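(* Let $\mathcal Z$ be an $m$-normal periodic orbit of minimal period $\tau$ of the conservative limit of $\dot x=f(x)+\varepsilon g(x,t;T,\varepsilon)$, let $p\in\mathcal Z$, let $l,m\in\mathbb N^+$ be relatively prime and let $\lambda=L(p,m\tau)$. The perturbed solutions of the problem $$\Delta_{l,L}(\xi,T,\varepsilon)=\begin{cases}x(lT;\xi,T,\varepsilon)-\xi\\ L(\xi,lT)-\lambda\end{cases}=0$$ of the form $\xi=x_0(s;p)+O(\varepsilon)$, $T=\tau m/l+O(\varepsilon)$, are (locally) in one-to-one correspondence with the zeros of a bifurcation function $$B^{m:l}_L(s,\varepsilon)=M^{m:l}(s)+O(\varepsilon),$$ whose leading-order term $$M^{m:l}(s)=\int_0^{m\tau}\big\langle DH(x_0(t+s;p)),\,g(x_0(t+s;p),t;\tau m/l,0)\big\rangle\,dt$$ is independent of the choice of the mapping $L$.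
   Context: **Mechanical system.** Let $N\ge1$, $n=2N$, $U\subset\mathbb R^N$ open, $q\in U$ generalised coordinates. The energy is $H(q,\dot q)=E(q,\dot q)+V(q)=\tfrac12\langle\dot q,\mathbf M(q)\dot q\rangle+V(q)$, with $\mathbf M(q)$ a symmetric positive definite mass matrix. The equations of motion are $\mathbf M(q)\ddot q+G(q,\dot q)+DV(q)=\varepsilon Q(q,\dot q,t;T,\varepsilon)$, where $\varepsilon\ge0$ is the perturbation parameter, $G(q,\dot q)=D_t(\mathbf M(q))\dot q-D_qE(q,\dot q)$, and $Q$ is $T$-periodic in $t$. With $x=(q,\dot q)\in\mathbb R^n$ this reads $\dot x=f(x)+\varepsilon g(x,t;T,\varepsilon)$, where $$f(x)=\begin{pmatrix}\dot q\\-\mathbf M^{-1}(q)(DV(q)+G(q,\dot q))\end{pmatrix},\qquad g(x,t;T,\varepsilon)=\begin{pmatrix}0\\ \mathbf M^{-1}(q)Q(q,\dot q,t;T,\varepsilon)\end{pmatrix}.$$ It is assumed that $f\in C^r$ with $r\ge2$, and $g$ is $C^{r-1}$ in $t$ and $C^r$ in the other arguments. $x(t;\xi,T,\varepsilon)$ is the trajectory starting from $\xi$ at $t=0$, and $x_0(t;\xi)=x(t;\xi,T,0)$; $H$ is conserved along $x_0$. **$m$-normality.** For a periodic orbit $\mathcal Z$ of $\dot x=f(x)$ of minimal period $\tau>0$ and $p\in\mathcal Z$, let $\Pi(p)=Y(\tau;p)$ be the monodromy matrix, where $\dot Y=Df(x_0(t;p))Y$, $Y(0)=I$. Let $\mu_{g,m}$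 be the geometric multiplicity of the eigenvalue $+1$ of $\Pi^m(p)$. $\mathcal Z$ is $m$-normal if either (a) $\mu_{g,m}=1$, or (b) $\mu_{g,m}=2$ and $f(p)\notin\mathrm{range}(\Pi^m(p)-I)$. An $m$-normal orbit belongs to a one-parameter family $\mathcal P$ of $m$-normal periodic orbits (a two-dimensional manifold), with family parameter $\lambda\in\mathbb R$. **Parametrisation $L$.** $L(\xi,\cdot)$ is a $C^r$ scalar mapping depending on the initial condition and on a period, invariant under translations of $\xi$ along the orbit, whose value identifies the orbits of the family. Near $\mathcal Z$ there are smooth maps $\lambda\mapsto\vartheta(\lambda)$ (initial condition on a Poincaré section) and $\lambda\mapsto\mathcal T(\lambda)$ (minimal period) parametrising the family, with $L(x_0(t;\vartheta(\lambda)),m\mathcal T(\lambda))=\lambda$ for all $t$. **Perturbed solutions.** For small $\varepsilon\neq0$, initial conditions near $\mathcal Z$ and periods are written as $\xi=z+\varepsilon\delta$ with $z=x_0(s;p)$ and $\delta$ orthogonal to $f(z)$ (the tangent direction of $\mathcal Z$ at $z$), and $T=(m\tau+\varepsilon\sigma)/l$, with $\sigma\in\mathbb R$. "Perturbed solutions of the form $\xi=x_0(s;p)+O(\varepsilon)$, $T=\tau m/l+O(\varepsilon)$" are the solutions of $\Delta_{l,L}=0$ with $(\delta,\sigma)$ bounded as $\varepsilon\to0$. The correspondence sends such a solution to $s$, where $B^{m:l}_L(s,\varepsilon)=0$. *)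

theory Defs
  imports "HOL-Analysis.Analysis"
begin

section \<open>Functions of class \<open>C\<^sup>k\<close>\<close>

primrec Ck_open :: "nat \<Rightarrow> 'a::euclidean_space set \<Rightarrow> ('a \<Rightarrow> 'b::real_normed_vector) \<Rightarrow> bool" where
  "Ck_open 0 S f \<longleftrightarrow> continuous_on S f"
| "Ck_open (Suc k) S f \<longleftrightarrow>
     (\<forall>x\<in>S. f differentiable (at x)) \<and>
     (\<forall>v. Ck_open k S (\<lambda>x. frechet_derivative f (at x) v))"

text \<open>On a set that need not be open (below: one with a boundary at \<open>\<epsilon> = 0\<close>), \<open>C\<^sup>k\<close> means having
  a \<open>C\<^sup>k\<close> extension to an open superset. For open sets this is the same as \<^const>\<open>Ck_open\<close>.\<close>

definition Ck_on :: "nat \<Rightarrow> 'a::euclidean_space set \<Rightarrow> ('a \<Rightarrow> 'b::real_normed_vector) \<Rightarrow> bool" where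
  "Ck_on k S f \<longleftrightarrow>
     (\<exists>S' F. open S' \<and> S \<subseteq> S' \<and> (\<forall>x\<in>S. F x = f x) \<and> Ck_open k S' F)"

text \<open>All derivatives of order at most \<open>k\<close> with respect to the first component exist and are
  continuous jointly in both components.\<close>

primrec Ck_fst_open ::
    "nat \<Rightarrow> ('a::euclidean_space \<times> 'b::euclidean_space) set \<Rightarrow> ('a \<times> 'b \<Rightarrow> 'c::real_normed_vector) \<Rightarrow> bool"
  where
  "Ck_fst_open 0 S g \<longleftrightarrow> continuous_on S g"
| "Ck_fst_open (Suc k) S g \<longleftrightarrow>
     continuous_on S g \<and>
     (\<forall>(y, t)\<in>S. (\<lambda>y'. g (y', t)) differentiable (at y)) \<and>
     (\<forall>v. Ck_fst_open k S (\<lambda>(y, t). frechet_derivative (\<lambda>y'. g (y', t)) (at y) v))"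

text \<open>\<open>C\<^sup>r\<close> in the first component and \<open>C\<^bsup>r-1\<^esup>\<close> in the second: jointly \<open>C\<^bsup>r-1\<^esup>\<close>, and in addition
  with jointly continuous derivatives up to order \<open>r\<close> in the first component.\<close>

definition Ck_fst_on ::
    "nat \<Rightarrow> ('a::euclidean_space \<times> 'b::euclidean_space) set \<Rightarrow> ('a \<times> 'b \<Rightarrow> 'c::real_normed_vector) \<Rightarrow> bool"
  where
  "Ck_fst_on r S g \<longleftrightarrow>
     (\<exists>S' F. open S' \<and> S \<subseteq> S' \<and> (\<forall>z\<in>S. F z = g z) \<and>
        Ck_open (r - 1) S' F \<and> Ck_fst_open r S' F)"

definition grad :: "('a::real_inner \<Rightarrow> real) \<Rightarrow> 'a \<Rightarrow> 'a" where
  "grad \<phi> x = (THE d. GDERIV \<phi> x :> d)"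


section \<open>Ordinary differential equations and periodic orbits\<close>

definition solves ::
    "'a set \<Rightarrow> (real \<Rightarrow> 'a \<Rightarrow> 'a) \<Rightarrow> real set \<Rightarrow> (real \<Rightarrow> 'a::real_normed_vector) \<Rightarrow> bool" where
  "solves X F J x \<longleftrightarrow>
     (\<forall>t\<in>J. x t \<in> X \<and> (x has_vector_derivative F t (x t)) (at t within J))"

text \<open>The value at time \<open>t\<close> of the solution starting from \<open>\<xi>\<close> at time \<open>0\<close> (meaningful when that
  solution exists up to time \<open>t\<close>).\<close>

definition traj ::
    "'a set \<Rightarrow> (real \<Rightarrow> 'a \<Rightarrow> 'a) \<Rightarrow> 'a::real_normed_vector \<Rightarrow> real \<Rightarrow> 'a" where
  "traj X F \<xi> t = (THE y. \<exists>x. solves X F (closed_segment 0 t) x \<and> x 0 = \<xi> \<and> x t = y)"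

definition flow0 :: "'a set \<Rightarrow> ('a \<Rightarrow> 'a) \<Rightarrow> real \<Rightarrow> 'a::real_normed_vector \<Rightarrow> 'a" where
  "flow0 X f t \<xi> = traj X (\<lambda>_. f) \<xi> t"

definition orbit :: "'a set \<Rightarrow> ('a \<Rightarrow> 'a) \<Rightarrow> 'a::real_normed_vector \<Rightarrow> 'a set" where
  "orbit X f p = range (\<lambda>t. flow0 X f t p)"

definition periodic_min ::
    "'a set \<Rightarrow> ('a \<Rightarrow> 'a) \<Rightarrow> 'a::real_normed_vector \<Rightarrow> real \<Rightarrow> bool" where
  "periodic_min X f p \<tau> \<longleftrightarrow>
     0 < \<tau> \<and>
     (\<exists>x. solves X (\<lambda>_. f) UNIV x \<and> x 0 = p \<and> (\<forall>t. x (t + \<tau>) = x t) \<and>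
        (\<forall>\<sigma>. 0 < \<sigma> \<and> \<sigma> < \<tau> \<longrightarrow> \<not> (\<forall>t. x (t + \<sigma>) = x t)))"

definition Dfield :: "('a \<Rightarrow> 'a) \<Rightarrow> 'a::real_normed_vector \<Rightarrow> 'a \<Rightarrow>\<^sub>L 'a" where
  "Dfield f x = Blinfun (frechet_derivative f (at x))"

text \<open>Matrices on the phase space are bounded linear maps; this is \<open>Y(\<tau>)\<close> for the matrix equation
  \<open>Y' = Df(x\<^sub>0(t;p)) Y\<close>, \<open>Y(0) = I\<close>.\<close>

definition monodromy :: "'a set \<Rightarrow> ('a \<Rightarrow> 'a) \<Rightarrow> 'a::real_normed_vector \<Rightarrow> real \<Rightarrow> 'a \<Rightarrow>\<^sub>L 'a" where
  "monodromy X f p \<tau> =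
     traj UNIV (\<lambda>t Y. Dfield f (flow0 X f t p) o\<^sub>L Y) id_blinfun \<tau>"

definition geom_mult :: "('a::euclidean_space \<Rightarrow> 'a) \<Rightarrow> real \<Rightarrow> nat" where
  "geom_mult A \<mu> = dim {v. A v = \<mu> *\<^sub>R v}"

definition m_normal ::
    "'a set \<Rightarrow> ('a \<Rightarrow> 'a) \<Rightarrow> nat \<Rightarrow> 'a::euclidean_space \<Rightarrow> real \<Rightarrow> bool" where
  "m_normal X f m p \<tau> \<longleftrightarrow>
     (let P = blinfun_apply (monodromy X f p \<tau>) ^^ m in
        geom_mult P 1 = 1 \<or>
        (geom_mult P 1 = 2 \<and> f p \<notin> range (\<lambda>v. P v - v)))"


section \<open>Parametrising the family of periodic orbits\<close>

definition poincare_section ::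
    "nat \<Rightarrow> ('a \<Rightarrow> 'a) \<Rightarrow> 'a::euclidean_space set \<Rightarrow> bool" where
  "poincare_section r f \<Sigma> \<longleftrightarrow>
     (\<exists>N \<phi>. open N \<and> Ck_on r N \<phi> \<and> \<Sigma> = {x\<in>N. \<phi> x = 0} \<and>
        (\<forall>x\<in>\<Sigma>. grad \<phi> x \<bullet> f x \<noteq> 0))"

text \<open>\<open>L\<close> parametrises, near the orbit of \<open>p\<close>, the family of \<open>m\<close>-normal periodic orbits to which it
  belongs. The final identity, holding for all \<open>t\<close>, contains the invariance of \<open>L\<close> under
  translations along the orbits as well as the fact that \<open>L\<close> separates them.\<close>

definition parametrises ::
    "'a set \<Rightarrow> ('a \<Rightarrow> 'a) \<Rightarrow> nat \<Rightarrow> nat \<Rightarrow> 'a::euclidean_space \<Rightarrow> real \<Rightarrow> ('a \<Rightarrow> real \<Rightarrow> real) \<Rightarrow> bool"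
  where
  "parametrises X f r m p \<tau> L \<longleftrightarrow>
     (\<exists>W. open W \<and> orbit X f p \<times> {real m * \<tau>} \<subseteq> W \<and> Ck_on r W (\<lambda>(\<xi>, T). L \<xi> T)) \<and>
     (\<exists>\<Lambda> \<theta> \<T> \<Sigma>. open \<Lambda> \<and> L p (real m * \<tau>) \<in> \<Lambda> \<and>
        Ck_on r \<Lambda> \<theta> \<and> Ck_on r \<Lambda> \<T> \<and>
        poincare_section r f \<Sigma> \<and> \<theta> ` \<Lambda> \<subseteq> \<Sigma> \<and>
        \<theta> (L p (real m * \<tau>)) \<in> orbit X f p \<and> \<T> (L p (real m * \<tau>)) = \<tau> \<and>
        (\<forall>c\<in>\<Lambda>. periodic_min X f (\<theta> c) (\<T> c) \<and> m_normal X f m (\<theta> c) (\<T> c) \<and>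
           (\<forall>t. L (flow0 X f t (\<theta> c)) (real m * \<T> c) = c)))"


section \<open>The mechanical system\<close>

type_synonym 'n state = "(real ^ 'n) \<times> (real ^ 'n)"

definition kinetic :: "(real ^ 'n \<Rightarrow> real ^ 'n ^ 'n) \<Rightarrow> real ^ 'n \<Rightarrow> real ^ 'n \<Rightarrow> real" where
  "kinetic Ms q v = (v \<bullet> (Ms q *v v)) / 2"

definition energy ::
    "(real ^ 'n \<Rightarrow> real ^ 'n ^ 'n) \<Rightarrow> (real ^ 'n \<Rightarrow> real) \<Rightarrow> 'n state \<Rightarrow> real" where
  "energy Ms V = (\<lambda>(q, v). kinetic Ms q v + V q)"

text \<open>Along a motion, \<open>D\<^sub>t(M(q))\<close> is the derivative of \<open>M\<close> at \<open>q\<close> in the direction \<open>v\<close>, where \<open>v\<close>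
  is the velocity.\<close>

definition gyro :: "(real ^ 'n \<Rightarrow> real ^ 'n ^ 'n) \<Rightarrow> real ^ 'n \<Rightarrow> real ^ 'n \<Rightarrow> real ^ 'n" where
  "gyro Ms q v = frechet_derivative Ms (at q) v *v v - grad (\<lambda>q'. kinetic Ms q' v) q"

definition cons_field ::
    "(real ^ 'n \<Rightarrow> real ^ 'n ^ 'n) \<Rightarrow> (real ^ 'n \<Rightarrow> real) \<Rightarrow> 'n state \<Rightarrow> 'n state" where
  "cons_field Ms V = (\<lambda>(q, v). (v, - (matrix_inv (Ms q) *v (grad V q + gyro Ms q v))))"

text \<open>The arguments of the forcing \<open>Q\<close> are \<open>q\<close>, the velocity, \<open>t\<close>, \<open>T\<close> and \<open>\<epsilon>\<close>, in this order.\<close>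

type_synonym 'n forcing =
  "real ^ 'n \<Rightarrow> real ^ 'n \<Rightarrow> real \<Rightarrow> real \<Rightarrow> real \<Rightarrow> real ^ 'n"

definition pert_field ::
    "(real ^ 'n \<Rightarrow> real ^ 'n ^ 'n) \<Rightarrow> 'n forcing \<Rightarrow> 'n state \<Rightarrow> real \<Rightarrow> real \<Rightarrow> real \<Rightarrow> 'n state" where
  "pert_field Ms Q = (\<lambda>(q, v) t T \<epsilon>. (0, matrix_inv (Ms q) *v Q q v t T \<epsilon>))"

definition mech_system ::
    "(real ^ 'n) set \<Rightarrow> (real ^ 'n \<Rightarrow> real ^ 'n ^ 'n) \<Rightarrow> (real ^ 'n \<Rightarrow> real) \<Rightarrow> 'n forcing \<Rightarrow> nat \<Rightarrow> bool"
  where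
  "mech_system U Ms V Q r \<longleftrightarrow>
     open U \<and> 2 \<le> r \<and>
     (\<forall>q\<in>U. transpose (Ms q) = Ms q \<and> (\<forall>v. v \<noteq> 0 \<longrightarrow> 0 < v \<bullet> (Ms q *v v))) \<and>
     (\<forall>q\<in>U. Ms differentiable (at q) \<and> V differentiable (at q)) \<and>
     (\<forall>q\<in>U. \<forall>v t. \<forall>T>0. \<forall>\<epsilon>\<ge>0. Q q v (t + T) T \<epsilon> = Q q v t T \<epsilon>) \<and>
     Ck_on r (U \<times> UNIV) (cons_field Ms V) \<and>
     Ck_fst_on r (((U \<times> UNIV) \<times> {0<..} \<times> {0..}) \<times> UNIV)
       (\<lambda>((x, T, \<epsilon>), t). pert_field Ms Q x t T \<epsilon>)"


section \<open>Perturbed solutions and the Melnikov function\<close>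

text \<open>\<open>x(t;\<xi>,T,\<epsilon>)\<close>\<close>

definition pert_traj ::
    "'a set \<Rightarrow> ('a \<Rightarrow> 'a) \<Rightarrow> ('a \<Rightarrow> real \<Rightarrow> real \<Rightarrow> real \<Rightarrow> 'a) \<Rightarrow> real \<Rightarrow> 'a::real_normed_vector \<Rightarrow>
     real \<Rightarrow> real \<Rightarrow> 'a" where
  "pert_traj X f g t \<xi> T \<epsilon> = traj X (\<lambda>u x. f x + \<epsilon> *\<^sub>R g x u T \<epsilon>) \<xi> t"

definition displacement ::
    "'a set \<Rightarrow> ('a \<Rightarrow> 'a) \<Rightarrow> ('a \<Rightarrow> real \<Rightarrow> real \<Rightarrow> real \<Rightarrow> 'a) \<Rightarrow> nat \<Rightarrow> ('a \<Rightarrow> real \<Rightarrow> real) \<Rightarrow> real \<Rightarrow>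
     'a::real_normed_vector \<Rightarrow> real \<Rightarrow> real \<Rightarrow> 'a \<times> real" where
  "displacement X f g l L c \<xi> T \<epsilon> =
     (pert_traj X f g (real l * T) \<xi> T \<epsilon> - \<xi>, L \<xi> (real l * T) - c)"

text \<open>\<open>\<xi> = z + \<epsilon>\<delta>\<close> and \<open>T = (m\<tau> + \<epsilon>\<sigma>)/l\<close> with \<open>z = x\<^sub>0(s;p)\<close>, \<open>\<delta>\<close> orthogonal to \<open>f(z)\<close>, and
  \<open>\<delta>\<close>, \<open>\<sigma>\<close> bounded by \<open>R\<close>.\<close>

definition pert_form ::
    "'a set \<Rightarrow> ('a \<Rightarrow> 'a) \<Rightarrow> nat \<Rightarrow> nat \<Rightarrow> 'a::real_inner \<Rightarrow> real \<Rightarrow> real \<Rightarrow> real \<Rightarrow> real \<Rightarrow>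
     'a \<Rightarrow> real \<Rightarrow> bool" where
  "pert_form X f m l p \<tau> R \<epsilon> s \<xi> T \<longleftrightarrow>
     (\<exists>\<delta> \<sigma>. norm \<delta> \<le> R \<and> \<bar>\<sigma>\<bar> \<le> R \<and> \<delta> \<bullet> f (flow0 X f s p) = 0 \<and>
        \<xi> = flow0 X f s p + \<epsilon> *\<^sub>R \<delta> \<and> T = (real m * \<tau> + \<epsilon> * \<sigma>) / real l)"

definition pert_solutions ::
    "'a set \<Rightarrow> ('a \<Rightarrow> 'a) \<Rightarrow> ('a \<Rightarrow> real \<Rightarrow> real \<Rightarrow> real \<Rightarrow> 'a) \<Rightarrow> nat \<Rightarrow> nat \<Rightarrow> 'a::real_inner \<Rightarrow> real \<Rightarrow>
     ('a \<Rightarrow> real \<Rightarrow> real) \<Rightarrow> real \<Rightarrow> real \<Rightarrow> ('a \<times> real) set" where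
  "pert_solutions X f g m l p \<tau> L R \<epsilon> =
     {(\<xi>, T). displacement X f g l L (L p (real m * \<tau>)) \<xi> T \<epsilon> = 0 \<and>
        (\<exists>s. pert_form X f m l p \<tau> R \<epsilon> s \<xi> T)}"

definition melnikov ::
    "'a set \<Rightarrow> ('a \<Rightarrow> 'a) \<Rightarrow> ('a \<Rightarrow> real \<Rightarrow> real \<Rightarrow> real \<Rightarrow> 'a) \<Rightarrow> ('a \<Rightarrow> real) \<Rightarrow> nat \<Rightarrow> nat \<Rightarrow>
     'a::real_inner \<Rightarrow> real \<Rightarrow> real \<Rightarrow> real" where
  "melnikov X f g H m l p \<tau> s =
     integral {0..real m * \<tau>}
       (\<lambda>t. grad H (flow0 X f (t + s) p) \<bullet>
            g (flow0 X f (t + s) p) t (\<tau> * real m / real l) 0)"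

text \<open>\<open>B\<close> is a bifurcation function with leading-order term \<open>M\<close>. The phase \<open>s\<close> is a point of the
  circle of length \<open>\<tau>\<close>, hence the periodicity of \<open>B\<close> and the restriction of its zeros to
  \<open>[0, \<tau>)\<close>. Solutions with \<open>(\<delta>, \<sigma>)\<close> bounded as \<open>\<epsilon>\<close> tends to \<open>0\<close> are captured by requiring the
  correspondence, for all \<open>\<epsilon>\<close> small depending on \<open>R\<close>, for every sufficiently large bound \<open>R\<close>.\<close>

definition bifurcation_function ::
    "'a set \<Rightarrow> ('a \<Rightarrow> 'a) \<Rightarrow> ('a \<Rightarrow> real \<Rightarrow> real \<Rightarrow> real \<Rightarrow> 'a) \<Rightarrow> nat \<Rightarrow> nat \<Rightarrow> 'a::real_inner \<Rightarrow> real \<Rightarrow>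
     ('a \<Rightarrow> real \<Rightarrow> real) \<Rightarrow> (real \<Rightarrow> real) \<Rightarrow> (real \<Rightarrow> real \<Rightarrow> real) \<Rightarrow> bool" where
  "bifurcation_function X f g m l p \<tau> L M B \<longleftrightarrow>
     (\<exists>\<epsilon>1>0.
        Ck_on 1 (UNIV \<times> {0..<\<epsilon>1}) (\<lambda>(s, \<epsilon>). B s \<epsilon>) \<and>
        (\<forall>s. \<forall>\<epsilon>\<in>{0..<\<epsilon>1}. B (s + \<tau>) \<epsilon> = B s \<epsilon>) \<and>
        (\<exists>C. \<forall>s. \<forall>\<epsilon>\<in>{0..<\<epsilon>1}. \<bar>B s \<epsilon> - M s\<bar> \<le> C * \<epsilon>) \<and>
        (\<exists>R0. \<forall>R\<ge>R0. \<exists>\<epsilon>0>0. \<epsilon>0 \<le> \<epsilon>1 \<and> (\<forall>\<epsilon>. 0 < \<epsilon> \<and> \<epsilon> < \<epsilon>0 \<longrightarrow>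
           (\<exists>h. bij_betw h (pert_solutions X f g m l p \<tau> L R \<epsilon>) {s\<in>{0..<\<tau>}. B s \<epsilon> = 0} \<and>
              (\<forall>(\<xi>, T)\<in>pert_solutions X f g m l p \<tau> L R \<epsilon>. \<forall>s\<in>{0..<\<tau>}.
                 pert_form X f m l p \<tau> R \<epsilon> s \<xi> T \<longleftrightarrow> s = h (\<xi>, T))))))"

end

theory Submission
  imports Defs
begin

text \<open>
  The proof is a Lyapunov--Schmidt reduction, carried out after dividing all equations by \<open>\<epsilon>\<close>.

  Let \<open>z\<close> be the periodic solution through \<open>p\<close>, \<open>\<omega> = m \<tau>\<close> and \<open>\<phi>\<close> the flow of \<open>f\<close>. A trajectory near the
  orbit is written as \<open>x(t) = z(t + s) + \<epsilon> y(t)\<close>. Then \<open>y\<close> solves an equation that is regular at \<open>\<epsilon> = 0\<close>,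
  where it becomes linear, \<open>y' = Df(z(t + s)) y + g(z(t + s), t; \<omega>/l, 0)\<close>. As \<open>f\<close> is \<open>C\<^sup>2\<close>, the difference
  quotients \<open>(f(x + \<epsilon>y) - f(x)) / \<epsilon>\<close> occurring in it are \<open>C\<^sup>1\<close> across \<open>\<epsilon> = 0\<close> (\<open>mean_deriv_C1\<close>), and so
  is \<open>y\<close>, by the \<open>C\<^sup>1\<close> dependence of solutions on initial values and parameters (\<open>unit_map_C1\<close>). With
  \<open>\<xi> = z(s) + \<epsilon>\<delta>\<close> and \<open>l T = \<omega> + \<epsilon>\<sigma>\<close>, the two equations \<open>\<Delta> = 0\<close>, divided by \<open>\<epsilon>\<close>, and the orthogonality of
  \<open>\<delta>\<close> to \<open>f(z(s))\<close> thus form a \<open>C\<^sup>1\<close> system in \<open>(s, \<epsilon>, \<delta>, \<sigma>)\<close>, affine in \<open>(\<delta>, \<sigma>)\<close> at \<open>\<epsilon> = 0\<close>, with linear part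
  \<open>(\<delta>, \<sigma>) \<mapsto> ((\<Pi> - I) \<delta> + \<sigma> f(z(s)), DL (\<delta>, \<sigma>), \<delta> \<bullet> f(z(s)))\<close>, \<open>\<Pi>\<close> being the derivative of \<open>\<phi>\<^sub>\<omega>\<close> at \<open>z(s)\<close>.

  By \<open>m\<close>-normality this linear part is injective (\<open>nondegenerate\<close>). Its range has codimension one, and
  conservation of energy identifies it: \<open>H \<circ> \<phi>\<^sub>\<omega> = H\<close> makes \<open>grad H(z(s))\<close> orthogonal to the range of
  \<open>\<Pi> - I\<close> and to \<open>f(z(s))\<close>. Adding an unknown multiple \<open>b\<close> of a vector \<open>e(s)\<close> with
  \<open>grad H(z(s)) \<bullet> e(s) = 1\<close> therefore makes the system uniquely solvable, uniformly in the phase \<open>s\<close>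
  (\<open>affine_perturbation_zeros\<close>), and \<open>B(s, \<epsilon>)\<close> is the component \<open>b\<close> of its solution: genuine solutions
  are those with \<open>b = 0\<close>. At \<open>\<epsilon> = 0\<close>, pairing the first equation with \<open>grad H(z(s))\<close> leaves
  \<open>b = M(s)\<close>, since \<open>grad H\<close> along the orbit solves the adjoint of the variational equation
  (\<open>gradH_deriv\<close>, \<open>dev_end_melnikov\<close>). In particular \<open>L\<close> does not enter \<open>M\<close>. Finally, the pair
  \<open>(s, \<delta>)\<close> is determined by \<open>\<xi>\<close> for small \<open>\<epsilon>\<close> (\<open>tubular_injective\<close>), so that zeros of \<open>B\<close> and solutions
  of \<open>\<Delta> = 0\<close> correspond one to one.
\<close>

section \<open>Continuously differentiable maps and preliminaries\<close>

definition blinderiv :: "('a::real_normed_vector \<Rightarrow> 'b::real_normed_vector) \<Rightarrow> 'a \<Rightarrow> 'a \<Rightarrow>\<^sub>L 'b" where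
  "blinderiv f x = Blinfun (frechet_derivative f (at x))"

definition C1 :: "'a::real_normed_vector set \<Rightarrow> ('a \<Rightarrow> 'b::real_normed_vector) \<Rightarrow> bool" where
  "C1 S f \<longleftrightarrow> (\<forall>x\<in>S. f differentiable (at x)) \<and> continuous_on S (blinderiv f)"

lemma blinderiv_works:
  assumes "f differentiable (at x)"
  shows "(f has_derivative blinfun_apply (blinderiv f x)) (at x)"
proof -
  have "(f has_derivative frechet_derivative f (at x)) (at x)"
    using assms frechet_derivative_works by blast
  moreover have "bounded_linear (frechet_derivative f (at x))"
    using calculation has_derivative_bounded_linear by blast
  ultimately show ?thesis by (simp add: blinderiv_def bounded_linear_Blinfun_apply)
qed

lemma blinderiv_eq:
  assumes "(f has_derivative blinfun_apply D) (at x)"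
  shows "blinderiv f x = D"
  by (metis assms blinderiv_def blinfun_apply_inverse frechet_derivative_at)

lemma C1_I:
  assumes "\<And>x. x \<in> S \<Longrightarrow> (f has_derivative blinfun_apply (D x)) (at x)" "continuous_on S D"
  shows "C1 S f"
  using assms blinderiv_eq[OF assms(1)] unfolding C1_def
  by (metis (no_types, lifting) continuous_on_cong differentiable_def)

lemma C1_has_derivative:
  "C1 S f \<Longrightarrow> x \<in> S \<Longrightarrow> (f has_derivative blinfun_apply (blinderiv f x)) (at x)"
  by (simp add: C1_def blinderiv_works)

lemma C1_continuous_deriv: "C1 S f \<Longrightarrow> continuous_on S (blinderiv f)"
  by (simp add: C1_def)

lemma C1_continuous_on: "C1 S f \<Longrightarrow> continuous_on S f"
  by (meson C1_def continuous_at_imp_continuous_on differentiable_imp_continuous_within)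

lemma C1_subset: "C1 S f \<Longrightarrow> T \<subseteq> S \<Longrightarrow> C1 T f"
  by (meson C1_def continuous_on_subset subset_eq)

lemma C1_compose:
  assumes g: "C1 T g" and f: "C1 S f" and "f ` S \<subseteq> T"
  shows "C1 S (\<lambda>x. g (f x))"
proof (rule C1_I)
  show "((\<lambda>x. g (f x)) has_derivative blinfun_apply (blinderiv g (f x) o\<^sub>L blinderiv f x)) (at x)"
    if "x \<in> S" for x
    using has_derivative_compose[OF C1_has_derivative[OF f that] C1_has_derivative[OF g, of "f x"]]
      that assms(3) by (auto simp: blinfun_compose.rep_eq o_def)
  show "continuous_on S (\<lambda>x. blinderiv g (f x) o\<^sub>L blinderiv f x)"
    using assms by (intro continuous_intros continuous_on_compose2[OF C1_continuous_deriv[OF g]]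
        C1_continuous_on C1_continuous_deriv) auto
qed

lemma C1_linear: "bounded_linear f \<Longrightarrow> C1 S f"
  by (rule C1_I[where D="\<lambda>_. Blinfun f"])
    (auto simp: bounded_linear_Blinfun_apply bounded_linear_imp_has_derivative)

lemma C1_compose_linear: "bounded_linear h \<Longrightarrow> C1 S f \<Longrightarrow> C1 S (\<lambda>x. h (f x))"
  by (rule C1_compose[OF C1_linear[of h UNIV]]) auto

lemma C1_const: "C1 S (\<lambda>_. c)"
  by (rule C1_I[where D="\<lambda>_. 0"]) (auto simp: zero_blinfun.rep_eq)

lemma C1_ident: "C1 S (\<lambda>x. x)"
  by (simp add: C1_linear bounded_linear_ident)

lemma C1_add: 
  assumes "C1 S f" "C1 S g" shows "C1 S (\<lambda>x. f x + g x)"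
  by (rule C1_I[where D="\<lambda>x. blinderiv f x + blinderiv g x"])
    (use assms in \<open>auto intro!: continuous_intros C1_continuous_deriv derivative_eq_intros 
       C1_has_derivative simp: plus_blinfun.rep_eq\<close>)

lemma C1_sum: "finite I \<Longrightarrow> (\<And>i. i \<in> I \<Longrightarrow> C1 S (f i)) \<Longrightarrow> C1 S (\<lambda>x. \<Sum>i\<in>I. f i x)"
  by (induction I rule: finite_induct) (auto intro: C1_const C1_add)

lemma C1_minus: "C1 S f \<Longrightarrow> C1 S (\<lambda>x. - f x)"
  by (rule C1_compose_linear) (auto intro: bounded_linear_minus bounded_linear_ident)

lemma C1_diff: "C1 S f \<Longrightarrow> C1 S g \<Longrightarrow> C1 S (\<lambda>x. f x - g x)"
  using C1_add[OF _ C1_minus, of S f g] by simp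

lemma C1_fst: "C1 S f \<Longrightarrow> C1 S (\<lambda>x. fst (f x))"
  by (rule C1_compose_linear[OF bounded_linear_fst])

lemma C1_snd: "C1 S f \<Longrightarrow> C1 S (\<lambda>x. snd (f x))"
  by (rule C1_compose_linear[OF bounded_linear_snd])

lemma C1_Pair:
  assumes "C1 S f" "C1 S g" shows "C1 S (\<lambda>x. (f x, g x))"
proof -
  have "bounded_linear (\<lambda>x::'b. (x, 0::'c))" "bounded_linear (\<lambda>x::'c. (0::'b, x))"
    by (auto intro!: bounded_linear_Pair bounded_linear_ident bounded_linear_zero)
  from C1_add[OF C1_compose_linear[OF this(1) assms(1)] C1_compose_linear[OF this(2) assms(2)]]
  show ?thesis by simp
qed

lemma norm_fst_snd_le: "norm (fst q) \<le> norm q" "norm (snd q) \<le> norm q"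
  by (metis norm_fst_le prod.collapse, metis norm_snd_le prod.collapse)

text \<open>The derivative \<open>(h, k) \<mapsto> a k + h b\<close> of a bilinear map at \<open>(a, b)\<close> is itself linear and
  bounded in \<open>(a, b)\<close>, so its continuity comes for free.\<close>

lemma C1_bilinear:
  assumes B: "bounded_bilinear B" and f: "C1 S f" and g: "C1 S g"
  shows "C1 S (\<lambda>x. B (f x) (g x))"
proof -
  interpret bounded_bilinear B by fact
  obtain K where K: "\<And>a b. norm (B a b) \<le> norm a * norm b * K" and "K \<ge> 0"
    using nonneg_bounded by blast
  define D where "D = (\<lambda>p. Blinfun (\<lambda>q. B (fst p) (snd q) + B (fst q) (snd p)))"
  have bl: "bounded_linear (\<lambda>q. B (fst p) (snd q) + B (fst q) (snd p))" for p
    by (intro bounded_linear_add bounded_linear_compose[OF bounded_linear_right]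
        bounded_linear_compose[OF bounded_linear_left] bounded_linear_fst bounded_linear_snd)
  have D: "blinfun_apply (D p) q = B (fst p) (snd q) + B (fst q) (snd p)" for p q
    unfolding D_def by (subst bounded_linear_Blinfun_apply[OF bl]) simp
  have "bounded_linear D"
  proof (rule bounded_linear_intro[where K="2*K"])
    show "norm (D p) \<le> norm p * (2*K)" for p
    proof (rule norm_blinfun_bound)
      show "norm (blinfun_apply (D p) q) \<le> norm p * (2*K) * norm q" for q
      proof -
        have "norm (B (fst p) (snd q)) \<le> norm p * norm q * K"
          by (rule order_trans[OF K]) 
            (intro mult_right_mono mult_mono norm_fst_snd_le \<open>K \<ge> 0\<close>, auto)
        moreover have "norm (B (fst q) (snd p)) \<le> norm q * norm p * K"
          by (rule order_trans[OF K]) 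
            (intro mult_right_mono mult_mono norm_fst_snd_le \<open>K \<ge> 0\<close>, auto)
        ultimately have "norm (blinfun_apply (D p) q) \<le> norm p * norm q * K + norm q * norm p * K"
          unfolding D by (meson add_mono norm_triangle_le)
        then show ?thesis by (simp add: algebra_simps)
      qed
    qed (use \<open>K \<ge> 0\<close> in auto)
  qed (auto intro!: blinfun_eqI simp: D plus_blinfun.rep_eq scaleR_blinfun.rep_eq add_left add_right 
        scaleR_left scaleR_right algebra_simps)
  then have "C1 UNIV (\<lambda>p. B (fst p) (snd p))"
    by (intro C1_I[where D=D]) 
      (auto simp: D[abs_def] linear_continuous_on intro!: FDERIV derivative_eq_intros)
  from C1_compose[OF this C1_Pair[OF f g]] show ?thesis by simp
qed

lemmas C1_scaleR = C1_bilinear[OF bounded_bilinear_scaleR]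
lemmas C1_mult = C1_bilinear[OF bounded_bilinear_mult]
lemmas C1_inner = C1_bilinear[OF bounded_bilinear_inner]
lemmas C1_blinfun_apply = C1_bilinear[OF bounded_bilinear_blinfun_apply]

lemmas C1_intros = C1_const C1_ident C1_add C1_diff C1_minus C1_fst C1_snd C1_Pair C1_scaleR
  C1_mult C1_inner C1_blinfun_apply

lemma C1_local:
  assumes "\<And>x. x \<in> S \<Longrightarrow> \<exists>N. open N \<and> x \<in> N \<and> C1 N f"
  shows "C1 S f"
  unfolding C1_def
proof (intro conjI ballI)
  show "f differentiable at x" if "x \<in> S" for x
    using assms[OF that] by (auto simp: C1_def)
  show "continuous_on S (blinderiv f)"
  proof (rule continuous_at_imp_continuous_on, rule ballI)
    fix x assume "x \<in> S"
    then obtain N where "open N" "x \<in> N" "C1 N f" using assms by blast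
    then show "isCont (blinderiv f) x"
      using C1_continuous_deriv continuous_on_eq_continuous_at by blast
  qed
qed

lemma blinderiv_cong:
  assumes "open S" "x \<in> S" "\<And>y. y \<in> S \<Longrightarrow> f y = g y" "f differentiable at x"
  shows "blinderiv g x = blinderiv f x"
  using assms by (intro blinderiv_eq has_derivative_transform_within_open[OF blinderiv_works]) auto

lemma C1_cong:
  assumes "open S" "\<And>y. y \<in> S \<Longrightarrow> f y = g y" "C1 S f"
  shows "C1 S g"
proof (rule C1_I[where D="blinderiv f"])
  show "(g has_derivative blinfun_apply (blinderiv f x)) (at x)" if "x \<in> S" for x
    by (rule has_derivative_transform_within_open[OF C1_has_derivative[OF assms(3) that] assms(1) that])
      (use assms in auto)
qed (use C1_continuous_deriv assms in blast)

lemma Ck_open_continuous: "Ck_open k S f \<Longrightarrow> continuous_on S f"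
  by (cases k) (auto intro!: continuous_at_imp_continuous_on differentiable_imp_continuous_within)

lemma blinderiv_basis:
  fixes f :: "'a::euclidean_space \<Rightarrow> 'b::real_normed_vector"
  assumes "f differentiable at x"
  shows "blinderiv f x = (\<Sum>b\<in>Basis. blinfun_scaleR_left (frechet_derivative f (at x) b) o\<^sub>L blinfun_inner_left b)"
proof (rule blinfun_eqI)
  fix v
  have lin: "linear (frechet_derivative f (at x))"
    using assms linear_frechet_derivative by blast
  have "blinderiv f x v = frechet_derivative f (at x) (\<Sum>b\<in>Basis. (v \<bullet> b) *\<^sub>R b)"
    using blinderiv_works[OF assms] frechet_derivative_at by (metis euclidean_representation)
  also have "\<dots> = (\<Sum>b\<in>Basis. (v \<bullet> b) *\<^sub>R frechet_derivative f (at x) b)"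
    by (simp add: linear_sum[OF lin] linear_cmul[OF lin])
  finally show "blinderiv f x v = (\<Sum>b\<in>Basis. blinfun_scaleR_left (frechet_derivative f (at x) b) o\<^sub>L blinfun_inner_left b) v"
    by (simp add: blinfun.sum_left inner_commute)
qed

lemma Ck_open_C1: 
  assumes "Ck_open (Suc k) S f"
  shows "C1 S f"
proof (rule C1_I)
  show "(f has_derivative blinfun_apply (blinderiv f x)) (at x)" if "x \<in> S" for x
    using assms that by (auto intro: blinderiv_works)
  have "continuous_on S (\<lambda>x. frechet_derivative f (at x) b)" for b
    using assms by (intro Ck_open_continuous[of k]) simp
  then have "continuous_on S (\<lambda>x. \<Sum>b\<in>Basis. blinfun_scaleR_left (frechet_derivative f (at x) b) o\<^sub>L blinfun_inner_left b)"
    by (auto intro!: continuous_intros)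
  then show "continuous_on S (blinderiv f)"
    using assms by (subst continuous_on_cong[OF refl blinderiv_basis]) auto
qed

lemma C1_blinfun_compose_const: "C1 S f \<Longrightarrow> C1 S (\<lambda>x. blinfun_scaleR_left (f x) o\<^sub>L c)"
  by (intro C1_compose_linear[OF bounded_linear_blinfun_scaleR_left]
      C1_bilinear[OF bounded_bilinear_blinfun_compose] C1_const)

text \<open>In finite dimension \<open>Df(x) = \<Sum>\<^sub>b D\<^sub>b f(x) \<otimes> b\<close> is a fixed linear function of finitely many directional
  derivatives, which are the data of \<^const>\<open>Ck_open\<close>.\<close>

lemma Ck_open_C2:
  assumes "open S" "Ck_open (Suc (Suc k)) S f"
  shows "C1 S (blinderiv f)"
proof (rule C1_cong[OF assms(1)])
  show "C1 S (\<lambda>x. \<Sum>b\<in>Basis. blinfun_scaleR_left (frechet_derivative f (at x) b) o\<^sub>L blinfun_inner_left b)"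
    using assms by (intro C1_sum C1_blinfun_compose_const Ck_open_C1[of k]) auto
  show "(\<Sum>b\<in>Basis. blinfun_scaleR_left (frechet_derivative f (at y) b) o\<^sub>L blinfun_inner_left b) = blinderiv f y"
    if "y \<in> S" for y
    using assms that by (subst blinderiv_basis) auto
qed

lemma C1_Ck_open: "C1 S f \<Longrightarrow> Ck_open 1 S f"
proof -
  assume C: "C1 S f"
  have "continuous_on S (\<lambda>x. frechet_derivative f (at x) v)" for v
  proof -
    have "continuous_on S (\<lambda>x. blinderiv f x v)"
      by (intro continuous_intros C1_continuous_deriv C)
    moreover have "blinderiv f x v = frechet_derivative f (at x) v" if "x \<in> S" for x
      using C1_has_derivative[OF C that] frechet_derivative_at by metis
    ultimately show ?thesis using continuous_on_cong by (metis (no_types, lifting))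
  qed
  then show ?thesis using C by (simp add: C1_def)
qed

lemma bounded_on_compact:
  fixes h :: "'a::topological_space \<Rightarrow> 'b::real_normed_vector"
  assumes "continuous_on T h" "compact T"
  obtains K where "K > 0" "\<And>t. t \<in> T \<Longrightarrow> norm (h t) \<le> K"
  using compact_imp_bounded[OF compact_continuous_image[OF assms]] that
  unfolding bounded_pos by blast

lemma reduce_period:
  fixes s \<tau> :: real
  assumes "\<tau> > 0"
  shows "\<exists>s'\<in>{0..<\<tau>}. \<exists>k::int. s = s' + of_int k * \<tau>"
proof (intro bexI exI)
  show "s = (s - of_int \<lfloor>s / \<tau>\<rfloor> * \<tau>) + of_int \<lfloor>s / \<tau>\<rfloor> * \<tau>" by simp
  have "of_int \<lfloor>s / \<tau>\<rfloor> * \<tau> \<le> s" "s < (of_int \<lfloor>s / \<tau>\<rfloor> + 1) * \<tau>"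
    using assms by (simp_all add: pos_le_divide_eq[symmetric] pos_divide_less_eq[symmetric])
  then show "s - of_int \<lfloor>s / \<tau>\<rfloor> * \<tau> \<in> {0..<\<tau>}" by (simp add: algebra_simps)
qed

section \<open>Existence, uniqueness and smooth dependence for differential equations\<close>

text \<open>The function \<open>exp (-(2K + 1) t) |u|\<^sup>2 - c\<^sup>2 t\<close> is nonincreasing because
  \<open>2 u \<bullet> u' \<le> 2K |u|\<^sup>2 + 2c |u| \<le> (2K + 1) |u|\<^sup>2 + c\<^sup>2\<close>.\<close>

lemma gronwall:
  fixes u :: "real \<Rightarrow> 'a::real_inner"
  assumes d: "\<And>t. t \<in> {0..1} \<Longrightarrow> (u has_vector_derivative u' t) (at t within {0..1})"
    and b: "\<And>t. t \<in> {0..1} \<Longrightarrow> norm (u' t) \<le> K * norm (u t) + c"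
    and K: "K \<ge> 0" and c: "c \<ge> 0" and t: "t \<in> {0..1}"
  shows "norm (u t) \<le> exp (K + 1) * (norm (u 0) + c)"
proof (cases "t = 0")
  case True
  have "1 \<le> exp (K+1)" using K by simp
  then have "1 * (norm (u 0) + c) \<le> exp (K + 1) * (norm (u 0) + c)"
    using c by (intro mult_right_mono) auto
  then show ?thesis using True c by simp
next
  case False
  define a where "a = 2*K+1"
  have a: "a > 0" using K by (simp add: a_def)
  define \<phi> where "\<phi> = (\<lambda>t. exp (- (a * t)) * (u t \<bullet> u t) - c\<^sup>2 * t)"
  have cont_u: "continuous_on {0..1} u"
    using d by (meson continuous_on_eq_continuous_within has_vector_derivative_continuous)
  have "\<phi> t \<le> \<phi> 0"
  proof (rule DERIV_nonpos_imp_decreasing_open[where f=\<phi> and a=0 and b=t])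
    show "0 \<le> t" using t by simp
    show "continuous_on {0..t} \<phi>" unfolding \<phi>_def
      using t by (intro continuous_intros continuous_on_subset[OF cont_u]) auto
    fix x assume x: "0 < x" "x < t"
    have "(u has_vector_derivative u' x) (at x)"
      using d[of x] x t by (simp add: at_within_Icc_at)
    then have du: "(u has_derivative (\<lambda>h. h *\<^sub>R u' x)) (at x)" by (simp add: has_vector_derivative_def)
    let ?y = "exp (- (a * x)) * (2 * (u x \<bullet> u' x) - a * (u x \<bullet> u x)) - c\<^sup>2"
    have "(\<phi> has_derivative (\<lambda>h. h * ?y)) (at x)"
      unfolding \<phi>_def 
      by (rule derivative_eq_intros du refl)+ (auto simp: algebra_simps inner_commute)
    then have "DERIV \<phi> x :> ?y" 
      unfolding has_field_derivative_def by (rule has_derivative_eq_rhs) (auto simp: mult.commute)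
    moreover have "?y \<le> 0"
    proof -
      have "u x \<bullet> u' x \<le> norm (u x) * (K * norm (u x) + c)"
        using norm_cauchy_schwarz[of "u x" "u' x"] b[of x] x t 
        mult_left_mono[of "norm (u' x)" "K * norm (u x) + c" "norm (u x)"] by auto
      moreover have "0 \<le> (norm (u x) - c)\<^sup>2" by simp
      ultimately have "2 * (u x \<bullet> u' x) \<le> a * (u x \<bullet> u x) + c\<^sup>2"
        unfolding dot_square_norm by (simp add: a_def power2_eq_square algebra_simps)
      then have 1: "2 * (u x \<bullet> u' x) - a * (u x \<bullet> u x) \<le> c\<^sup>2" by simp
      have "exp (- (a * x)) * (2 * (u x \<bullet> u' x) - a * (u x \<bullet> u x)) \<le> exp (- (a * x)) * c\<^sup>2"
        by (rule mult_left_mono[OF 1]) simp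
      also have "\<dots> \<le> 1 * c\<^sup>2"
        using a x by (intro mult_right_mono) auto
      finally show ?thesis by simp
    qed
    ultimately show "\<exists>y. DERIV \<phi> x :> y \<and> y \<le> 0" by blast
  qed
  then have 1: "exp (- (a * t)) * (norm (u t))\<^sup>2 \<le> (norm (u 0))\<^sup>2 + c\<^sup>2 * t"
    by (simp add: \<phi>_def dot_square_norm)
  have "(norm (u t))\<^sup>2 = exp (a * t) * (exp (- (a * t)) * (norm (u t))\<^sup>2)"
    by (simp add: exp_minus)
  also have "\<dots> \<le> exp (a * t) * ((norm (u 0))\<^sup>2 + c\<^sup>2 * t)"
    by (rule mult_left_mono[OF 1]) simp
  also have "\<dots> \<le> exp (2*K+2) * (norm (u 0) + c)\<^sup>2"
  proof (rule mult_mono)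
    have "a * t \<le> a * 1" using a t by (intro mult_left_mono) auto
    then show "exp (a * t) \<le> exp (2*K+2)" by (simp add: a_def)
    have "c\<^sup>2 * t \<le> c\<^sup>2 * 1" using t by (intro mult_left_mono) auto
    moreover have "(norm (u 0) + c)\<^sup>2 = (norm (u 0))\<^sup>2 + 2 * (norm (u 0) * c) + c\<^sup>2"
      by (simp add: power2_eq_square algebra_simps)
    moreover have "0 \<le> norm (u 0) * c" using c by simp
    ultimately show "(norm (u 0))\<^sup>2 + c\<^sup>2 * t \<le> (norm (u 0) + c)\<^sup>2" by linarith
  qed (use t in auto)
  also have "\<dots> = (exp (K+1) * (norm (u 0) + c))\<^sup>2"
  proof -
    have "exp (2*K+2) = (exp (K+1))\<^sup>2"
      unfolding power2_eq_square by (subst exp_add[symmetric]) (rule arg_cong[where f=exp], simp)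
    then show ?thesis by (simp add: power_mult_distrib)
  qed
  finally show ?thesis by (rule power2_le_imp_le) (use c in auto)
qed

text \<open>Picard iteration in the weighted norm \<open>sup exp (-2Kt) |x(t)|\<close>, in which the integral operator
  contracts by the factor \<open>1/2\<close> on the whole interval at once.\<close>

lemma lipschitz_ode_exists:
  fixes \<Phi> :: "real \<Rightarrow> 'a::banach \<Rightarrow> 'a"
  assumes cont: "continuous_on ({0..1} \<times> UNIV) (\<lambda>(t, x). \<Phi> t x)"
    and lip: "\<And>t x y. t \<in> {0..1} \<Longrightarrow> norm (\<Phi> t x - \<Phi> t y) \<le> K0 * norm (x - y)"
  shows "\<exists>x. x 0 = \<xi> \<and> (\<forall>t\<in>{0..1}. (x has_vector_derivative \<Phi> t (x t)) (at t within {0..1}))"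
proof -
  define K where "K = max 1 K0"
  have K: "K > 0" by (simp add: K_def)
  have lip: "norm (\<Phi> t x - \<Phi> t y) \<le> K * norm (x - y)" if "t \<in> {0..1}" for t x y
    using lip[OF that, of x y] mult_right_mono[of K0 K "norm (x - y)"] by (auto simp: K_def)
  define c where "c = (\<lambda>t::real. max 0 (min 1 t))"
  have c: "c t \<in> {0..1}" "t \<in> {0..1} \<Longrightarrow> c t = t" for t by (auto simp: c_def)
  have cont_c: "continuous_on S c" for S unfolding c_def by (intro continuous_intros)
  define I where "I = (\<lambda>(w::real \<Rightarrow>\<^sub>C 'a) v. \<Phi> v (exp (2*K * v) *\<^sub>R apply_bcontfun w v))"
  have contI: "continuous_on {0..1} (I w)" for w
  proof -
    have "continuous_on {0..1} (\<lambda>v. (\<lambda>(t,x). \<Phi> t x) (v, exp (2*K * v) *\<^sub>R apply_bcontfun w v))"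
      by (intro continuous_on_compose2[OF cont] continuous_intros) auto
    then show ?thesis by (simp add: I_def)
  qed
  have intI: "I w integrable_on {0..c t}" for w t
    using continuous_on_subset[OF contI, of "{0..c t}"] c[of t] integrable_continuous_real by auto
  define P where "P = (\<lambda>w t. exp (-2*K*c t) *\<^sub>R (\<xi> + integral {0..c t} (I w)))"
  have P_bc: "P w \<in> bcontfun" for w
  proof -
    have "continuous_on {0..1} (\<lambda>t. exp (-2*K*t) *\<^sub>R (\<xi> + integral {0..t} (I w)))"
      by (intro continuous_intros indefinite_integral_continuous_1 integrable_continuous_real contI)
    note cont = this
    have ct: "continuous_on UNIV (\<lambda>t. (\<lambda>t. exp (-2*K*t) *\<^sub>R (\<xi> + integral {0..t} (I w))) (c t))"
      by (intro continuous_on_compose2[OF cont cont_c]) (use c in auto)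
    obtain B where "\<And>t. t \<in> {0..1} \<Longrightarrow> norm (exp (-2*K*t) *\<^sub>R (\<xi> + integral {0..t} (I w))) \<le> B"
      by (rule bounded_on_compact[OF cont compact_Icc]) (rule that; blast)
    then have "norm (P w t) \<le> B" for t using c[of t] by (simp add: P_def)
    then show ?thesis using ct by (intro bcontfun_normI) (auto simp: P_def)
  qed
  have "\<exists>!w. Bcontfun (P w) = w"
  proof (rule banach_fix_type[where c="1/2"])
    show "\<forall>w z. dist (Bcontfun (P w)) (Bcontfun (P z)) \<le> 1/2 * dist w z"
    proof (intro allI dist_bound)
      fix w z :: "real \<Rightarrow>\<^sub>C 'a" and t
      define d where "d = dist w z"
      have d: "d \<ge> 0" by (simp add: d_def)
      have E: "((\<lambda>v. K * exp (2*K * v) * d) has_integral (d/2) * exp (2*K*c t) - (d/2) * exp (2*K*0)) {0..c t}"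
        using c[of t] by (intro fundamental_theorem_of_calculus)
          (auto intro!: derivative_eq_intros simp: has_real_derivative_iff_has_vector_derivative[symmetric])
      have "P w t - P z t = exp (-2*K*c t) *\<^sub>R integral {0..c t} (\<lambda>v. I w v - I z v)"
        unfolding P_def using intI by (simp add: integral_diff algebra_simps)
      also have "norm \<dots> = exp (-2*K*c t) * norm (integral {0..c t} (\<lambda>v. I w v - I z v))" by simp
      also have "\<dots> \<le> exp (-2*K*c t) * integral {0..c t} (\<lambda>v. K * exp (2*K * v) * d)"
      proof (intro mult_left_mono integral_norm_bound_integral)
        show "(\<lambda>v. I w v - I z v) integrable_on {0..c t}" using intI by (intro integrable_diff)
        show "(\<lambda>v. K * exp (2*K * v) * d) integrable_on {0..c t}" using E by blast
        fix v assume "v \<in> {0..c t}"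
        then have v: "v \<in> {0..1}" using c[of t] by auto
        have "norm (I w v - I z v) \<le> K * norm (exp (2*K * v) *\<^sub>R (apply_bcontfun w v - apply_bcontfun z v))"
          using lip[OF v] unfolding I_def by (simp add: scaleR_diff_right)
        also have "\<dots> = K * (exp (2*K * v) * dist (apply_bcontfun w v) (apply_bcontfun z v))"
          by (simp add: dist_norm)
        also have "\<dots> \<le> K * (exp (2*K * v) * d)"
          using K by (intro mult_left_mono) (auto simp: d_def dist_bounded)
        finally show "norm (I w v - I z v) \<le> K * exp (2*K * v) * d" by simp
      qed auto
      also have "\<dots> = exp (-2*K*c t) * ((d/2) * exp (2*K*c t) - d/2)"
        using integral_unique[OF E] by (simp only: mult_zero_right exp_zero mult_1_right)
      also have "\<dots> = d/2 * (exp (-2*K*c t) * exp (2*K*c t)) - exp (-2*K*c t) * (d/2)"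
        by (simp add: algebra_simps)
      also have "\<dots> \<le> d/2" using d by (simp flip: exp_add)
      finally show "dist (apply_bcontfun (Bcontfun (P w)) t) (apply_bcontfun (Bcontfun (P z)) t) \<le> 1/2 * dist w z"
        using P_bc by (simp add: Bcontfun_inverse dist_norm d_def)
    qed
  qed auto
  then obtain w where "Bcontfun (P w) = w" by blast
  then have w: "apply_bcontfun w t = P w t" for t
    using P_bc Bcontfun_inverse by metis
  define x where "x = (\<lambda>t. \<xi> + integral {0..t} (I w))"
  have x: "I w t = \<Phi> t (x t)" if "t \<in> {0..1}" for t
  proof -
    have "exp (2*K*t) *\<^sub>R apply_bcontfun w t = x t"
      unfolding w P_def x_def using c(2)[OF that] by (simp flip: exp_add)
    then show ?thesis by (simp add: I_def)
  qed
  have "(x has_vector_derivative \<Phi> t (x t)) (at t within {0..1})" if "t \<in> {0..1}" for t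
    using integral_has_vector_derivative[OF contI that, of w] x[OF that] unfolding x_def
    by (auto intro!: derivative_eq_intros)
  moreover have "x 0 = \<xi>" by (simp add: x_def)
  ultimately show ?thesis by blast
qed

lemma fundamental_solution_exists:
  fixes A :: "real \<Rightarrow> 'a::euclidean_space \<Rightarrow>\<^sub>L 'a"
  assumes "continuous_on {0..1} A"
  shows "\<exists>Y. Y 0 = id_blinfun \<and> (\<forall>t\<in>{0..1}. (Y has_vector_derivative (A t o\<^sub>L Y t)) (at t within {0..1}))"
proof -
  obtain K where K: "\<And>t. t \<in> {0..1} \<Longrightarrow> norm (A t) \<le> K"
    by (rule bounded_on_compact[OF assms compact_Icc]) (rule that; blast)
  show ?thesis
  proof (rule lipschitz_ode_exists)
    show "continuous_on ({0..1} \<times> UNIV) (\<lambda>(t, Y). A t o\<^sub>L Y)"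
      unfolding case_prod_beta
      by (intro continuous_intros continuous_on_compose2[OF assms]) auto
    show "norm ((A t o\<^sub>L x) - (A t o\<^sub>L y)) \<le> K * norm (x - y)" if "t \<in> {0..1}" for t x y
    proof -
      have "norm ((A t o\<^sub>L x) - (A t o\<^sub>L y)) = norm (A t o\<^sub>L (x - y))"
        by (simp add: bounded_bilinear.diff_right[OF bounded_bilinear_blinfun_compose])
      also have "\<dots> \<le> norm (A t) * norm (x - y)" by (rule norm_blinfun_compose)
      also have "\<dots> \<le> K * norm (x - y)" using K[OF that] by (intro mult_right_mono) auto
      finally show ?thesis .
    qed
  qed
qed

text \<open>The compact set need not be convex: it will be the union of two trajectories.\<close>

lemma C1_lipschitz_on_compact:
  fixes F :: "'a::euclidean_space \<Rightarrow> 'a"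
  assumes "open S" "C1 S F" "compact K" "K \<subseteq> S"
  obtains M where "\<And>x y. x \<in> K \<Longrightarrow> y \<in> K \<Longrightarrow> norm (F x - F y) \<le> M * norm (x - y)"
proof -
  have "local_lipschitz (UNIV::real set) S (\<lambda>_. F)"
  proof (rule c1_implies_local_lipschitz)
    show "(F has_derivative blinfun_apply (blinderiv F (snd (t, x)))) (at x)" if "x \<in> S" for t::real and x
      using C1_has_derivative[OF assms(2) that] by simp
    show "continuous_on (UNIV \<times> S) (\<lambda>p::real \<times> 'a. blinderiv F (snd p))"
      by (intro continuous_on_compose2[OF C1_continuous_deriv[OF assms(2)]] continuous_intros) auto
  qed (use assms in auto)
  then have "local_lipschitz {0::real} K (\<lambda>_. F)"
    using assms by (auto intro: local_lipschitz_subset)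
  then obtain M where "\<And>t. t \<in> {0::real} \<Longrightarrow> M-lipschitz_on K F"
    by (rule local_lipschitz_compact_implies_lipschitz) (use assms in auto)
  then have "M-lipschitz_on K F" by simp
  then show ?thesis using that lipschitz_onD dist_norm by metis
qed

lemma solves_unit_unique:
  fixes F :: "'a::euclidean_space \<Rightarrow> 'a"
  assumes "open S" "C1 S F" and x: "solves S (\<lambda>_. F) {0..1} x" and y: "solves S (\<lambda>_. F) {0..1} y"
    and "x 0 = y 0" "t \<in> {0..1}"
  shows "x t = y t"
proof -
  have c: "continuous_on {0..1} x" "continuous_on {0..1} y"
    using x y unfolding solves_def
    by (meson continuous_on_eq_continuous_within has_vector_derivative_continuous)+
  define K where "K = x ` {0..1} \<union> y ` {0..1}"
  have "compact K" unfolding K_def using c by (intro compact_Un compact_continuous_image) auto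
  moreover have "K \<subseteq> S" using x y by (auto simp: K_def solves_def)
  ultimately obtain M where M: "\<And>x y. x \<in> K \<Longrightarrow> y \<in> K \<Longrightarrow> norm (F x - F y) \<le> M * norm (x - y)"
    using C1_lipschitz_on_compact assms by metis
  have "norm (x t - y t) \<le> exp (max M 0 + 1) * (norm (x 0 - y 0) + 0)"
  proof (rule gronwall[where u'="\<lambda>t. F (x t) - F (y t)"])
    fix t :: real assume t: "t \<in> {0..1}"
    show "((\<lambda>a. x a - y a) has_vector_derivative F (x t) - F (y t)) (at t within {0..1})"
      using x y t by (auto simp: solves_def intro: has_vector_derivative_diff)
    have "norm (F (x t) - F (y t)) \<le> M * norm (x t - y t)"
      using t by (intro M) (auto simp: K_def)
    also have "\<dots> \<le> max M 0 * norm (x t - y t)" by (intro mult_right_mono) auto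
    finally show "norm (F (x t) - F (y t)) \<le> max M 0 * norm (x t - y t) + 0" by simp
  qed (use assms in auto)
  then show ?thesis using assms by simp
qed

lemma compact_tube:
  fixes x :: "real \<Rightarrow> 'a::euclidean_space"
  assumes "continuous_on {0..1} x" "open S" "x ` {0..1} \<subseteq> S"
  obtains r where "r > 0" "compact ((\<lambda>(t, v). x t + v) ` ({0..1} \<times> cball 0 r))"
    "(\<lambda>(t, v). x t + v) ` ({0..1} \<times> cball 0 r) \<subseteq> S"
proof -
  have cx: "compact (x ` {0..1})" using assms by (intro compact_continuous_image) auto
  obtain r where r: "r > 0" "(\<Union>z\<in>x ` {0..1}. cball z r) \<subseteq> S"
    using compact_subset_open_imp_cball_epsilon_subset[OF cx assms(2,3)] by blast
  have "compact ((\<lambda>(t, v). x t + v) ` ({0..1} \<times> cball 0 r))"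
    unfolding case_prod_beta
    by (intro compact_continuous_image compact_Times continuous_intros 
        continuous_on_compose2[OF assms(1)]) auto
  moreover have "(\<lambda>(t, v). x t + v) ` ({0..1} \<times> cball 0 r) \<subseteq> S"
  proof clarify
    fix t :: real and v :: 'a assume "t \<in> {0..1}" "v \<in> cball 0 r"
    then have "x t + v \<in> cball (x t) r" by (simp add: dist_norm)
    then show "x t + v \<in> S" using r \<open>t \<in> {0..1}\<close> by blast
  qed
  ultimately show ?thesis by (rule that[OF r(1)])
qed

text \<open>Solutions near a given one are found by projecting radially onto a tube around it, which makes
  the field globally Lipschitz; by Gronwall's inequality the solution never leaves the tube.\<close>

lemma nearby_solutions:
  fixes F :: "'a::euclidean_space \<Rightarrow> 'a"
  assumes S: "open S" and F: "C1 S F" and x: "solves S (\<lambda>_. F) {0..1} x"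
  obtains r K where "r > 0" "K \<ge> 0"
    "\<And>t v. t \<in> {0..1} \<Longrightarrow> norm v \<le> r \<Longrightarrow> x t + v \<in> S \<and> norm (blinderiv F (x t + v)) \<le> K"
    "\<And>\<eta>. \<eta> > 0 \<Longrightarrow> \<exists>d>0. d \<le> r \<and> (\<forall>t\<in>{0..1}. \<forall>v. norm v \<le> d \<longrightarrow>
        norm (blinderiv F (x t + v) - blinderiv F (x t)) \<le> \<eta>)"
    "\<And>\<xi>. exp (K + 1) * norm (\<xi> - x 0) \<le> r \<Longrightarrow> \<exists>y. solves S (\<lambda>_. F) {0..1} y \<and> y 0 = \<xi> \<and>
        (\<forall>t\<in>{0..1}. norm (y t - x t) \<le> exp (K + 1) * norm (\<xi> - x 0))"
proof -
  have cx: "continuous_on {0..1} x"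
    using x unfolding solves_def
    by (meson continuous_on_eq_continuous_within has_vector_derivative_continuous)
  have xS: "x ` {0..1} \<subseteq> S" using x by (auto simp: solves_def)
  obtain r where r: "r > 0" and ct: "compact ((\<lambda>(t, v). x t + v) ` ({0..1} \<times> cball 0 r))"
    and ts: "(\<lambda>(t, v). x t + v) ` ({0..1} \<times> cball 0 r) \<subseteq> S"
    using compact_tube[OF cx S xS] by metis
  define T where "T = (\<lambda>(t, v). x t + v) ` ({0..1} \<times> cball 0 r)"
  have T: "compact T" "T \<subseteq> S" using ct ts by (simp_all only: T_def)
  have inT: "x t + v \<in> T" if "t \<in> {0..1}" "norm v \<le> r" for t v
    using that unfolding T_def by (intro image_eqI[where x="(t, v)"]) auto
  have cD: "continuous_on T (blinderiv F)" using C1_continuous_deriv[OF F] T continuous_on_subset by blast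
  then obtain K where "K > 0" and KT: "\<And>y. y \<in> T \<Longrightarrow> norm (blinderiv F y) \<le> K"
    by (rule bounded_on_compact[OF _ T(1)]) (rule that; blast)
  then have K: "K \<ge> 0" "\<And>y. y \<in> T \<Longrightarrow> norm (blinderiv F y) \<le> K" by auto
  have ucD: "uniformly_continuous_on T (blinderiv F)"
    using compact_uniformly_continuous[OF cD] T by blast
  have 2: "\<exists>d>0. d \<le> r \<and> (\<forall>t\<in>{0..1}. \<forall>v. norm v \<le> d \<longrightarrow>
        norm (blinderiv F (x t + v) - blinderiv F (x t)) \<le> \<eta>)" if "\<eta> > 0" for \<eta>
  proof -
    obtain d where d: "d > 0" "\<And>y z. y \<in> T \<Longrightarrow> z \<in> T \<Longrightarrow> dist z y < d \<Longrightarrow> dist (blinderiv F z) (blinderiv F y) < \<eta>"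
      using ucD \<open>\<eta> > 0\<close> unfolding uniformly_continuous_on_def by metis
    have "norm (blinderiv F (x t + v) - blinderiv F (x t)) \<le> \<eta>" if "t \<in> {0..1}" "norm v \<le> min (d/2) r" for t v
    proof -
      have "dist (blinderiv F (x t + v)) (blinderiv F (x t)) < \<eta>"
        using inT[of t v] inT[of t 0] that d r by (intro d(2)) (auto simp: dist_norm)
      then show ?thesis by (simp add: dist_norm)
    qed
    then show ?thesis using d r by (intro exI[of _ "min (d/2) r"]) auto
  qed
  define \<pi> where "\<pi> = closest_point (cball (0::'a) r)"
  have \<pi>_in: "norm (\<pi> v) \<le> r" for v
    using closest_point_in_set[of "cball (0::'a) r" v] r by (auto simp: \<pi>_def)
  have \<pi>_id: "\<pi> v = v" if "norm v \<le> r" for v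
    using that by (simp add: \<pi>_def closest_point_self)
  have \<pi>_lip: "norm (\<pi> v - \<pi> w) \<le> norm (v - w)" for v w
    using closest_point_lipschitz[of "cball (0::'a) r" v w] r by (auto simp: \<pi>_def dist_norm)
  have \<pi>_cont: "continuous_on A \<pi>" for A
    unfolding \<pi>_def using r by (intro continuous_on_closest_point) auto
  define \<Phi> where "\<Phi> = (\<lambda>t y. F (x t + \<pi> (y - x t)))"
  have cF: "continuous_on T F" using C1_continuous_on[OF F] T continuous_on_subset by blast
  have lipF: "norm (F (x t + v) - F (x t + w)) \<le> K * norm (v - w)" 
    if "t \<in> {0..1}" "norm v \<le> r" "norm w \<le> r" for t v w
  proof -
    have "norm (F (x t + v) - F (x t + w)) \<le> K * norm ((x t + v) - (x t + w))"
    proof (rule differentiable_bound[where S="cball (x t) r" and f'="\<lambda>y. blinfun_apply (blinderiv F y)"])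
      fix z assume "z \<in> cball (x t) r"
      then have "z \<in> T" using inT[OF that(1), of "z - x t"] by (simp add: dist_norm norm_minus_commute)
      then show "(F has_derivative blinfun_apply (blinderiv F z)) (at z within cball (x t) r)"
        using C1_has_derivative[OF F, of z] T has_derivative_at_withinI by blast
      show "onorm (blinfun_apply (blinderiv F z)) \<le> K"
        using K(2)[OF \<open>z \<in> T\<close>] by (simp add: norm_blinfun.rep_eq)
    qed (use that in \<open>auto simp: dist_norm\<close>)
    then show ?thesis by simp
  qed
  have 3: "\<exists>y. solves S (\<lambda>_. F) {0..1} y \<and> y 0 = \<xi> \<and>
        (\<forall>t\<in>{0..1}. norm (y t - x t) \<le> exp (K + 1) * norm (\<xi> - x 0))"
    if "exp (K + 1) * norm (\<xi> - x 0) \<le> r" for \<xi>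
  proof -
    have "\<exists>y. y 0 = \<xi> \<and> (\<forall>t\<in>{0..1}. (y has_vector_derivative \<Phi> t (y t)) (at t within {0..1}))"
    proof (rule lipschitz_ode_exists)
      show "continuous_on ({0..1} \<times> UNIV) (\<lambda>(t, y). \<Phi> t y)"
        unfolding case_prod_beta \<Phi>_def
        by (intro continuous_on_compose2[OF cF] continuous_intros continuous_on_compose2[OF cx]
            continuous_on_compose2[OF \<pi>_cont[of UNIV]]) (auto intro!: inT \<pi>_in)
      show "norm (\<Phi> t y - \<Phi> t z) \<le> K * norm (y - z)" if "t \<in> {0..1}" for t y z
      proof -
        have "norm (\<Phi> t y - \<Phi> t z) \<le> K * norm (\<pi> (y - x t) - \<pi> (z - x t))"
          unfolding \<Phi>_def using that by (intro lipF \<pi>_in)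
        also have "\<dots> \<le> K * norm ((y - x t) - (z - x t))" using K by (intro mult_left_mono \<pi>_lip)
        finally show ?thesis by simp
      qed
    qed
    then obtain y where y0: "y 0 = \<xi>"
      and y: "\<And>t. t \<in> {0..1} \<Longrightarrow> (y has_vector_derivative \<Phi> t (y t)) (at t within {0..1})" by blast
    have est: "norm (y t - x t) \<le> exp (K + 1) * norm (\<xi> - x 0)" if "t \<in> {0..1}" for t
    proof -
      have "norm (y t - x t) \<le> exp (K + 1) * (norm (y 0 - x 0) + 0)"
      proof (rule gronwall[where u'="\<lambda>t. \<Phi> t (y t) - F (x t)"])
        fix t :: real assume t: "t \<in> {0..1}"
        show "((\<lambda>a. y a - x a) has_vector_derivative \<Phi> t (y t) - F (x t)) (at t within {0..1})"
          using x y t by (auto simp: solves_def intro: has_vector_derivative_diff)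
        have "norm (\<Phi> t (y t) - F (x t)) \<le> K * norm (\<pi> (y t - x t) - 0)"
          using lipF[OF t \<pi>_in, of 0] r by (simp add: \<Phi>_def)
        also have "\<dots> \<le> K * norm ((y t - x t) - 0)"
          using \<pi>_lip[of "y t - x t" 0] \<pi>_id[of 0] r K by (intro mult_left_mono) auto
        finally show "norm (\<Phi> t (y t) - F (x t)) \<le> K * norm (y t - x t) + 0" by simp
      qed (use K that in auto)
      then show ?thesis using y0 by simp
    qed
    have "y t \<in> S \<and> (y has_vector_derivative F (y t)) (at t within {0..1})" if t: "t \<in> {0..1}" for t
    proof -
      have n: "norm (y t - x t) \<le> r" using est[OF t] \<open>exp (K + 1) * norm (\<xi> - x 0) \<le> r\<close> by simp
      then have "\<Phi> t (y t) = F (y t)" by (simp add: \<Phi>_def \<pi>_id)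
      then show ?thesis using y[OF t] inT[OF t n] T by auto
    qed
    then show ?thesis using y0 est unfolding solves_def by (intro exI[of _ y]) blast
  qed
  show ?thesis
    by (rule that[OF r K(1) _ 2 3]) (use inT K T in auto)
qed

text \<open>Smooth dependence is proved for the time-one map of an autonomous field only. Other times, and
  parameters, are reduced to it by rescaling the field and by adjoining constant components.\<close>

definition unit_domain :: "'a set \<Rightarrow> ('a \<Rightarrow> 'a) \<Rightarrow> 'a::real_normed_vector set" where
  "unit_domain S F = {\<xi>. \<exists>x. solves S (\<lambda>_. F) {0..1} x \<and> x 0 = \<xi>}"

lemma closed_segment_01: "closed_segment 0 1 = {0..1::real}"
  by (simp add: closed_segment_eq_real_ivl)

lemma traj_unit:
  fixes F :: "'a::euclidean_space \<Rightarrow> 'a"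
  assumes "open S" "C1 S F" "solves S (\<lambda>_. F) {0..1} x"
  shows "traj S (\<lambda>_. F) (x 0) 1 = x 1"
  unfolding traj_def closed_segment_01
proof (rule the_equality)
  show "\<exists>x'. solves S (\<lambda>_. F) {0..1} x' \<and> x' 0 = x 0 \<and> x' 1 = x 1" using assms by blast
  fix y assume "\<exists>x'. solves S (\<lambda>_. F) {0..1} x' \<and> x' 0 = x 0 \<and> x' 1 = y"
  then obtain x' where x': "solves S (\<lambda>_. F) {0..1} x'" "x' 0 = x 0" "x' 1 = y" by blast
  have "x' 1 = x 1" by (rule solves_unit_unique[OF assms(1,2) x'(1) assms(3) x'(2)]) simp
  then show "y = x 1" using x' by simp
qed

text \<open>Gronwall's inequality is applied to \<open>y - x - Y h\<close>, where \<open>y\<close> starts at \<open>x(0) + h\<close> and \<open>Y\<close> solves the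
  variational equation along \<open>x\<close>.\<close>

lemma unit_map_derivative:
  fixes F :: "'a::euclidean_space \<Rightarrow> 'a"
  assumes S: "open S" and F: "C1 S F" and x: "solves S (\<lambda>_. F) {0..1} x"
    and Y0: "Y 0 = id_blinfun"
    and Y: "\<And>t. t \<in> {0..1} \<Longrightarrow> (Y has_vector_derivative (blinderiv F (x t) o\<^sub>L Y t)) (at t within {0..1})"
  shows "((\<lambda>\<xi>. traj S (\<lambda>_. F) \<xi> 1) has_derivative blinfun_apply (Y 1)) (at (x 0))"
  unfolding has_derivative_at_alt
proof (intro conjI allI impI blinfun.bounded_linear_right)
  obtain r K where rK: "r > 0" "K \<ge> 0"
    and tube: "\<And>t v. t \<in> {0..1} \<Longrightarrow> norm v \<le> r \<Longrightarrow> x t + v \<in> S \<and> norm (blinderiv F (x t + v)) \<le> K"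
    and uc: "\<And>\<eta>. \<eta> > 0 \<Longrightarrow> \<exists>d>0. d \<le> r \<and> (\<forall>t\<in>{0..1}. \<forall>v. norm v \<le> d \<longrightarrow>
        norm (blinderiv F (x t + v) - blinderiv F (x t)) \<le> \<eta>)"
    and ex: "\<And>\<xi>. exp (K + 1) * norm (\<xi> - x 0) \<le> r \<Longrightarrow> \<exists>y. solves S (\<lambda>_. F) {0..1} y \<and> y 0 = \<xi> \<and>
        (\<forall>t\<in>{0..1}. norm (y t - x t) \<le> exp (K + 1) * norm (\<xi> - x 0))"
    using nearby_solutions[OF S F x] by blast
  define C where "C = exp (K + 1)"
  have C: "C > 0" by (simp add: C_def)
  fix e :: real assume e: "e > 0"
  define \<eta> where "\<eta> = e / (C * C)"
  have \<eta>: "\<eta> > 0" using e C by (simp add: \<eta>_def)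
  obtain d where d: "d > 0" "d \<le> r" and dD: "\<And>t v. t \<in> {0..1} \<Longrightarrow> norm v \<le> d \<Longrightarrow>
        norm (blinderiv F (x t + v) - blinderiv F (x t)) \<le> \<eta>"
    using uc[OF \<eta>] by blast
  have taylor: "norm (F (x t + v) - F (x t) - blinderiv F (x t) v) \<le> \<eta> * norm v"
    if t: "t \<in> {0..1}" and v: "norm v \<le> d" for t v
  proof -
    define G where "G = (\<lambda>z. F z - blinderiv F (x t) z)"
    have "norm (G (x t + v) - G (x t)) \<le> \<eta> * norm ((x t + v) - x t)"
    proof (rule differentiable_bound[where S="cball (x t) d" 
          and f'="\<lambda>z. blinfun_apply (blinderiv F z - blinderiv F (x t))"])
      fix z assume z: "z \<in> cball (x t) d"
      then have n: "norm (z - x t) \<le> d" by (simp add: dist_norm norm_minus_commute)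
      then have "z \<in> S" using tube[OF t, of "z - x t"] d by simp
      then have "(F has_derivative blinfun_apply (blinderiv F z)) (at z within cball (x t) d)"
        using C1_has_derivative[OF F] has_derivative_at_withinI by blast
      then show "(G has_derivative blinfun_apply (blinderiv F z - blinderiv F (x t))) (at z within cball (x t) d)"
        unfolding G_def by (auto intro!: derivative_eq_intros simp: blinfun.diff_left)
      show "onorm (blinfun_apply (blinderiv F z - blinderiv F (x t))) \<le> \<eta>"
        using dD[OF t n] by (simp add: norm_blinfun.rep_eq)
    qed (use v d in \<open>auto simp: dist_norm\<close>)
    then show ?thesis by (simp add: G_def blinfun.add_right algebra_simps)
  qed
  show "\<exists>da>0. \<forall>\<xi>. norm (\<xi> - x 0) < da \<longrightarrow>
      norm (traj S (\<lambda>_. F) \<xi> 1 - traj S (\<lambda>_. F) (x 0) 1 - blinfun_apply (Y 1) (\<xi> - x 0)) \<le> e * norm (\<xi> - x 0)"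
  proof (intro exI[of _ "d / C"] conjI allI impI)
    show "d / C > 0" using d C by simp
    fix \<xi> assume "norm (\<xi> - x 0) < d / C"
    then have small: "C * norm (\<xi> - x 0) < d" using C by (simp add: field_simps)
    then obtain y where y: "solves S (\<lambda>_. F) {0..1} y" "y 0 = \<xi>"
      and yx: "\<And>t. t \<in> {0..1} \<Longrightarrow> norm (y t - x t) \<le> C * norm (\<xi> - x 0)"
      using ex[of \<xi>] d unfolding C_def by fastforce
    define h where "h = \<xi> - x 0"
    have "norm (y 1 - x 1 - Y 1 h) \<le> exp (K + 1) * (norm (y 0 - x 0 - Y 0 h) + \<eta> * C * norm h)"
    proof (rule gronwall[where u="\<lambda>t. y t - x t - Y t h" and u'="\<lambda>t. F (y t) - F (x t) - blinderiv F (x t) (Y t h)"])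
      fix t :: real assume t: "t \<in> {0..1}"
      have "((\<lambda>t. Y t h) has_vector_derivative blinderiv F (x t) (Y t h)) (at t within {0..1})"
        using bounded_linear.has_vector_derivative[OF blinfun.bounded_linear_left Y[OF t], of h] by simp
      then show "((\<lambda>t. y t - x t - Y t h) has_vector_derivative F (y t) - F (x t) - blinderiv F (x t) (Y t h)) (at t within {0..1})"
        using x y t by (auto simp: solves_def intro!: has_vector_derivative_diff)
      have n: "norm (y t - x t) \<le> d" using yx[OF t] small by simp
      have "F (y t) - F (x t) - blinderiv F (x t) (Y t h) =
          blinderiv F (x t) (y t - x t - Y t h) + (F (x t + (y t - x t)) - F (x t) - blinderiv F (x t) (y t - x t))"
        by (simp add: blinfun.diff_right)
      also have "norm \<dots> \<le> K * norm (y t - x t - Y t h) + \<eta> * norm (y t - x t)"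
      proof (rule order_trans[OF norm_triangle_ineq add_mono])
        have "norm (blinderiv F (x t)) \<le> K" using tube[OF t, of 0] rK by simp
        then show "norm (blinderiv F (x t) (y t - x t - Y t h)) \<le> K * norm (y t - x t - Y t h)"
          by (meson mult_right_mono norm_blinfun norm_ge_zero order_trans)
      qed (rule taylor[OF t n])
      also have "\<eta> * norm (y t - x t) \<le> \<eta> * (C * norm h)"
        using yx[OF t] \<eta> by (intro mult_left_mono) (auto simp: h_def)
      finally show "norm (F (y t) - F (x t) - blinderiv F (x t) (Y t h)) \<le> K * norm (y t - x t - Y t h) + \<eta> * C * norm h"
        by simp
    qed (use rK \<eta> C in auto)
    also have "\<dots> = e * norm h" using y C by (simp add: Y0 h_def C_def[symmetric] \<eta>_def)
    finally show "norm (traj S (\<lambda>_. F) \<xi> 1 - traj S (\<lambda>_. F) (x 0) 1 - blinfun_apply (Y 1) (\<xi> - x 0)) \<le> e * norm (\<xi> - x 0)"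
      using traj_unit[OF S F y(1)] traj_unit[OF S F x] y(2) by (simp add: h_def)
  qed
qed

lemma solves_continuous: "solves S F J x \<Longrightarrow> continuous_on J x"
  unfolding solves_def
  by (meson continuous_on_eq_continuous_within has_vector_derivative_continuous)

lemma variational_exists:
  fixes F :: "'a::euclidean_space \<Rightarrow> 'a"
  assumes F: "C1 S F" and x: "solves S (\<lambda>_. F) {0..1} x"
  obtains Y where "Y 0 = id_blinfun"
    "\<And>t. t \<in> {0..1} \<Longrightarrow> (Y has_vector_derivative (blinderiv F (x t) o\<^sub>L Y t)) (at t within {0..1})"
proof -
  have "continuous_on {0..1} (\<lambda>t. blinderiv F (x t))"
    using x by (intro continuous_on_compose2[OF C1_continuous_deriv[OF F] solves_continuous[OF x]])
      (auto simp: solves_def)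
  from fundamental_solution_exists[OF this] show ?thesis using that by blast
qed

text \<open>The derivative is given by the variational equation, whose coefficients \<open>Df(x(t))\<close> vary
  continuously with the initial value, uniformly in \<open>t\<close>; Gronwall's inequality passes this on to its solution.\<close>

theorem unit_map_C1:
  fixes F :: "'a::euclidean_space \<Rightarrow> 'a"
  assumes S: "open S" and F: "C1 S F"
  shows "open (unit_domain S F)" and "C1 (unit_domain S F) (\<lambda>\<xi>. traj S (\<lambda>_. F) \<xi> 1)"
proof -
  let ?\<phi> = "\<lambda>\<xi>. traj S (\<lambda>_. F) \<xi> 1"
  show "open (unit_domain S F)"
  proof (rule openI)
    fix \<xi> assume "\<xi> \<in> unit_domain S F"
    then obtain x where x: "solves S (\<lambda>_. F) {0..1} x" "x 0 = \<xi>" by (auto simp: unit_domain_def)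
    obtain r K where "r > (0::real)" 
      and ex: "\<And>\<xi>. exp (K + 1) * norm (\<xi> - x 0) \<le> r \<Longrightarrow> \<exists>y. solves S (\<lambda>_. F) {0..1} y \<and> y 0 = \<xi>"
      using nearby_solutions[OF S F x(1)] by metis
    have "ball \<xi> (r / exp (K + 1)) \<subseteq> unit_domain S F"
    proof
      fix \<xi>' assume "\<xi>' \<in> ball \<xi> (r / exp (K + 1))"
      then have "exp (K + 1) * norm (\<xi>' - x 0) \<le> r" 
        using x(2) by (simp add: field_simps dist_norm norm_minus_commute)
      from ex[OF this] show "\<xi>' \<in> unit_domain S F" by (auto simp: unit_domain_def)
    qed
    then show "\<exists>e>0. ball \<xi> e \<subseteq> unit_domain S F" using \<open>r > 0\<close> 
      by (intro exI[of _ "r / exp (K + 1)"]) auto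
  qed
  have diff: "?\<phi> differentiable (at \<xi>)" if "\<xi> \<in> unit_domain S F" for \<xi>
  proof -
    obtain x where x: "solves S (\<lambda>_. F) {0..1} x" "x 0 = \<xi>" using \<open>\<xi> \<in> unit_domain S F\<close> unfolding unit_domain_def by blast
    obtain Y where "Y 0 = id_blinfun"
      "\<And>t. t \<in> {0..1} \<Longrightarrow> (Y has_vector_derivative (blinderiv F (x t) o\<^sub>L Y t)) (at t within {0..1})"
      using variational_exists[OF F x(1)] by blast
    from unit_map_derivative[OF S F x(1) this] x(2) show ?thesis by (auto simp: differentiable_def)
  qed
  have "isCont (blinderiv ?\<phi>) \<xi>" if "\<xi> \<in> unit_domain S F" for \<xi>
  proof -
    obtain x where x: "solves S (\<lambda>_. F) {0..1} x" "x 0 = \<xi>" using \<open>\<xi> \<in> unit_domain S F\<close> unfolding unit_domain_def by blast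
    obtain X where X0: "X 0 = id_blinfun"
      and X: "\<And>t. t \<in> {0..1} \<Longrightarrow> (X has_vector_derivative (blinderiv F (x t) o\<^sub>L X t)) (at t within {0..1})"
      using variational_exists[OF F x(1)] by blast
    have DX: "blinderiv ?\<phi> \<xi> = X 1"
      using unit_map_derivative[OF S F x(1) X0 X] x(2) by (intro blinderiv_eq) auto
    obtain r K where rK: "r > 0" "K \<ge> 0"
      and tube: "\<And>t v. t \<in> {0..1} \<Longrightarrow> norm v \<le> r \<Longrightarrow> x t + v \<in> S \<and> norm (blinderiv F (x t + v)) \<le> K"
      and uc: "\<And>\<eta>. \<eta> > 0 \<Longrightarrow> \<exists>d>0. d \<le> r \<and> (\<forall>t\<in>{0..1}. \<forall>v. norm v \<le> d \<longrightarrow>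
          norm (blinderiv F (x t + v) - blinderiv F (x t)) \<le> \<eta>)"
      and ex: "\<And>\<xi>. exp (K + 1) * norm (\<xi> - x 0) \<le> r \<Longrightarrow> \<exists>y. solves S (\<lambda>_. F) {0..1} y \<and> y 0 = \<xi> \<and>
          (\<forall>t\<in>{0..1}. norm (y t - x t) \<le> exp (K + 1) * norm (\<xi> - x 0))"
      using nearby_solutions[OF S F x(1)] by blast
    define C where "C = exp (K + 1)"
    have C: "C > 0" by (simp add: C_def)
    have "continuous_on {0..1} X"
      using X by (meson continuous_on_eq_continuous_within has_vector_derivative_continuous)
    then obtain M where M: "M > 0" "\<And>t. t \<in> {0..1} \<Longrightarrow> norm (X t) \<le> M"
      by (rule bounded_on_compact[OF _ compact_Icc]) (rule that; blast)
    show ?thesis unfolding continuous_at_eps_delta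
    proof (intro allI impI)
      fix e :: real assume e: "e > 0"
      define \<eta> where "\<eta> = e / (2 * (C * M))"
      have \<eta>: "\<eta> > 0" using e C M by (simp add: \<eta>_def)
      obtain d where d: "d > 0" "d \<le> r" and dD: "\<And>t v. t \<in> {0..1} \<Longrightarrow> norm v \<le> d \<Longrightarrow>
            norm (blinderiv F (x t + v) - blinderiv F (x t)) \<le> \<eta>"
        using uc[OF \<eta>] by blast
      show "\<exists>da>0. \<forall>\<zeta>. dist \<zeta> \<xi> < da \<longrightarrow> dist (blinderiv ?\<phi> \<zeta>) (blinderiv ?\<phi> \<xi>) < e"
      proof (intro exI[of _ "d / C"] conjI allI impI)
        show "d / C > 0" using d C by simp
        fix \<zeta> assume "dist \<zeta> \<xi> < d / C"
        then have small: "C * norm (\<zeta> - x 0) < d" using C x(2) by (simp add: field_simps dist_norm)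
        then obtain y where y: "solves S (\<lambda>_. F) {0..1} y" "y 0 = \<zeta>"
          and yx: "\<And>t. t \<in> {0..1} \<Longrightarrow> norm (y t - x t) \<le> C * norm (\<zeta> - x 0)"
          using ex[of \<zeta>] d unfolding C_def by fastforce
        obtain Y where Y0: "Y 0 = id_blinfun"
          and Y: "\<And>t. t \<in> {0..1} \<Longrightarrow> (Y has_vector_derivative (blinderiv F (y t) o\<^sub>L Y t)) (at t within {0..1})"
          using variational_exists[OF F y(1)] by blast
        have DY: "blinderiv ?\<phi> \<zeta> = Y 1"
          using unit_map_derivative[OF S F y(1) Y0 Y] y(2) by (intro blinderiv_eq) auto
        have "norm (Y 1 - X 1) \<le> C * (\<eta> * M)"
        proof (rule norm_blinfun_bound)
          fix v
          have "norm (Y 1 v - X 1 v) \<le> exp (K + 1) * (norm (Y 0 v - X 0 v) + \<eta> * M * norm v)"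
          proof (rule gronwall[where u="\<lambda>t. Y t v - X t v" and u'="\<lambda>t. blinderiv F (y t) (Y t v) - blinderiv F (x t) (X t v)"])
            fix t :: real assume t: "t \<in> {0..1}"
            have "((\<lambda>t. Y t v) has_vector_derivative blinderiv F (y t) (Y t v)) (at t within {0..1})"
              "((\<lambda>t. X t v) has_vector_derivative blinderiv F (x t) (X t v)) (at t within {0..1})"
              using bounded_linear.has_vector_derivative[OF blinfun.bounded_linear_left Y[OF t], of v]
                bounded_linear.has_vector_derivative[OF blinfun.bounded_linear_left X[OF t], of v] by simp_all
            then show "((\<lambda>t. Y t v - X t v) has_vector_derivative 
                blinderiv F (y t) (Y t v) - blinderiv F (x t) (X t v)) (at t within {0..1})"
              by (rule has_vector_derivative_diff)
            have n: "norm (y t - x t) \<le> d" using yx[OF t] small by simp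
            have "blinderiv F (y t) (Y t v) - blinderiv F (x t) (X t v) =
                blinderiv F (y t) (Y t v - X t v) + (blinderiv F (y t) - blinderiv F (x t)) (X t v)"
              by (simp add: blinfun.diff_right blinfun.diff_left)
            also have "norm \<dots> \<le> K * norm (Y t v - X t v) + \<eta> * (M * norm v)"
            proof (rule order_trans[OF norm_triangle_ineq add_mono])
              have "norm (blinderiv F (y t)) \<le> K" using tube[OF t, of "y t - x t"] n d by simp
              then show "norm (blinderiv F (y t) (Y t v - X t v)) \<le> K * norm (Y t v - X t v)"
                by (meson mult_right_mono norm_blinfun norm_ge_zero order_trans)
              have "norm (X t v) \<le> M * norm v"
                by (meson M(2)[OF t] mult_right_mono norm_blinfun norm_ge_zero order_trans)
              moreover have "norm (blinderiv F (y t) - blinderiv F (x t)) \<le> \<eta>" using dD[OF t n] by simp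
              ultimately show "norm ((blinderiv F (y t) - blinderiv F (x t)) (X t v)) \<le> \<eta> * (M * norm v)"
                by (meson \<eta> less_imp_le mult_mono norm_blinfun norm_ge_zero order_trans)
            qed
            finally show "norm (blinderiv F (y t) (Y t v) - blinderiv F (x t) (X t v)) \<le> K * norm (Y t v - X t v) + \<eta> * M * norm v"
              by simp
          qed (use rK \<eta> M in auto)
          then show "norm ((Y 1 - X 1) v) \<le> C * (\<eta> * M) * norm v"
            by (simp add: Y0 X0 C_def blinfun.diff_left)
        qed (use C \<eta> M in auto)
        also have "\<dots> < e" using C M e by (simp add: \<eta>_def field_simps)
        finally show "dist (blinderiv ?\<phi> \<zeta>) (blinderiv ?\<phi> \<xi>) < e" by (simp add: DX DY dist_norm)
      qed
    qed
  qed
  then show "C1 (unit_domain S F) ?\<phi>"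
    using diff by (auto simp: C1_def intro: continuous_at_imp_continuous_on)
qed

section \<open>Difference quotients as integrals\<close>

lemma compact_slice_tube:
  fixes K :: "'b::metric_space set" and x0 :: "'a::metric_space"
  assumes "compact K" "open W" "{x0} \<times> K \<subseteq> W"
  obtains d where "d > 0" "\<And>x k. dist x x0 \<le> d \<Longrightarrow> k \<in> K \<Longrightarrow> (x, k) \<in> W"
proof -
  have "compact ({x0} \<times> K)" using assms by (intro compact_Times) auto
  then obtain d where d: "d > 0" "(\<Union>z\<in>{x0} \<times> K. cball z d) \<subseteq> W"
    using compact_subset_open_imp_cball_epsilon_subset[of "{x0} \<times> K" W] assms by blast
  show ?thesis
  proof (rule that[OF d(1)])
    fix x k assume "dist x x0 \<le> d" "k \<in> K"
    then have "(x, k) \<in> cball (x0, k) d" by (simp add: dist_Pair_Pair dist_commute)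
    then show "(x, k) \<in> W" using d(2) \<open>k \<in> K\<close> by blast
  qed
qed

text \<open>The Hadamard form \<open>f(x + v) - f(x) = Q(x, v) v\<close> with \<open>Q(x, v) = \<integral>\<^sub>0\<^sup>1 Df(x + \<theta>v) d\<theta>\<close>: for \<open>v = \<epsilon>y\<close> the quotient
  by \<open>\<epsilon>\<close> is \<open>Q(x, \<epsilon>y) y\<close>, which makes sense at \<open>\<epsilon> = 0\<close> too.\<close>

definition seg_domain :: "'a::real_normed_vector set \<Rightarrow> ('a \<times> 'a) set" where
  "seg_domain S = {p. \<forall>\<theta>\<in>{0..1}. fst p + \<theta> *\<^sub>R snd p \<in> S}"

definition mean_deriv :: "('a::real_normed_vector \<Rightarrow> 'b::banach) \<Rightarrow> 'a \<times> 'a \<Rightarrow> 'a \<Rightarrow>\<^sub>L 'b" where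
  "mean_deriv f p = integral {0..1} (\<lambda>\<theta>. blinderiv f (fst p + \<theta> *\<^sub>R snd p))"

lemma open_seg_domain: 
  fixes S :: "'a::real_normed_vector set"
  assumes "open S"
  shows "open (seg_domain S)"
proof (rule openI)
  fix p :: "'a \<times> 'a" assume p: "p \<in> seg_domain S"
  let ?W = "{q::('a \<times> 'a) \<times> real. fst (fst q) + snd q *\<^sub>R snd (fst q) \<in> S}"
  have "continuous_on UNIV (\<lambda>q::('a \<times> 'a) \<times> real. fst (fst q) + snd q *\<^sub>R snd (fst q))"
    by (intro continuous_intros)
  from open_vimage[OF assms this] have "open ?W" by (simp add: vimage_def)
  moreover have "{p} \<times> {0..1} \<subseteq> ?W" using p by (auto simp: seg_domain_def)
  ultimately obtain d where d: "d > 0" "\<And>x k. dist x p \<le> d \<Longrightarrow> k \<in> {0..1::real} \<Longrightarrow> (x, k) \<in> ?W"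
    using compact_slice_tube[of "{0..1::real}" ?W p] by blast
  then have "ball p d \<subseteq> seg_domain S"
    by (auto simp: seg_domain_def dist_commute)
  then show "\<exists>e>0. ball p e \<subseteq> seg_domain S" using d by blast
qed

lemma seg_continuous:
  assumes "continuous_on S k" "U \<subseteq> seg_domain S"
  shows "continuous_on (U \<times> {0..1}) (\<lambda>q. k (fst (fst q) + snd q *\<^sub>R snd (fst q)))"
  using assms by (intro continuous_on_compose2[OF assms(1)] continuous_intros) (auto simp: seg_domain_def)

lemma seg_integrable:
  fixes k :: "'a::real_normed_vector \<Rightarrow> 'b::banach"
  assumes "continuous_on S k" "p \<in> seg_domain S"
  shows "(\<lambda>\<theta>. k (fst p + \<theta> *\<^sub>R snd p)) integrable_on {0..1}"
  using assms by (intro integrable_continuous_real continuous_on_compose2[OF assms(1)] continuous_intros)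
    (auto simp: seg_domain_def)

lemma mean_deriv_zero: "mean_deriv f (x, 0) = blinderiv f x"
  by (simp add: mean_deriv_def)

lemma mean_deriv_works:
  fixes f :: "'a::real_normed_vector \<Rightarrow> 'b::banach"
  assumes f: "C1 S f" and p: "(x, v) \<in> seg_domain S"
  shows "f (x + v) - f x = mean_deriv f (x, v) v"
proof -
  have "((\<lambda>\<theta>. blinderiv f (x + \<theta> *\<^sub>R v) v) has_integral f (x + 1 *\<^sub>R v) - f (x + 0 *\<^sub>R v)) {0..1}"
  proof (rule fundamental_theorem_of_calculus)
    fix \<theta> :: real assume "\<theta> \<in> {0..1}"
    then have "x + \<theta> *\<^sub>R v \<in> S" using p by (auto simp: seg_domain_def)
    note C1_has_derivative[OF f this]
    moreover have "((\<lambda>\<theta>. x + \<theta> *\<^sub>R v) has_vector_derivative v) (at \<theta>)"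
      by (auto intro!: derivative_eq_intros)
    ultimately have "((\<lambda>\<theta>. f (x + \<theta> *\<^sub>R v)) has_vector_derivative blinderiv f (x + \<theta> *\<^sub>R v) v) (at \<theta>)"
      using vector_derivative_diff_chain_within[of "\<lambda>\<theta>. x + \<theta> *\<^sub>R v" v \<theta> UNIV f]
      by (auto simp: o_def intro: has_derivative_at_withinI)
    then show "((\<lambda>\<theta>. f (x + \<theta> *\<^sub>R v)) has_vector_derivative blinderiv f (x + \<theta> *\<^sub>R v) v) (at \<theta> within {0..1})"
      using has_vector_derivative_at_within by blast
  qed simp
  moreover have "integral {0..1} ((\<lambda>D. blinfun_apply D v) \<circ> (\<lambda>\<theta>. blinderiv f (x + \<theta> *\<^sub>R v))) = mean_deriv f (x, v) v"
    unfolding mean_deriv_def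
    using seg_integrable[OF C1_continuous_deriv[OF f] p] 
    by (subst integral_linear) (auto intro: blinfun.bounded_linear_left)
  ultimately show ?thesis by (simp add: integral_unique o_def)
qed

text \<open>Differentiation under the integral sign; this is where the second derivative of \<open>f\<close> enters.\<close>

lemma mean_deriv_C1:
  fixes f :: "'a::euclidean_space \<Rightarrow> 'b::banach"
  assumes S: "open S" and f: "C1 S (blinderiv f)"
  shows "C1 (seg_domain S) (mean_deriv f)"
proof -
  define k where "k = blinderiv f"
  define L where "L = (\<lambda>\<theta>. fst_blinfun + \<theta> *\<^sub>R snd_blinfun :: ('a \<times> 'a) \<Rightarrow>\<^sub>L 'a)"
  define fx where "fx = (\<lambda>p \<theta>. blinderiv k (fst p + \<theta> *\<^sub>R snd p) o\<^sub>L L \<theta>)"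
  have ck: "continuous_on S (blinderiv k)" using f C1_continuous_deriv k_def by blast
  have cfx: "continuous_on (seg_domain S \<times> cbox 0 1) (\<lambda>(p, \<theta>). fx p \<theta>)"
    unfolding fx_def L_def case_prod_beta cbox_interval
    by (intro continuous_intros seg_continuous[OF ck]) auto
  have der: "(mean_deriv f has_derivative integral (cbox 0 1) (fx p)) (at p)" if p: "p \<in> seg_domain S" for p
  proof -
    obtain e where e: "e > 0" "ball p e \<subseteq> seg_domain S"
      using open_seg_domain[OF S] p open_contains_ball by blast
    have "((\<lambda>q. integral (cbox 0 1) (\<lambda>\<theta>. k (fst q + \<theta> *\<^sub>R snd q))) has_derivative integral (cbox 0 1) (fx p)) (at p within ball p e)"
    proof (rule leibniz_rule)
      fix q \<theta> assume q: "q \<in> ball p e" and \<theta>: "\<theta> \<in> cbox (0::real) 1"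
      then have "fst q + \<theta> *\<^sub>R snd q \<in> S" using e by (auto simp: seg_domain_def subset_iff)
      note dk = C1_has_derivative[OF f[folded k_def] this]
      have dL: "((\<lambda>q. fst q + \<theta> *\<^sub>R snd q) has_derivative blinfun_apply (L \<theta>)) (at q within ball p e)"
        unfolding L_def by (auto simp: blinfun.add_left blinfun.scaleR_left intro!: derivative_eq_intros)
      show "((\<lambda>q. k (fst q + \<theta> *\<^sub>R snd q)) has_derivative blinfun_apply (fx q \<theta>)) (at q within ball p e)"
        using has_derivative_compose[OF dL dk] by (simp add: fx_def blinfun_compose.rep_eq o_def)
    next
      fix q assume q: "q \<in> ball p e"
      show "(\<lambda>\<theta>. k (fst q + \<theta> *\<^sub>R snd q)) integrable_on cbox 0 1" 
        using seg_integrable[OF C1_continuous_on[OF f], of q] q e by (auto simp: k_def)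
    next
      show "continuous_on (ball p e \<times> cbox 0 1) (\<lambda>(x, t). fx x t)"
        using continuous_on_subset[OF cfx] e by (metis Sigma_mono order_refl)
    qed (use e in auto)
    then show ?thesis
      using e by (simp add: mean_deriv_def[abs_def] k_def at_within_open[of p "ball p e"])
  qed
  show ?thesis
  proof (rule C1_I[OF der])
    show "continuous_on (seg_domain S) (\<lambda>p. integral (cbox 0 1) (fx p))"
      using cfx by (rule integral_continuous_on_param)
  qed
qed

section \<open>Lyapunov--Schmidt reduction around an affine problem\<close>

text \<open>From \<open>G y - G y\<^sub>0 = G y (P y\<^sub>0 - P y) G y\<^sub>0\<close> one first gets that \<open>G\<close> is bounded near \<open>y\<^sub>0\<close>, then that it
  is continuous there.\<close>

lemma continuous_inverse_blinfun:
  fixes P G :: "'a::topological_space \<Rightarrow> 'b::real_normed_vector \<Rightarrow>\<^sub>L 'b"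
  assumes P: "continuous_on V P" and GP: "\<And>y. y \<in> V \<Longrightarrow> G y o\<^sub>L P y = id_blinfun"
    and PG: "\<And>y. y \<in> V \<Longrightarrow> P y o\<^sub>L G y = id_blinfun"
  shows "continuous_on V G"
  unfolding continuous_on_def
proof
  fix y0 assume y0: "y0 \<in> V"
  have tP: "(P \<longlongrightarrow> P y0) (at y0 within V)" using P y0 by (auto simp: continuous_on_def)
  define c where "c = norm (G y0) + 1"
  have c: "c > 0" by (simp add: c_def add_nonneg_pos)
  have id: "G y - G y0 = G y o\<^sub>L (P y0 - P y) o\<^sub>L G y0" if "y \<in> V" for y
  proof (rule blinfun_eqI)
    fix v
    have "G y (P y (G y0 v)) = G y0 v" "P y0 (G y0 v) = v"
      using GP[OF that] PG[OF y0] by (metis blinfun_apply_blinfun_compose blinfun_apply_id_blinfun)+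
    then show "(G y - G y0) v = (G y o\<^sub>L (P y0 - P y) o\<^sub>L G y0) v"
      by (simp add: blinfun.diff_left blinfun.diff_right)
  qed
  have bd: "norm (G y - G y0) \<le> norm (G y) * norm (P y - P y0) * c" if "y \<in> V" for y
  proof -
    have "norm (G y - G y0) \<le> norm (G y o\<^sub>L (P y0 - P y)) * norm (G y0)"
      unfolding id[OF that] by (rule norm_blinfun_compose)
    also have "\<dots> \<le> (norm (G y) * norm (P y0 - P y)) * c"
      by (intro mult_mono norm_blinfun_compose) (auto simp: c_def)
    finally show ?thesis by (simp add: norm_minus_commute)
  qed
  have ev: "\<forall>\<^sub>F y in at y0 within V. y \<in> V \<and> norm (P y - P y0) < 1 / (2*c)"
    using tendstoD[OF tP, of "1 / (2*c)"] c 
    by (auto simp: dist_norm eventually_at_filter elim: eventually_mono)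
  have "\<forall>\<^sub>F y in at y0 within V. norm (G y - G y0) \<le> 2 * c * c * norm (P y - P y0)"
  proof (rule eventually_mono[OF ev])
    fix y assume y: "y \<in> V \<and> norm (P y - P y0) < 1 / (2*c)"
    then have "norm (P y - P y0) * c \<le> 1/2" using c by (simp add: field_simps)
    then have "norm (G y) * (norm (P y - P y0) * c) \<le> norm (G y) * (1/2)" by (intro mult_left_mono) auto
    then have "norm (G y - G y0) \<le> norm (G y) * (1/2)" using bd[of y] y by (simp add: mult.assoc)
    moreover have "norm (G y) \<le> norm (G y0) + norm (G y - G y0)" by (metis norm_triangle_sub)
    ultimately have "norm (G y) \<le> 2 * c" by (simp add: c_def)
    then have "norm (G y) * norm (P y - P y0) * c \<le> 2 * c * norm (P y - P y0) * c"
      using c by (intro mult_right_mono) auto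
    then show "norm (G y - G y0) \<le> 2 * c * c * norm (P y - P y0)" using bd[of y] y by (simp add: mult_ac)
  qed
  moreover have "((\<lambda>y. 2 * c * c * norm (P y - P y0)) \<longlongrightarrow> 2 * c * c * norm (P y0 - P y0)) (at y0 within V)"
    by (intro tendsto_intros tP)
  then have "((\<lambda>y. 2 * c * c * norm (P y - P y0)) \<longlongrightarrow> 0) (at y0 within V)" by simp
  ultimately have "((\<lambda>y. G y - G y0) \<longlongrightarrow> 0) (at y0 within V)"
    by (rule Lim_null_comparison)
  then show "(G \<longlongrightarrow> G y0) (at y0 within V)" by (simp add: LIM_zero_iff)
qed

text \<open>The inverse function theorem, supplemented by the continuity of the derivative of the inverse.\<close>

lemma C1_local_inverse:
  fixes \<Theta> :: "'a::euclidean_space \<Rightarrow> 'a"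
  assumes D: "open D" and \<Theta>: "C1 D \<Theta>" and p: "p \<in> D"
    and inj: "\<And>v. blinderiv \<Theta> p v = 0 \<Longrightarrow> v = 0"
  obtains V G where "open V" "\<Theta> p \<in> V" "C1 V G" "G (\<Theta> p) = p"
    "\<And>y. y \<in> V \<Longrightarrow> G y \<in> D \<and> \<Theta> (G y) = y"
proof -
  have "inj (blinfun_apply (blinderiv \<Theta> p))"
    using inj by (metis blinfun.bounded_linear_right bounded_linear.linear linear_injective_0)
  then obtain h where h: "linear h" "h \<circ> blinfun_apply (blinderiv \<Theta> p) = id"
    using linear_injective_left_inverse blinfun.bounded_linear_right bounded_linear.linear by metis
  have bh: "bounded_linear h" using h linear_conv_bounded_linear by blast
  have inv: "Blinfun h o\<^sub>L blinderiv \<Theta> p = id_blinfun"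
    using h(2) by (intro blinfun_eqI) (auto simp: bounded_linear_Blinfun_apply[OF bh] fun_eq_iff)
  obtain U V g g' where *: "U \<subseteq> D" "p \<in> U" "open V" "\<Theta> p \<in> V" "homeomorphism U V \<Theta> g"
    "\<And>y. y \<in> V \<Longrightarrow> (g has_derivative (g' y)) (at y)"
    "\<And>y. y \<in> V \<Longrightarrow> g' y = Hilbert_Choice.inv (blinfun_apply (blinderiv \<Theta> (g y)))"
    "\<And>y. y \<in> V \<Longrightarrow> bij (blinfun_apply (blinderiv \<Theta> (g y)))"
    using inverse_function_theorem[OF D C1_has_derivative[OF \<Theta>] C1_continuous_deriv[OF \<Theta>] p inv] by metis
  have gU: "g y \<in> U" "\<Theta> (g y) = y" if "y \<in> V" for y
    using *(5) that by (auto simp: homeomorphism_def)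
  have cg: "continuous_on V g" using *(5) homeomorphism_def by blast
  define E where "E = (\<lambda>y. Blinfun (g' y))"
  have E: "blinfun_apply (E y) = g' y" if "y \<in> V" for y
    using *(6)[OF that] by (simp add: E_def bounded_linear_Blinfun_apply has_derivative_bounded_linear)
  have "continuous_on V E"
  proof (rule continuous_inverse_blinfun)
    show "continuous_on V (\<lambda>y. blinderiv \<Theta> (g y))"
      using gU *(1) by (intro continuous_on_compose2[OF C1_continuous_deriv[OF \<Theta>] cg]) auto
    show "E y o\<^sub>L blinderiv \<Theta> (g y) = id_blinfun" "blinderiv \<Theta> (g y) o\<^sub>L E y = id_blinfun" if "y \<in> V" for y
      using *(7,8)[OF that] E[OF that]
      by (auto intro!: blinfun_eqI simp: bij_is_inj bij_is_surj surj_f_inv_f)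
  qed
  then have "C1 V g" using *(6) E by (intro C1_I[where D=E]) auto
  moreover have "g (\<Theta> p) = p" using *(2,5) by (auto simp: homeomorphism_def)
  ultimately show ?thesis using that[OF *(3,4)] gU *(1) by blast
qed

text \<open>At \<open>\<epsilon> = 0\<close> the equation is affine and invertible in \<open>v\<close>, uniformly in the phase \<open>s\<close> because the
  phases form a circle. Hence on each ball \<open>|v| \<le> R\<close> the equation for small \<open>\<epsilon>\<close> is a contraction, which
  gives existence and uniqueness; smoothness then comes from the inverse function theorem.\<close>

theorem affine_perturbation_zeros:
  fixes F :: "real \<times> real \<times> 'e::euclidean_space \<Rightarrow> 'e"
  assumes D: "open D" and F: "C1 D F" and D0: "\<And>s v. (s, 0, v) \<in> D" and \<tau>: "\<tau> > 0"
    and perD: "\<And>s \<epsilon> v. (s + \<tau>, \<epsilon>, v) \<in> D \<longleftrightarrow> (s, \<epsilon>, v) \<in> D"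
    and perF: "\<And>s \<epsilon> v. (s, \<epsilon>, v) \<in> D \<Longrightarrow> F (s + \<tau>, \<epsilon>, v) = F (s, \<epsilon>, v)"
    and aff: "\<And>s. \<exists>A. linear A \<and> inj A \<and> (\<forall>v. F (s, 0, v) = A v + F (s, 0, 0))"
  obtains \<epsilon>1 R0 C w where "\<epsilon>1 > 0" "C1 (UNIV \<times> {-\<epsilon>1<..<\<epsilon>1}) (\<lambda>(s, \<epsilon>). w s \<epsilon>)"
    "\<And>s \<epsilon>. \<bar>\<epsilon>\<bar> < \<epsilon>1 \<Longrightarrow> (s, \<epsilon>, w s \<epsilon>) \<in> D \<and> F (s, \<epsilon>, w s \<epsilon>) = 0 \<and> norm (w s \<epsilon>) \<le> R0 \<and>
        w (s + \<tau>) \<epsilon> = w s \<epsilon> \<and> norm (w s \<epsilon> - w s 0) \<le> C * \<bar>\<epsilon>\<bar>"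
    "\<And>R. \<exists>\<epsilon>0>0. \<epsilon>0 \<le> \<epsilon>1 \<and> (\<forall>s \<epsilon> v. \<bar>\<epsilon>\<bar> < \<epsilon>0 \<longrightarrow> norm v \<le> R \<longrightarrow>
        (s, \<epsilon>, v) \<in> D \<and> (F (s, \<epsilon>, v) = 0 \<longrightarrow> v = w s \<epsilon>))"
proof -
  have contF: "continuous_on D F" using F by (rule C1_continuous_on)
  have perk: "((s + of_int k * \<tau>, \<epsilon>, v) \<in> D \<longleftrightarrow> (s, \<epsilon>, v) \<in> D) \<and>
      ((s, \<epsilon>, v) \<in> D \<longrightarrow> F (s + of_int k * \<tau>, \<epsilon>, v) = F (s, \<epsilon>, v))" for s \<epsilon> v and k :: int
  proof (induction k rule: int_induct[where k=0])
    case (step1 i)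
    have "s + of_int (i + 1) * \<tau> = (s + of_int i * \<tau>) + \<tau>" by (simp add: algebra_simps)
    then show ?case using perD perF step1 by metis
  next
    case (step2 i)
    have "s + of_int i * \<tau> = (s + of_int (i - 1) * \<tau>) + \<tau>" by (simp add: algebra_simps)
    then show ?case using perD perF step2 by metis
  qed auto
  have red: "\<exists>s'\<in>{0..\<tau>}. \<exists>k::int. s = s' + of_int k * \<tau>" for s
    using reduce_period[OF \<tau>, of s] by force
  define A where "A = (\<lambda>s v. F (s, 0, v) - F (s, 0, 0))"
  define E where "E = (\<lambda>s \<epsilon> v. F (s, \<epsilon>, v) - F (s, 0, v))"
  have A: "linear (A s)" "inj (A s)" for s
  proof -
    obtain B where B: "linear B" "inj B" "\<forall>v. F (s, 0, v) = B v + F (s, 0, 0)" using aff by blast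
    have "A s v = B v" for v unfolding A_def by (subst B(3)[rule_format]) simp
    then have "A s = B" by blast
    then show "linear (A s)" "inj (A s)" using \<open>linear B\<close> \<open>inj B\<close> by auto
  qed
  have Aper: "A (s + of_int k * \<tau>) = A s" for s and k :: int
    using perk D0 by (auto simp: A_def fun_eq_iff)
  \<comment> \<open>compactness of the circle of phases gives one lower bound for all the maps \<open>A s\<close>\<close>
  obtain \<kappa> where \<kappa>: "\<kappa> > 0" and \<kappa>A: "\<And>s v. \<kappa> * norm v \<le> norm (A s v)"
  proof -
    have "compact ({0..\<tau>} \<times> sphere (0::'e) 1)" by (intro compact_Times) auto
    moreover have "{0..\<tau>} \<times> sphere (0::'e) 1 \<noteq> {}" using \<tau> by auto
    moreover have "continuous_on ({0..\<tau>} \<times> sphere 0 1) (\<lambda>p. norm (A (fst p) (snd p)))"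
      unfolding A_def
      by (intro continuous_intros continuous_on_compose2[OF contF]) (auto simp: D0)
    ultimately obtain p where p: "p \<in> {0..\<tau>} \<times> sphere (0::'e) 1"
      and min: "\<And>q. q \<in> {0..\<tau>} \<times> sphere (0::'e) 1 \<Longrightarrow> norm (A (fst p) (snd p)) \<le> norm (A (fst q) (snd q))"
      using continuous_attains_inf[of "{0..\<tau>} \<times> sphere (0::'e) 1" "\<lambda>p. norm (A (fst p) (snd p))"] by blast
    have "snd p \<noteq> 0" using p by auto
    then have pos: "norm (A (fst p) (snd p)) > 0"
      using A linear_injective_0 by (metis zero_less_norm_iff)
    have "norm (A (fst p) (snd p)) * norm v \<le> norm (A s v)" for s v
    proof (cases "v = 0")
      case True then show ?thesis by simp
    next
      case False
      obtain s' k where s': "s' \<in> {0..\<tau>}" "s = s' + of_int k * \<tau>" using red by blast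
      have "norm (A (fst p) (snd p)) \<le> norm (A s' (v /\<^sub>R norm v))"
        using min[of "(s', v /\<^sub>R norm v)"] s' False by simp
      also have "\<dots> = norm (A s v) / norm v"
        using s' Aper linear_cmul[OF A(1)] by (simp add: divide_inverse mult.commute)
      finally show ?thesis using False by (simp add: field_simps)
    qed
    then show ?thesis using that pos by blast
  qed
  \<comment> \<open>on bounded sets the deviation \<open>E\<close> from the affine problem is small in \<open>C\<^sup>1\<close>, by the tube lemma\<close>
  have ball: "\<exists>d>0. \<forall>s \<epsilon>. \<bar>\<epsilon>\<bar> \<le> d \<longrightarrow> (\<forall>v\<in>cball 0 R. (s, \<epsilon>, v) \<in> D \<and> norm (E s \<epsilon> v) \<le> \<kappa> / 2 \<and>
      (\<forall>v'\<in>cball 0 R. norm (E s \<epsilon> v - E s \<epsilon> v') \<le> \<kappa> / 2 * norm (v - v')))" for R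
  proof -
    define h where "h = (\<lambda>p. norm (blinderiv F p - blinderiv F (fst p, 0, snd (snd p))))"
    define h' where "h' = (\<lambda>p. norm (F p - F (fst p, 0, snd (snd p))))"
    define W where "W = (D \<inter> h -` {..<\<kappa>/2}) \<inter> (D \<inter> h' -` {..<\<kappa>/2})"
    have "continuous_on D h" "continuous_on D h'" unfolding h_def h'_def
      by (intro continuous_intros continuous_on_compose2[OF C1_continuous_deriv[OF F]] 
          continuous_on_compose2[OF contF]; auto simp: D0)+
    then have "open W" unfolding W_def using D by (intro open_Int continuous_open_preimage) auto
    then have W1: "open ((\<lambda>q. (fst (snd q), fst q, snd (snd q))) -` W)"
      by (rule open_vimage) (intro continuous_intros)
    have W2: "{0} \<times> ({0..\<tau>} \<times> cball 0 R) \<subseteq> (\<lambda>q. (fst (snd q), fst q, snd (snd q))) -` W"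
      using D0 \<kappa> by (auto simp: W_def h_def h'_def)
    have W3: "compact ({0..\<tau>} \<times> cball (0::'e) R)" by (intro compact_Times) auto
    obtain d where d: "d > 0"
      "\<And>\<epsilon> q. dist \<epsilon> 0 \<le> d \<Longrightarrow> q \<in> {0..\<tau>} \<times> cball 0 R \<Longrightarrow> (\<epsilon>, q) \<in> (\<lambda>q. (fst (snd q), fst q, snd (snd q))) -` W"
      using compact_slice_tube[OF W3 W1 W2] by blast
    have W: "(s, \<epsilon>, v) \<in> W" if "\<bar>\<epsilon>\<bar> \<le> d" "s \<in> {0..\<tau>}" "v \<in> cball 0 R" for s \<epsilon> v
      using d(2)[of \<epsilon> "(s, v)"] that by simp
    have 1: "norm (E s \<epsilon> v - E s \<epsilon> v') \<le> \<kappa> / 2 * norm (v - v')"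
      if s: "\<bar>\<epsilon>\<bar> \<le> d" "s \<in> {0..\<tau>}" and v: "v \<in> cball 0 R" "v' \<in> cball 0 R" for s \<epsilon> v v'
    proof (rule differentiable_bound[where S="cball 0 R" and 
          f'="\<lambda>z u. (blinderiv F (s, \<epsilon>, z) - blinderiv F (s, 0, z)) (0, 0, u)"])
      fix z assume z: "z \<in> cball (0::'e) R"
      have zW: "(s, \<epsilon>, z) \<in> W" using W[OF s z] .
      have "((\<lambda>z. F (s, e, z)) has_derivative (\<lambda>u. blinderiv F (s, e, z) (0, 0, u))) (at z within cball 0 R)"
        if "(s, e, z) \<in> D" for e
      proof -
        have "((\<lambda>z. (s, e, z)) has_derivative (\<lambda>u. (0, 0, u))) (at z within cball 0 R)"
          by (auto intro!: derivative_eq_intros)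
        from has_derivative_compose[OF this C1_has_derivative[OF F that]] show ?thesis .
      qed
      then show "(E s \<epsilon> has_derivative (\<lambda>u. (blinderiv F (s, \<epsilon>, z) - blinderiv F (s, 0, z)) (0, 0, u))) (at z within cball 0 R)"
        using zW D0 unfolding E_def W_def by (auto intro!: derivative_eq_intros simp: blinfun.diff_left)
      show "onorm (\<lambda>u. (blinderiv F (s, \<epsilon>, z) - blinderiv F (s, 0, z)) (0, 0, u)) \<le> \<kappa> / 2"
      proof (rule onorm_le)
        fix u :: 'e
        have "norm ((blinderiv F (s, \<epsilon>, z) - blinderiv F (s, 0, z)) (0, 0, u)) 
            \<le> norm (blinderiv F (s, \<epsilon>, z) - blinderiv F (s, 0, z)) * norm (0::real, 0::real, u)"
          by (rule norm_blinfun)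
        also have "\<dots> \<le> \<kappa> / 2 * norm (0::real, 0::real, u)"
          using zW by (intro mult_right_mono) (auto simp: W_def h_def)
        finally show "norm ((blinderiv F (s, \<epsilon>, z) - blinderiv F (s, 0, z)) (0, 0, u)) \<le> \<kappa> / 2 * norm u"
          by (simp add: norm_Pair)
      qed
    qed (use v in auto)
    have Eper: "E (s' + of_int k * \<tau>) \<epsilon> v = E s' \<epsilon> v" if "(s', \<epsilon>, v) \<in> D" for s' \<epsilon> v and k :: int
      using perk D0 that by (auto simp: E_def)
    show ?thesis
    proof (intro exI[of _ d] conjI d allI impI ballI)
      fix s \<epsilon> v assume e: "\<bar>\<epsilon>\<bar> \<le> d" and v: "v \<in> cball (0::'e) R"
      obtain s' k where s': "s' \<in> {0..\<tau>}" "s = s' + of_int k * \<tau>" using red by blast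
      have inD: "(s', \<epsilon>, u) \<in> D" if "u \<in> cball 0 R" for u using W[OF e s'(1) that] by (auto simp: W_def)
      show "(s, \<epsilon>, v) \<in> D" using inD[OF v] perk s' by simp
      show "norm (E s \<epsilon> v) \<le> \<kappa> / 2"
        using W[OF e s'(1) v] Eper[OF inD[OF v]] s'(2) by (auto simp: W_def h'_def E_def)
      fix v' assume v': "v' \<in> cball (0::'e) R"
      show "norm (E s \<epsilon> v - E s \<epsilon> v') \<le> \<kappa> / 2 * norm (v - v')"
        using 1[OF e s'(1) v v'] Eper[OF inD[OF v]] Eper[OF inD[OF v']] s'(2) by simp
    qed
  qed
  have Fdec: "F (s, \<epsilon>, v) = A s v + F (s, 0, 0) + E s \<epsilon> v" for s \<epsilon> v by (simp add: A_def E_def)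
  have lower: "\<kappa> / 2 * norm (v - v') \<le> norm (F (s, \<epsilon>, v) - F (s, \<epsilon>, v'))"
    if "norm (E s \<epsilon> v - E s \<epsilon> v') \<le> \<kappa> / 2 * norm (v - v')" for s \<epsilon> v v'
  proof -
    have "A s (v - v') = (F (s, \<epsilon>, v) - F (s, \<epsilon>, v')) - (E s \<epsilon> v - E s \<epsilon> v')"
      unfolding linear_diff[OF A(1)] by (simp add: A_def E_def)
    then have "norm (A s (v - v')) \<le> norm (F (s, \<epsilon>, v) - F (s, \<epsilon>, v')) + norm (E s \<epsilon> v - E s \<epsilon> v')"
      by (metis norm_triangle_ineq4)
    then show ?thesis using \<kappa>A[of "v - v'" s] that by simp
  qed
  obtain c0 where c0: "\<And>s. norm (F (s, 0, 0)) \<le> c0"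
  proof -
    have "continuous_on {0..\<tau>} (\<lambda>s. F (s, 0, 0))"
      by (intro continuous_on_compose2[OF contF] continuous_intros) (auto simp: D0)
    then obtain c0 where "\<And>s. s \<in> {0..\<tau>} \<Longrightarrow> norm (F (s, 0, 0)) \<le> c0"
      by (rule bounded_on_compact[OF _ compact_Icc]) (rule that; blast)
    then have "norm (F (s, 0, 0)) \<le> c0" for s using red[of s] perk D0 by metis
    then show ?thesis by (rule that)
  qed
  \<comment> \<open>\<open>R0\<close> bounds \<open>inv (A s)\<close> of the right-hand side. The larger ball of radius \<open>R1\<close> keeps the solutions in
    the interior, so that nearby zeros found by the inverse function theorem are covered by uniqueness.\<close>
  define R0 where "R0 = (c0 + \<kappa> / 2) / \<kappa>"
  define R1 where "R1 = R0 + 1"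
  have c0': "c0 \<ge> 0" using c0 norm_ge_zero order_trans by blast
  have R0: "R0 \<ge> 0" using \<kappa> c0' by (simp add: R0_def)
  obtain d1 where d1: "d1 > 0" and d1D: "\<And>s \<epsilon> v. \<bar>\<epsilon>\<bar> \<le> d1 \<Longrightarrow> v \<in> cball 0 R1 \<Longrightarrow> (s, \<epsilon>, v) \<in> D"
    and d1E: "\<And>s \<epsilon> v. \<bar>\<epsilon>\<bar> \<le> d1 \<Longrightarrow> v \<in> cball 0 R1 \<Longrightarrow> norm (E s \<epsilon> v) \<le> \<kappa> / 2"
    and d1L: "\<And>s \<epsilon> v v'. \<bar>\<epsilon>\<bar> \<le> d1 \<Longrightarrow> v \<in> cball 0 R1 \<Longrightarrow> v' \<in> cball 0 R1 \<Longrightarrow> 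
        norm (E s \<epsilon> v - E s \<epsilon> v') \<le> \<kappa> / 2 * norm (v - v')"
    using ball[of R1] by blast
  have ex: "\<exists>v. norm v \<le> R0 \<and> F (s, \<epsilon>, v) = 0" if \<epsilon>: "\<bar>\<epsilon>\<bar> \<le> d1" for s \<epsilon>
  proof -
    have surj: "surj (A s)" using A linear_injective_imp_surjective by blast
    define T where "T = (\<lambda>v. inv (A s) (- (F (s, 0, 0) + E s \<epsilon> v)))"
    have AT: "A s (T v) = - (F (s, 0, 0) + E s \<epsilon> v)" for v
      unfolding T_def using surj by (simp add: surj_f_inv_f)
    have TR0: "norm (T v) \<le> R0" if "v \<in> cball 0 R1" for v
    proof -
      have "\<kappa> * norm (T v) \<le> norm (F (s, 0, 0)) + norm (E s \<epsilon> v)"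
        using \<kappa>A[of "T v" s] norm_triangle_ineq[of "F (s, 0, 0)" "E s \<epsilon> v"] unfolding AT norm_minus_cancel by linarith
      also have "\<dots> \<le> c0 + \<kappa> / 2" using c0 d1E[OF \<epsilon> that] by (intro add_mono) auto
      finally show ?thesis using \<kappa> by (simp add: R0_def field_simps)
    qed
    have "\<exists>!v\<in>cball 0 R1. T v = v"
    proof (rule Banach_fix[where c="1/2"])
      show "complete (cball (0::'e) R1)" by (simp add: complete_eq_closed)
      show "cball (0::'e) R1 \<noteq> {}" using R0 by (auto simp: R1_def)
      show "T ` cball 0 R1 \<subseteq> cball 0 R1" using TR0 by (force simp: R1_def)
      fix v v' :: 'e assume v: "v \<in> cball 0 R1" "v' \<in> cball 0 R1"
      have "\<kappa> * norm (T v - T v') \<le> norm (A s (T v - T v'))" by (rule \<kappa>A)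
      also have "A s (T v - T v') = E s \<epsilon> v' - E s \<epsilon> v" by (simp add: linear_diff[OF A(1)] AT)
      also have "norm \<dots> \<le> \<kappa> / 2 * norm (v - v')" using d1L[OF \<epsilon> v] by (simp add: norm_minus_commute)
      finally show "dist (T v) (T v') \<le> 1/2 * dist v v'" using \<kappa> by (simp add: dist_norm)
    qed auto
    then obtain v where v: "v \<in> cball 0 R1" "T v = v" by blast
    have "F (s, \<epsilon>, v) = 0" using AT[of v] Fdec[of s \<epsilon> v] by (simp add: v(2))
    then show ?thesis using TR0[OF v(1)] v(2) by auto
  qed
  have uniq: "v = v'" if "\<bar>\<epsilon>\<bar> \<le> d1" "norm v \<le> R1" "norm v' \<le> R1" "F (s, \<epsilon>, v) = 0" "F (s, \<epsilon>, v') = 0" for s \<epsilon> v v'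
  proof -
    have "\<kappa> / 2 * norm (v - v') \<le> norm (F (s, \<epsilon>, v) - F (s, \<epsilon>, v'))"
      using that by (intro lower d1L) auto
    then show ?thesis using that \<kappa> by (simp add: mult_le_0_iff)
  qed
  define w where "w = (\<lambda>s \<epsilon>. SOME v. norm v \<le> R0 \<and> F (s, \<epsilon>, v) = 0)"
  have w: "norm (w s \<epsilon>) \<le> R0" "F (s, \<epsilon>, w s \<epsilon>) = 0" if "\<bar>\<epsilon>\<bar> \<le> d1" for s \<epsilon>
    using someI_ex[OF ex[OF that, of s]] unfolding w_def by auto
  have w_eq: "v = w s \<epsilon>" if "\<bar>\<epsilon>\<bar> \<le> d1" "norm v \<le> R1" "F (s, \<epsilon>, v) = 0" for s \<epsilon> v
    using uniq[OF that(1,2) _ that(3), of "w s \<epsilon>"] w[OF that(1), of s] by (simp add: R1_def)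
  have wper: "w (s + of_int k * \<tau>) \<epsilon> = w s \<epsilon>" if "\<bar>\<epsilon>\<bar> \<le> d1" for s \<epsilon> and k :: int
  proof -
    have "w s \<epsilon> \<in> cball 0 R1" using w(1)[OF that, of s] by (simp add: R1_def)
    then have "F (s + of_int k * \<tau>, \<epsilon>, w s \<epsilon>) = 0" using w(2)[OF that, of s] perk d1D[OF that] by metis
    moreover have "norm (w s \<epsilon>) \<le> R1" using w(1)[OF that, of s] by (simp add: R1_def)
    ultimately show ?thesis using w_eq[OF that] by metis
  qed
  have wC1: "C1 (UNIV \<times> {-d1<..<d1}) (\<lambda>(s, \<epsilon>). w s \<epsilon>)"
  proof (rule C1_local)
    fix q :: "real \<times> real" assume "q \<in> UNIV \<times> {-d1<..<d1}"
    then obtain s0 e0 where q: "q = (s0, e0)" and e0: "\<bar>e0\<bar> < d1" by (cases q) auto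
    define w0 where "w0 = w s0 e0"
    have w0: "norm w0 \<le> R0" "F (s0, e0, w0) = 0" using w[of e0 s0] e0 by (auto simp: w0_def)
    have pD: "(s0, e0, w0) \<in> D" using d1D[of e0 w0 s0] w0 e0 by (auto simp: R1_def)
    define \<Theta> where "\<Theta> = (\<lambda>p. (fst p, fst (snd p), F p))"
    have \<Theta>: "C1 D \<Theta>" unfolding \<Theta>_def by (intro C1_intros F)
    have der\<Theta>: "blinderiv \<Theta> (s0, e0, w0) u = (fst u, fst (snd u), blinderiv F (s0, e0, w0) u)" for u
    proof -
      have "(\<Theta> has_derivative (\<lambda>u. (fst u, fst (snd u), blinderiv F (s0, e0, w0) u))) (at (s0, e0, w0))"
        unfolding \<Theta>_def using C1_has_derivative[OF F pD] by (auto intro!: derivative_eq_intros)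
      from has_derivative_unique[OF C1_has_derivative[OF \<Theta> pD] this] show ?thesis by (rule fun_cong)
    qed
    \<comment> \<open>a kernel vector would contradict the lower bound for difference quotients of \<open>F\<close> in \<open>v\<close>\<close>
    have inj: "u = 0" if "blinderiv \<Theta> (s0, e0, w0) u = 0" for u
    proof -
      have u: "fst u = 0" "fst (snd u) = 0" "blinderiv F (s0, e0, w0) u = 0"
        using that unfolding der\<Theta> by (simp_all add: prod_eq_iff)
      define v where "v = snd (snd u)"
      have ueq: "u = (0, 0, v)" using u by (simp add: v_def prod_eq_iff)
      have "v = 0"
      proof (rule ccontr)
        assume "v \<noteq> 0"
        define g where "g = (\<lambda>t::real. F (s0, e0, w0 + t *\<^sub>R v))"
        have "((\<lambda>t. (s0, e0, w0 + t *\<^sub>R v)) has_derivative (\<lambda>t. (0, 0, t *\<^sub>R v))) (at 0)"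
          by (auto intro!: derivative_eq_intros)
        from has_derivative_compose[OF this, of F "blinderiv F (s0, e0, w0)"] C1_has_derivative[OF F pD]
        have "(g has_derivative (\<lambda>t. blinderiv F (s0, e0, w0) (0, 0, t *\<^sub>R v))) (at 0)"
          by (simp add: g_def)
        moreover have "blinderiv F (s0, e0, w0) (0, 0, t *\<^sub>R v) = 0" for t
          using u(3) blinfun.scaleR_right[of "blinderiv F (s0, e0, w0)" t u] by (simp add: ueq)
        ultimately have dg: "(g has_derivative (\<lambda>t. 0)) (at 0)" by simp
        have "\<kappa> / 4 * norm v > 0" using \<kappa> \<open>v \<noteq> 0\<close> by simp
        then have "\<exists>d>0. \<forall>t. norm (t - 0) < d \<longrightarrow> norm (g t - g 0 - 0) \<le> \<kappa> / 4 * norm v * norm (t - 0)"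
          using dg unfolding has_derivative_at_alt by blast
        then obtain d where d: "d > 0" "\<And>t. \<bar>t\<bar> < d \<Longrightarrow> norm (g t - g 0) \<le> \<kappa> / 4 * norm v * \<bar>t\<bar>"
          by auto
        define t where "t = min (d / 2) (1 / norm v)"
        have t: "t > 0" "t < d" "t * norm v \<le> 1" using d \<open>v \<noteq> 0\<close> by (auto simp: t_def field_simps min_def)
        have "norm (w0 + t *\<^sub>R v) \<le> norm w0 + t * norm v" 
          using norm_triangle_ineq[of w0 "t *\<^sub>R v"] t by simp
        then have "w0 + t *\<^sub>R v \<in> cball 0 R1" "w0 \<in> cball 0 R1" using t w0 by (auto simp: R1_def)
        then have "\<kappa> / 2 * norm (w0 + t *\<^sub>R v - w0) \<le> norm (F (s0, e0, w0 + t *\<^sub>R v) - F (s0, e0, w0))"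
          using e0 by (intro lower d1L) auto
        then have "\<kappa> / 2 * (t * norm v) \<le> norm (g t - g 0)" using t by (simp add: g_def)
        also have "\<dots> \<le> \<kappa> / 4 * norm v * t" using d(2)[of t] t by simp
        finally have "\<kappa> * (t * norm v) \<le> 0" by simp
        moreover have "0 < \<kappa> * (t * norm v)" using \<kappa> t \<open>v \<noteq> 0\<close> by simp
        ultimately show False by linarith
      qed
      then show ?thesis using ueq by (simp add: zero_prod_def)
    qed
    obtain V G where V: "open V" "\<Theta> (s0, e0, w0) \<in> V" and G: "C1 V G" "G (\<Theta> (s0, e0, w0)) = (s0, e0, w0)"
      and inv: "\<And>y. y \<in> V \<Longrightarrow> G y \<in> D \<and> \<Theta> (G y) = y"
      using C1_local_inverse[OF D \<Theta> pD inj] by blast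
    have \<Theta>p: "\<Theta> (s0, e0, w0) = (s0, e0, 0)" by (simp add: \<Theta>_def w0)
    define \<iota> where "\<iota> = (\<lambda>q::real \<times> real. (fst q, snd q, 0::'e))"
    define V' where "V' = V \<inter> (\<lambda>y. norm (snd (snd (G y)))) -` {..<R1}"
    have "open V'" unfolding V'_def
      by (intro continuous_open_preimage continuous_intros C1_continuous_on[OF G(1)] V)
    define N where "N = \<iota> -` V' \<inter> UNIV \<times> {-d1<..<d1}"
    have "open N" unfolding N_def \<iota>_def
      by (intro open_Int open_vimage[OF \<open>open V'\<close>] open_Times continuous_intros) auto
    moreover have "q \<in> N" using V(2) e0 w0(1) G(2) by (auto simp: N_def V'_def q \<iota>_def \<Theta>p R1_def)
    moreover have "C1 N (\<lambda>(s, \<epsilon>). w s \<epsilon>)"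
    proof (rule C1_cong[OF \<open>open N\<close>])
      have \<iota>: "C1 N \<iota>" unfolding \<iota>_def by (intro C1_intros)
      show "C1 N (\<lambda>q. snd (snd (G (\<iota> q))))"
        by (intro C1_intros C1_compose[OF G(1) \<iota>]) (auto simp: N_def V'_def)
      fix q assume "q \<in> N"
      then obtain s \<epsilon> where q: "q = (s, \<epsilon>)" "\<bar>\<epsilon>\<bar> < d1" "\<iota> (s, \<epsilon>) \<in> V'" by (cases q) (auto simp: N_def)
      then have "\<iota> q \<in> V" "norm (snd (snd (G (\<iota> q)))) < R1" by (auto simp: V'_def)
      moreover from this have "\<Theta> (G (\<iota> q)) = (s, \<epsilon>, 0)" using inv q by (auto simp: \<iota>_def)
      then have "G (\<iota> q) = (s, \<epsilon>, snd (snd (G (\<iota> q))))" "F (G (\<iota> q)) = 0"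
        by (auto simp: \<Theta>_def prod_eq_iff)
      ultimately have "snd (snd (G (\<iota> q))) = w s \<epsilon>" using q by (intro w_eq) auto
      then show "snd (snd (G (\<iota> q))) = (case q of (s, \<epsilon>) \<Rightarrow> w s \<epsilon>)" by (simp add: q)
    qed
    ultimately show "\<exists>N. open N \<and> q \<in> N \<and> C1 N (\<lambda>(s, \<epsilon>). w s \<epsilon>)" by blast
  qed
  define \<epsilon>1 where "\<epsilon>1 = d1 / 2"
  have \<epsilon>1: "\<epsilon>1 > 0" "\<epsilon>1 < d1" using d1 by (auto simp: \<epsilon>1_def)
  define ww where "ww = (\<lambda>(s, \<epsilon>). w s \<epsilon>)"
  have wwC1: "C1 (UNIV \<times> {-d1<..<d1}) ww" using wC1 by (simp add: ww_def)
  let ?K = "{0..\<tau>} \<times> {-\<epsilon>1..\<epsilon>1}"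
  have "continuous_on ?K (blinderiv ww)"
    by (rule continuous_on_subset[OF C1_continuous_deriv[OF wwC1]]) (use \<epsilon>1 in auto)
  then obtain C where C: "\<And>q. q \<in> ?K \<Longrightarrow> norm (blinderiv ww q) \<le> C"
    by (rule bounded_on_compact[OF _ compact_Times[OF compact_Icc compact_Icc]]) (rule that; blast)
  have lip: "norm (w s \<epsilon> - w s 0) \<le> C * \<bar>\<epsilon>\<bar>" if e: "\<bar>\<epsilon>\<bar> < \<epsilon>1" for s \<epsilon>
  proof -
    obtain s' k where s': "s' \<in> {0..\<tau>}" "s = s' + of_int k * \<tau>" using red by blast
    have "norm (ww (s', \<epsilon>) - ww (s', 0)) \<le> C * norm ((s', \<epsilon>) - (s', 0))"
    proof (rule differentiable_bound[where S="?K" and f'="\<lambda>q. blinfun_apply (blinderiv ww q)"])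
      fix q assume "q \<in> ?K"
      then show "(ww has_derivative blinfun_apply (blinderiv ww q)) (at q within ?K)"
        using \<epsilon>1 by (auto intro: has_derivative_at_withinI[OF C1_has_derivative[OF wwC1]])
      show "onorm (blinfun_apply (blinderiv ww q)) \<le> C" using C[OF \<open>q \<in> ?K\<close>] by (simp add: norm_blinfun.rep_eq)
    qed (use e s' in \<open>auto intro: convex_Times\<close>)
    then show ?thesis using wper[of \<epsilon> s' k] wper[of 0 s' k] e \<epsilon>1 s'(2) by (simp add: norm_Pair ww_def)
  qed
  show ?thesis
  proof (rule that[OF \<epsilon>1(1)])
    show "C1 (UNIV \<times> {-\<epsilon>1<..<\<epsilon>1}) (\<lambda>(s, \<epsilon>). w s \<epsilon>)"
      by (rule C1_subset[OF wC1]) (use \<epsilon>1 in auto)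
    fix s \<epsilon> :: real assume "\<bar>\<epsilon>\<bar> < \<epsilon>1"
    then have e: "\<bar>\<epsilon>\<bar> \<le> d1" using \<epsilon>1 by simp
    show "(s, \<epsilon>, w s \<epsilon>) \<in> D \<and> F (s, \<epsilon>, w s \<epsilon>) = 0 \<and> norm (w s \<epsilon>) \<le> R0 \<and>
        w (s + \<tau>) \<epsilon> = w s \<epsilon> \<and> norm (w s \<epsilon> - w s 0) \<le> C * \<bar>\<epsilon>\<bar>"
      using w[OF e, of s] d1D[OF e, of "w s \<epsilon>" s] wper[OF e, of s 1] lip[OF \<open>\<bar>\<epsilon>\<bar> < \<epsilon>1\<close>] by (auto simp: R1_def)
  next
    fix R
    obtain d where d: "d > 0" and dD: "\<And>s \<epsilon> v. \<bar>\<epsilon>\<bar> \<le> d \<Longrightarrow> v \<in> cball 0 (max R R1) \<Longrightarrow> (s, \<epsilon>, v) \<in> D"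
      and dL: "\<And>s \<epsilon> v v'. \<bar>\<epsilon>\<bar> \<le> d \<Longrightarrow> v \<in> cball 0 (max R R1) \<Longrightarrow> v' \<in> cball 0 (max R R1) \<Longrightarrow> 
        norm (E s \<epsilon> v - E s \<epsilon> v') \<le> \<kappa> / 2 * norm (v - v')"
      using ball[of "max R R1"] by blast
    show "\<exists>\<epsilon>0>0. \<epsilon>0 \<le> \<epsilon>1 \<and> (\<forall>s \<epsilon> v. \<bar>\<epsilon>\<bar> < \<epsilon>0 \<longrightarrow> norm v \<le> R \<longrightarrow>
        (s, \<epsilon>, v) \<in> D \<and> (F (s, \<epsilon>, v) = 0 \<longrightarrow> v = w s \<epsilon>))"
    proof (intro exI[of _ "min d \<epsilon>1"] conjI allI impI)
      fix s \<epsilon> and v :: 'e assume e: "\<bar>\<epsilon>\<bar> < min d \<epsilon>1" and v: "norm v \<le> R"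
      then have e': "\<bar>\<epsilon>\<bar> \<le> d" "\<bar>\<epsilon>\<bar> \<le> d1" using \<epsilon>1 by auto
      show "(s, \<epsilon>, v) \<in> D" using dD[OF e'(1)] v by simp
      assume 0: "F (s, \<epsilon>, v) = 0"
      have "\<kappa> / 2 * norm (v - w s \<epsilon>) \<le> norm (F (s, \<epsilon>, v) - F (s, \<epsilon>, w s \<epsilon>))"
        using v w(1)[OF e'(2), of s] by (intro lower dL e') (auto simp: R1_def)
      then show "v = w s \<epsilon>" using 0 w(2)[OF e'(2)] \<kappa> by (simp add: mult_le_0_iff)
    qed (use d \<epsilon>1 in auto)
  qed
qed

section \<open>Flows\<close>

lemma closed_segment_scaled: "u \<in> {0..1} \<Longrightarrow> t * u \<in> closed_segment 0 (t::real)"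
  by (auto simp: in_segment mult.commute)

lemma has_vector_derivative_rescale:
  assumes "(x has_vector_derivative x') (at (c + t * u) within S)" "\<And>r. r \<in> R \<Longrightarrow> c + t * r \<in> S"
  shows "((\<lambda>r. x (c + t * r)) has_vector_derivative t *\<^sub>R x') (at u within R)"
proof -
  have "((\<lambda>r. c + t * r) has_vector_derivative t) (at u within R)"
    by (auto intro!: derivative_eq_intros simp: has_real_derivative_iff_has_vector_derivative[symmetric])
  moreover have "(x has_vector_derivative x') (at (c + t * u) within (\<lambda>r. c + t * r) ` R)"
    using assms by (auto intro: has_vector_derivative_within_subset)
  ultimately show ?thesis using vector_diff_chain_within[of "\<lambda>r. c + t * r"] by (auto simp: o_def)
qed

lemma solves_rescale:
  assumes "solves X G (closed_segment 0 t) x"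
  shows "solves (X \<times> UNIV) (\<lambda>_ q. (t *\<^sub>R G (snd q) (fst q), t)) {0..1} (\<lambda>u. (x (t * u), t * u))"
  unfolding solves_def
proof (intro ballI conjI)
  fix u :: real assume "u \<in> {0..1}"
  then have tu: "t * u \<in> closed_segment 0 t" by (rule closed_segment_scaled)
  show "(x (t * u), t * u) \<in> X \<times> UNIV" using assms tu by (auto simp: solves_def)
  have "((\<lambda>r. x (0 + t * r)) has_vector_derivative t *\<^sub>R G (t * u) (x (t * u))) (at u within {0..1})"
    by (rule has_vector_derivative_rescale[where S="closed_segment 0 t"])
      (use assms tu closed_segment_scaled in \<open>auto simp: solves_def\<close>)
  moreover have "((\<lambda>r. t * r) has_vector_derivative t) (at u within {0..1})"
    by (auto intro!: derivative_eq_intros simp: has_real_derivative_iff_has_vector_derivative[symmetric])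
  ultimately show "((\<lambda>u. (x (t * u), t * u)) has_vector_derivative
      (t *\<^sub>R G (snd (x (t * u), t * u)) (fst (x (t * u), t * u)), t)) (at u within {0..1})"
    by (auto intro: has_vector_derivative_Pair)
qed

text \<open>Time is adjoined to the state, so uniqueness reduces to the autonomous case.\<close>

lemma traj_eq:
  fixes G :: "real \<Rightarrow> 'a::euclidean_space \<Rightarrow> 'a"
  assumes X: "open X" and G: "C1 (X \<times> UNIV) (\<lambda>q. G (snd q) (fst q))"
    and x: "solves X G (closed_segment 0 t) x"
  shows "traj X G (x 0) t = x t"
  unfolding traj_def
proof (rule the_equality)
  show "\<exists>y. solves X G (closed_segment 0 t) y \<and> y 0 = x 0 \<and> y t = x t" using x by blast
  fix z assume "\<exists>y. solves X G (closed_segment 0 t) y \<and> y 0 = x 0 \<and> y t = z"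
  then obtain y where y: "solves X G (closed_segment 0 t) y" "y 0 = x 0" "y t = z" by blast
  have C: "C1 (X \<times> UNIV) (\<lambda>q. (t *\<^sub>R G (snd q) (fst q), t))" by (intro C1_intros G)
  have O: "open (X \<times> (UNIV :: real set))" using X by (intro open_Times) auto
  have "(y (t * 1), t * 1) = (x (t * 1), t * 1)"
    by (rule solves_unit_unique[OF O C solves_rescale[OF y(1)] solves_rescale[OF x]]) (use y(2) in simp_all)
  then show "z = x t" using y by simp
qed

lemma flow0_eq:
  fixes f :: "'a::euclidean_space \<Rightarrow> 'a"
  assumes X: "open X" and f: "C1 X f" and x: "solves X (\<lambda>_. f) J x" and J: "closed_segment a b \<subseteq> J"
  shows "flow0 X f (b - a) (x a) = x b"
proof -
  have J': "r \<in> closed_segment 0 (b - a) \<Longrightarrow> a + 1 * r \<in> closed_segment a b" for r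
    by (auto simp: closed_segment_eq_real_ivl split: if_splits)
  have "solves X (\<lambda>_. f) (closed_segment 0 (b - a)) (\<lambda>r. x (a + 1 * r))"
    unfolding solves_def
  proof (intro ballI conjI)
    fix r assume r: "r \<in> closed_segment 0 (b - a)"
    then have "a + 1 * r \<in> J" using J J' by blast
    then show "x (a + 1 * r) \<in> X" using x by (auto simp: solves_def)
    have "((\<lambda>r. x (a + 1 * r)) has_vector_derivative 1 *\<^sub>R f (x (a + 1 * r))) (at r within closed_segment 0 (b - a))"
      by (rule has_vector_derivative_rescale[where S=J]) 
        (use x J J' \<open>a + 1 * r \<in> J\<close> in \<open>auto simp: solves_def\<close>)
    then show "((\<lambda>r. x (a + 1 * r)) has_vector_derivative f (x (a + 1 * r))) (at r within closed_segment 0 (b - a))"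
      by simp
  qed
  moreover have "C1 (X \<times> UNIV) (\<lambda>q. f (fst q))"
    by (rule C1_compose[OF f C1_fst[OF C1_ident]]) auto
  ultimately have "traj X (\<lambda>_. f) (x (a + 1 * 0)) (b - a) = x (a + 1 * (b - a))"
    by (intro traj_eq X)
  then show ?thesis by (simp add: flow0_def)
qed

text \<open>This form avoids the fundamental matrix: to compute a derivative it suffices to exhibit a solution
  of the variational equation.\<close>

lemma unit_map_variation:
  fixes F :: "'a::euclidean_space \<Rightarrow> 'a"
  assumes S: "open S" and F: "C1 S F" and x: "solves S (\<lambda>_. F) {0..1} x"
    and u: "\<And>t. t \<in> {0..1} \<Longrightarrow> (u has_vector_derivative blinderiv F (x t) (u t)) (at t within {0..1})"
  shows "blinderiv (\<lambda>\<xi>. traj S (\<lambda>_. F) \<xi> 1) (x 0) (u 0) = u 1"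
proof -
  obtain Y where Y0: "Y 0 = id_blinfun"
    and Y: "\<And>t. t \<in> {0..1} \<Longrightarrow> (Y has_vector_derivative (blinderiv F (x t) o\<^sub>L Y t)) (at t within {0..1})"
    using variational_exists[OF F x] by blast
  have "continuous_on {0..1} (\<lambda>t. blinderiv F (x t))"
    using x by (intro continuous_on_compose2[OF C1_continuous_deriv[OF F] solves_continuous[OF x]])
      (auto simp: solves_def)
  then obtain K where K: "K > 0" "\<And>t. t \<in> {0..1} \<Longrightarrow> norm (blinderiv F (x t)) \<le> K"
    by (rule bounded_on_compact[OF _ compact_Icc]) (rule that; blast)
  have "norm (Y 1 (u 0) - u 1) \<le> exp (K + 1) * (norm (Y 0 (u 0) - u 0) + 0)"
  proof (rule gronwall[where u'="\<lambda>t. blinderiv F (x t) (Y t (u 0)) - blinderiv F (x t) (u t)"])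
    fix t :: real assume t: "t \<in> {0..1}"
    have "((\<lambda>t. Y t (u 0)) has_vector_derivative blinderiv F (x t) (Y t (u 0))) (at t within {0..1})"
      using bounded_linear.has_vector_derivative[OF blinfun.bounded_linear_left Y[OF t], of "u 0"] by simp
    then show "((\<lambda>t. Y t (u 0) - u t) has_vector_derivative 
        blinderiv F (x t) (Y t (u 0)) - blinderiv F (x t) (u t)) (at t within {0..1})"
      using u[OF t] by (rule has_vector_derivative_diff)
    have "norm (blinderiv F (x t) (Y t (u 0) - u t)) \<le> K * norm (Y t (u 0) - u t)"
      using K(2)[OF t] by (meson mult_right_mono norm_blinfun norm_ge_zero order_trans)
    then show "norm (blinderiv F (x t) (Y t (u 0)) - blinderiv F (x t) (u t)) \<le> K * norm (Y t (u 0) - u t) + 0"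
      by (simp add: blinfun.diff_right)
  qed (use K in auto)
  then have "Y 1 (u 0) = u 1" by (simp add: Y0)
  moreover have "blinderiv (\<lambda>\<xi>. traj S (\<lambda>_. F) \<xi> 1) (x 0) = Y 1"
    by (intro blinderiv_eq unit_map_derivative[OF S F x Y0 Y])
  ultimately show ?thesis by simp
qed

text \<open>The time-\<open>t\<close> map of \<open>f\<close> is the time-one map of the field \<open>t f\<close>; carrying \<open>t\<close> along as a constant
  component makes the flow differentiable jointly in the initial value and in time.\<close>

definition flow_field :: "('a \<Rightarrow> 'a) \<Rightarrow> 'a::real_normed_vector \<times> real \<Rightarrow> 'a \<times> real" where
  "flow_field f q = (snd q *\<^sub>R f (fst q), 0)"

lemma flow_field_C1: 
  assumes "C1 X f" 
  shows "C1 (X \<times> UNIV) (flow_field f)"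
proof -
  have "C1 (X \<times> UNIV) (\<lambda>q. f (fst q))"
    by (rule C1_compose[OF assms C1_fst[OF C1_ident]]) auto
  then show ?thesis unfolding flow_field_def[abs_def] by (intro C1_intros)
qed

lemma blinderiv_flow_field:
  assumes f: "C1 X f" and q: "\<xi> \<in> X"
  shows "blinderiv (flow_field f) (\<xi>, t) (v, \<kappa>) = (t *\<^sub>R blinderiv f \<xi> v + \<kappa> *\<^sub>R f \<xi>, 0)"
proof -
  have "(fst has_derivative fst) (at (\<xi>, t))" by (auto intro!: derivative_eq_intros)
  from has_derivative_compose[OF this, of f "blinderiv f \<xi>"] C1_has_derivative[OF f q]
  have "((\<lambda>q. f (fst q)) has_derivative (\<lambda>u. blinderiv f \<xi> (fst u))) (at (\<xi>, t))" by simp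
  then have "(flow_field f has_derivative (\<lambda>u. (t *\<^sub>R blinderiv f \<xi> (fst u) + snd u *\<^sub>R f \<xi>, 0))) (at (\<xi>, t))"
    unfolding flow_field_def[abs_def] by (auto intro!: derivative_eq_intros)
  moreover have "(flow_field f has_derivative blinderiv (flow_field f) (\<xi>, t)) (at (\<xi>, t))"
    by (rule C1_has_derivative[OF flow_field_C1[OF f]]) (use q in auto)
  ultimately have "blinfun_apply (blinderiv (flow_field f) (\<xi>, t)) = (\<lambda>u. (t *\<^sub>R blinderiv f \<xi> (fst u) + snd u *\<^sub>R f \<xi>, 0))"
    using has_derivative_unique by blast
  then show ?thesis by simp
qed

lemma solves_flow_field:
  assumes "solves X (\<lambda>_. f) (closed_segment 0 t) x"
  shows "solves (X \<times> UNIV) (\<lambda>_. flow_field f) {0..1} (\<lambda>u. (x (t * u), t))"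
  unfolding solves_def
proof (intro ballI conjI)
  fix u :: real assume "u \<in> {0..1}"
  then have tu: "t * u \<in> closed_segment 0 t" by (rule closed_segment_scaled)
  show "(x (t * u), t) \<in> X \<times> UNIV" using assms tu by (auto simp: solves_def)
  have "((\<lambda>r. x (0 + t * r)) has_vector_derivative t *\<^sub>R f (x (t * u))) (at u within {0..1})"
    by (rule has_vector_derivative_rescale[where S="closed_segment 0 t"])
      (use assms tu closed_segment_scaled in \<open>auto simp: solves_def\<close>)
  then show "((\<lambda>u. (x (t * u), t)) has_vector_derivative flow_field f (x (t * u), t)) (at u within {0..1})"
    unfolding flow_field_def by (auto intro: has_vector_derivative_Pair)
qed

text \<open>For \<open>t = 0\<close> the rescaling degenerates, but then the solution is constant.\<close>

lemma solves_from_flow_field: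
  fixes f :: "'a::euclidean_space \<Rightarrow> 'a"
  assumes z: "solves (X \<times> UNIV) (\<lambda>_. flow_field f) {0..1} z"
  obtains x where "solves X (\<lambda>_. f) (closed_segment 0 (snd (z 0))) x" "x 0 = fst (z 0)"
    "x (snd (z 0)) = fst (z 1)"
proof -
  define t where "t = snd (z 0)"
  have zd: "(z has_vector_derivative flow_field f (z u)) (at u within {0..1})" "fst (z u) \<in> X"
    if "u \<in> {0..1}" for u using z that unfolding solves_def by (auto simp: mem_Times_iff)
  have "((\<lambda>u. snd (z u)) has_derivative (\<lambda>h. 0)) (at u within {0..1})" if "u \<in> {0..1}" for u
    using bounded_linear.has_vector_derivative[OF bounded_linear_snd zd(1)[OF that]] 
    by (simp add: flow_field_def has_vector_derivative_def)
  then obtain c where "\<And>u. u \<in> {0..1} \<Longrightarrow> snd (z u) = c"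
    using has_derivative_zero_constant[of "{0..1::real}" "\<lambda>u. snd (z u)"] by auto
  then have t: "snd (z u) = t" if "u \<in> {0..1}" for u using that unfolding t_def by (metis atLeastAtMost_iff order_refl zero_le_one)
  have fz: "((\<lambda>u. fst (z u)) has_vector_derivative t *\<^sub>R f (fst (z u))) (at u within {0..1})" if "u \<in> {0..1}" for u
    using bounded_linear.has_vector_derivative[OF bounded_linear_fst zd(1)[OF that]] t[OF that]
    by (simp add: flow_field_def)
  show ?thesis
  proof (cases "t = 0")
    case True
    then have "((\<lambda>u. fst (z u)) has_derivative (\<lambda>h. 0)) (at u within {0..1})" if "u \<in> {0..1}" for u
      using fz[OF that] by (simp add: has_vector_derivative_def)
    then obtain c where c: "\<And>u. u \<in> {0..1} \<Longrightarrow> fst (z u) = c"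
      using has_derivative_zero_constant[of "{0..1::real}" "\<lambda>u. fst (z u)"] by auto
    have "fst (z 0) = c" "fst (z 1) = c" by (simp_all add: c)
    moreover have "solves X (\<lambda>_. f) {0} (\<lambda>_. fst (z 0))"
      using zd(2)[of 0] by (auto simp: solves_def has_vector_derivative_def has_derivative_within_singleton_iff 
          intro!: bounded_linear_intros)
    ultimately show ?thesis using that[of "\<lambda>_. fst (z 0)"] True by (simp add: t_def)
  next
    case False
    define x where "x = (\<lambda>r. fst (z (0 + (1/t) * r)))"
    have r: "0 + (1/t) * r \<in> {0..1}" if "r \<in> closed_segment 0 t" for r
      using that False by (auto simp: in_segment)
    have "solves X (\<lambda>_. f) (closed_segment 0 t) x"
      unfolding solves_def
    proof (intro ballI conjI)
      fix s assume s: "s \<in> closed_segment 0 t"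
      show "x s \<in> X" using zd(2)[OF r[OF s]] by (simp add: x_def)
      have "(x has_vector_derivative (1/t) *\<^sub>R (t *\<^sub>R f (fst (z (0 + (1/t) * s))))) (at s within closed_segment 0 t)"
        unfolding x_def by (rule has_vector_derivative_rescale[OF fz[OF r[OF s]]]) (rule r)
      then show "(x has_vector_derivative f (x s)) (at s within closed_segment 0 t)"
        using False by (simp add: x_def)
    qed
    then show ?thesis using that[of x] False by (simp add: x_def t_def)
  qed
qed

lemma flow0_unit_map:
  fixes f :: "'a::euclidean_space \<Rightarrow> 'a"
  assumes X: "open X" and f: "C1 X f" and q: "(\<xi>, t) \<in> unit_domain (X \<times> UNIV) (flow_field f)"
  shows "flow0 X f t \<xi> = fst (traj (X \<times> UNIV) (\<lambda>_. flow_field f) (\<xi>, t) 1)"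
    and "\<exists>x. solves X (\<lambda>_. f) (closed_segment 0 t) x \<and> x 0 = \<xi>"
proof -
  obtain z where z: "solves (X \<times> UNIV) (\<lambda>_. flow_field f) {0..1} z" "z 0 = (\<xi>, t)"
    using q by (auto simp: unit_domain_def)
  obtain x where x: "solves X (\<lambda>_. f) (closed_segment 0 t) x" "x 0 = \<xi>" "x t = fst (z 1)"
    using solves_from_flow_field[OF z(1)] z(2) by auto
  have "flow0 X f t \<xi> = x t" using flow0_eq[OF X f x(1), of 0 t] x(2) by simp
  moreover have "traj (X \<times> UNIV) (\<lambda>_. flow_field f) (z 0) 1 = z 1"
    by (rule traj_unit[OF _ flow_field_C1[OF f] z(1)]) (simp add: open_Times X)
  ultimately show "flow0 X f t \<xi> = fst (traj (X \<times> UNIV) (\<lambda>_. flow_field f) (\<xi>, t) 1)"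
    using x z by simp
  show "\<exists>x. solves X (\<lambda>_. f) (closed_segment 0 t) x \<and> x 0 = \<xi>" using x by blast
qed

section \<open>Linearisation along a periodic orbit\<close>

lemma C1_curve:
  assumes "\<And>t. (c has_vector_derivative c' t) (at t)" "continuous_on UNIV c'"
  shows "C1 UNIV c" and "blinderiv c t = blinfun_scaleR_left (c' t)"
proof -
  have d: "(c has_derivative blinfun_apply (blinfun_scaleR_left (c' t))) (at t)" for t
    using assms(1)[of t] by (simp add: has_vector_derivative_def)
  show "C1 UNIV c"
    by (rule C1_I[OF d]) (auto intro!: continuous_intros assms bounded_linear.continuous_on[OF bounded_linear_blinfun_scaleR_left])
  show "blinderiv c t = blinfun_scaleR_left (c' t)" by (rule blinderiv_eq[OF d])
qed

locale periodic_orbit =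
  fixes X :: "'a::euclidean_space set" and f :: "'a \<Rightarrow> 'a" and z :: "real \<Rightarrow> 'a" and \<tau> :: real
  assumes X: "open X" and f: "C1 X f" and zsol: "solves X (\<lambda>_. f) UNIV z"
    and \<tau>: "\<tau> > 0" and zper: "\<And>t. z (t + \<tau>) = z t"
begin

lemma zX: "z t \<in> X"
  using zsol by (simp add: solves_def)

lemma z_deriv: "(z has_vector_derivative f (z t)) (at t)"
  using zsol by (simp add: solves_def)

lemma z_cont: "continuous_on S z"
  using solves_continuous[OF zsol] continuous_on_subset by blast

lemma fz_cont: "continuous_on S (\<lambda>t. f (z t))"
  by (rule continuous_on_compose2[OF C1_continuous_on[OF f] z_cont]) (auto simp: zX)

lemma z_C1: "C1 S z" and blinderiv_z: "blinderiv z t = blinfun_scaleR_left (f (z t))"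
  using C1_subset C1_curve[OF z_deriv fz_cont] by blast+

lemma fz_C1: "C1 S (\<lambda>t. f (z t))"
  by (rule C1_compose[OF f z_C1]) (auto simp: zX)

lemma fz_deriv: "((\<lambda>t. f (z t)) has_vector_derivative blinderiv f (z t) (f (z t))) (at t)"
  using has_derivative_compose[OF z_deriv[unfolded has_vector_derivative_def] C1_has_derivative[OF f zX]]
  by (simp add: has_vector_derivative_def blinfun.scaleR_right)

lemma Dfz_cont: "continuous_on S (\<lambda>t. blinderiv f (z t))"
  by (rule continuous_on_compose2[OF C1_continuous_deriv[OF f] z_cont]) (auto simp: zX)

lemma flow_z: "flow0 X f t (z s) = z (s + t)"
  using flow0_eq[OF X f zsol, of s "s + t"] by simp

definition P :: "real \<Rightarrow> real \<Rightarrow> 'a \<Rightarrow>\<^sub>L 'a" where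
  "P s t = blinderiv (flow0 X f t) (z s)"

definition variation :: "real \<Rightarrow> real \<Rightarrow> (real \<Rightarrow> 'a) \<Rightarrow> bool" where
  "variation s t u \<longleftrightarrow> (\<forall>r\<in>{0..1}. 
     (u has_vector_derivative t *\<^sub>R blinderiv f (z (s + t * r)) (u r)) (at r within {0..1}))"

lemma z_solves_shift: "solves X (\<lambda>_. f) J (\<lambda>t. z (s + t))"
  unfolding solves_def
proof (intro ballI conjI zX)
  fix t
  have "((\<lambda>r. z (s + 1 * r)) has_vector_derivative 1 *\<^sub>R f (z (s + t))) (at t within J)"
    by (rule has_vector_derivative_rescale[where S=UNIV]) (use z_deriv in auto)
  then show "((\<lambda>t. z (s + t)) has_vector_derivative f (z (s + t))) (at t within J)" by simp
qed

lemma in_unit_domain: "(z s, t) \<in> unit_domain (X \<times> UNIV) (flow_field f)"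
  using solves_flow_field[OF z_solves_shift[of "closed_segment 0 t" s]]
  unfolding unit_domain_def by force

text \<open>In the direction of time, the variation of the system with \<open>t\<close> adjoined is \<open>r \<mapsto> (r f(z(s + t r)), 1)\<close>.\<close>

lemma flow_joint_derivative: 
  "((\<lambda>q. flow0 X f (snd q) (fst q)) has_derivative (\<lambda>q. P s t (fst q) + snd q *\<^sub>R f (z (s + t)))) (at (z s, t))"
  and P_variation: "variation s t u \<Longrightarrow> P s t (u 0) = u 1"
proof -
  let ?U = "unit_domain (X \<times> UNIV) (flow_field f)"
  let ?T = "\<lambda>q. traj (X \<times> UNIV) (\<lambda>_. flow_field f) q 1"
  let ?\<Phi> = "\<lambda>q. flow0 X f (snd q) (fst q)"
  have O: "open (X \<times> (UNIV :: real set))" using X by (intro open_Times) auto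
  note F = flow_field_C1[OF f]
  have U: "open ?U" and T: "C1 ?U ?T" using unit_map_C1[OF O F] by auto
  define D where "D = blinderiv ?T (z s, t)"
  have dT: "((\<lambda>q. fst (?T q)) has_derivative (\<lambda>q. fst (D q))) (at (z s, t))"
    using C1_has_derivative[OF T in_unit_domain] unfolding D_def by (auto intro!: derivative_eq_intros)
  have d\<Phi>: "(?\<Phi> has_derivative (\<lambda>q. fst (D q))) (at (z s, t))"
    by (rule has_derivative_transform_within_open[OF dT U in_unit_domain])
      (use flow0_unit_map(1)[OF X f] in auto)
  have "((\<lambda>\<xi>. (\<xi>, t)) has_derivative (\<lambda>v. (v, 0))) (at (z s))" by (auto intro!: derivative_eq_intros)
  from has_derivative_compose[OF this, of ?\<Phi>] d\<Phi>
  have dP: "(flow0 X f t has_derivative (\<lambda>v. fst (D (v, 0)))) (at (z s))" by simp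
  then have P: "P s t v = fst (D (v, 0))" for v
    unfolding P_def using blinderiv_works has_derivative_unique differentiable_def by metis
  note z_sol = solves_flow_field[OF z_solves_shift[of "closed_segment 0 t" s]]
  have var: "D (w 0) = w 1" if "\<And>r. r \<in> {0..1} \<Longrightarrow> (w has_vector_derivative
        (t *\<^sub>R blinderiv f (z (s + t * r)) (fst (w r)) + snd (w r) *\<^sub>R f (z (s + t * r)), 0)) (at r within {0..1})" for w
  proof -
    have "blinderiv ?T ((\<lambda>u. (z (s + t * u), t)) 0) (w 0) = w 1"
    proof (rule unit_map_variation[OF O F z_sol])
      fix r :: real assume "r \<in> {0..1}"
      from that[OF this] blinderiv_flow_field[OF f zX, of "s + t * r" t "fst (w r)" "snd (w r)"]
      show "(w has_vector_derivative blinderiv (flow_field f) (z (s + t * r), t) (w r)) (at r within {0..1})"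
        by simp
    qed
    then show ?thesis by (simp add: D_def)
  qed
  show "P s t (u 0) = u 1" if "variation s t u" for u
  proof -
    have "D ((\<lambda>r. (u r, 0)) 0) = (\<lambda>r. (u r, 0)) 1"
      by (rule var) (use that in \<open>auto simp: variation_def intro!: has_vector_derivative_Pair\<close>)
    then show ?thesis by (simp add: P)
  qed
  have "D ((\<lambda>r. (r *\<^sub>R f (z (s + t * r)), 1)) 0) = (\<lambda>r. (r *\<^sub>R f (z (s + t * r)), 1)) 1"
  proof (rule var)
    fix r :: real
    have "((\<lambda>r. f (z (s + t * r))) has_vector_derivative t *\<^sub>R blinderiv f (z (s + t * r)) (f (z (s + t * r)))) (at r within {0..1})"
      by (rule has_vector_derivative_rescale[where S=UNIV]) (use fz_deriv in auto)
    then have "((\<lambda>r. r *\<^sub>R f (z (s + t * r))) has_vector_derivative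
        r *\<^sub>R (t *\<^sub>R blinderiv f (z (s + t * r)) (f (z (s + t * r)))) + 1 *\<^sub>R f (z (s + t * r))) (at r within {0..1})"
      by (intro has_vector_derivative_scaleR) (auto intro!: derivative_eq_intros)
    then show "((\<lambda>r. (r *\<^sub>R f (z (s + t * r)), 1)) has_vector_derivative
        (t *\<^sub>R blinderiv f (z (s + t * r)) (fst (r *\<^sub>R f (z (s + t * r)), 1::real)) +
         snd (r *\<^sub>R f (z (s + t * r)), 1::real) *\<^sub>R f (z (s + t * r)), 0)) (at r within {0..1})"
      by (intro has_vector_derivative_Pair) (auto simp: blinfun.scaleR_right mult.commute)
  qed
  then have D1: "D (0, 1) = (f (z (s + t)), 1)" by simp
  have Dq: "D q = D (fst q, 0) + snd q *\<^sub>R D (0, 1)" for q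
  proof -
    have "q = (fst q, 0) + snd q *\<^sub>R (0, 1)" by (simp add: prod_eq_iff)
    then show ?thesis by (metis blinfun.add_right blinfun.scaleR_right)
  qed
  have "fst (D q) = P s t (fst q) + snd q *\<^sub>R f (z (s + t))" for q
    using arg_cong[OF Dq[of q], of fst] by (simp add: P D1)
  then show "(?\<Phi> has_derivative (\<lambda>q. P s t (fst q) + snd q *\<^sub>R f (z (s + t)))) (at (z s, t))"
    using d\<Phi> by simp
qed

lemma flow_derivative: "(flow0 X f t has_derivative P s t) (at (z s))"
proof -
  have "((\<lambda>\<xi>. (\<xi>, t)) has_derivative (\<lambda>v. (v, 0))) (at (z s))" by (auto intro!: derivative_eq_intros)
  from has_derivative_compose[OF this, of "\<lambda>q. flow0 X f (snd q) (fst q)"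
      "\<lambda>q. P s t (fst q) + snd q *\<^sub>R f (z (s + t))"] flow_joint_derivative[of s t]
  show ?thesis by simp
qed

lemma variation_exists: "\<exists>u. u 0 = v \<and> variation s t u"
proof -
  have "continuous_on {0..1} (\<lambda>r. t *\<^sub>R blinderiv f (z (s + t * r)))"
    by (intro continuous_intros continuous_on_compose2[OF Dfz_cont[of UNIV]]) auto
  from fundamental_solution_exists[OF this] obtain Y where Y: "Y 0 = id_blinfun"
    "\<And>r. r \<in> {0..1} \<Longrightarrow> (Y has_vector_derivative (t *\<^sub>R blinderiv f (z (s + t * r)) o\<^sub>L Y r)) (at r within {0..1})"
    by blast
  have "variation s t (\<lambda>r. Y r v)" unfolding variation_def
  proof
    fix r :: real assume r: "r \<in> {0..1}"
    show "((\<lambda>r. Y r v) has_vector_derivative t *\<^sub>R blinderiv f (z (s + t * r)) (Y r v)) (at r within {0..1})"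
      using bounded_linear.has_vector_derivative[OF blinfun.bounded_linear_left Y(2)[OF r], of v]
      by (simp add: scaleR_blinfun.rep_eq)
  qed
  then show ?thesis using Y(1) by (intro exI[of _ "\<lambda>r. Y r v"]) simp
qed

lemma nearby_solution:
  "\<exists>N. open N \<and> z s \<in> N \<and> (\<forall>\<xi>\<in>N. \<exists>x. solves X (\<lambda>_. f) (closed_segment 0 T) x \<and> x 0 = \<xi>)"
proof -
  let ?U = "unit_domain (X \<times> UNIV) (flow_field f)"
  have O: "open (X \<times> (UNIV :: real set))" using X by (intro open_Times) auto
  have U: "open ?U" using unit_map_C1[OF O flow_field_C1[OF f]] by auto
  have "open ((\<lambda>\<xi>. (\<xi>, T)) -` ?U)" by (rule open_vimage[OF U]) (intro continuous_intros)
  then show ?thesis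
    using in_unit_domain[of s T] flow0_unit_map(2)[OF X f, of _ T] 
    by (intro exI[of _ "(\<lambda>\<xi>. (\<xi>, T)) -` ?U"]) auto
qed

text \<open>The case \<open>t2 = - t1\<close> is included, and gives invertibility of the linearised flow.\<close>

lemma P_comp:
  assumes "0 \<le> t1" "0 \<le> t1 + t2"
  shows "P (s + t1) t2 o\<^sub>L P s t1 = P s (t1 + t2)"
proof (rule blinfun_eqI)
  define T where "T = max t1 (t1 + t2)"
  obtain N where N': "open N \<and> z s \<in> N \<and> (\<forall>\<xi>\<in>N. \<exists>x. solves X (\<lambda>_. f) (closed_segment 0 T) x \<and> x 0 = \<xi>)"
    using nearby_solution[of s T] ..
  then have N: "open N" "z s \<in> N" 
    "\<And>\<xi>. \<xi> \<in> N \<Longrightarrow> \<exists>x. solves X (\<lambda>_. f) (closed_segment 0 T) x \<and> x 0 = \<xi>"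
    by auto
  have eq: "flow0 X f t2 (flow0 X f t1 \<xi>) = flow0 X f (t1 + t2) \<xi>" if \<xi>: "\<xi> \<in> N" for \<xi>
  proof -
    obtain x where x: "solves X (\<lambda>_. f) (closed_segment 0 T) x" "x 0 = \<xi>" using N(3)[OF \<xi>] by blast
    have J: "closed_segment a b \<subseteq> closed_segment 0 T" if "a \<in> {0, t1, t1 + t2}" "b \<in> {0, t1, t1 + t2}" for a b
      using that assms by (auto simp: T_def closed_segment_eq_real_ivl)
    have "flow0 X f (t1 - 0) (x 0) = x t1" "flow0 X f (t1 + t2 - 0) (x 0) = x (t1 + t2)"
      "flow0 X f (t1 + t2 - t1) (x t1) = x (t1 + t2)"
      using flow0_eq[OF X f x(1) J, of 0 t1] flow0_eq[OF X f x(1) J, of 0 "t1 + t2"] 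
        flow0_eq[OF X f x(1) J, of t1 "t1 + t2"] by simp_all
    then show ?thesis using x(2) by simp
  qed
  have "((\<lambda>\<xi>. flow0 X f t2 (flow0 X f t1 \<xi>)) has_derivative (\<lambda>v. P (s + t1) t2 (P s t1 v))) (at (z s))"
    using has_derivative_compose[OF flow_derivative[of t1 s], of "flow0 X f t2"] flow_derivative[of t2 "s + t1"]
    by (simp add: flow_z)
  then have "(flow0 X f (t1 + t2) has_derivative (\<lambda>v. P (s + t1) t2 (P s t1 v))) (at (z s))"
    by (rule has_derivative_transform_within_open[OF _ N(1,2)]) (rule eq)
  then show "(P (s + t1) t2 o\<^sub>L P s t1) v = P s (t1 + t2) v" for v
    using has_derivative_unique[OF _ flow_derivative[of "t1 + t2" s]] by (simp add: fun_eq_iff)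
qed

lemma P_zero: "P s 0 v = v"
proof -
  have "variation s 0 (\<lambda>_. v)" by (simp add: variation_def)
  from P_variation[OF this] show ?thesis by simp
qed

lemma P_bij: 
  assumes "t \<ge> 0"
  shows "P (s + t) (- t) (P s t v) = v" and "\<exists>u. P s t u = v"
proof -
  have l: "P (s + t) (- t) (P s t v) = v" for v
    using P_comp[of t "- t" s] assms P_zero by (metis add.right_inverse blinfun_apply_blinfun_compose order_refl)
  then show "P (s + t) (- t) (P s t v) = v" by blast
  have "inj (P s t)" using l by (metis injI)
  then have "surj (P s t)" 
    using linear_injective_imp_surjective blinfun.bounded_linear_right bounded_linear.linear by blast
  then show "\<exists>u. P s t u = v" by (metis surjE)
qed

lemma P_field: "P s t (f (z s)) = f (z (s + t))"
proof -
  have "variation s t (\<lambda>r. f (z (s + t * r)))" unfolding variation_def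
    by (intro ballI has_vector_derivative_rescale[where S=UNIV]) (use fz_deriv in auto)
  from P_variation[OF this] show ?thesis by simp
qed

lemma z_per: "z (t + real k * \<tau>) = z t"
proof (induction k)
  case (Suc k)
  have "z (t + real (Suc k) * \<tau>) = z ((t + real k * \<tau>) + \<tau>)" by (simp add: algebra_simps)
  then show ?case using zper Suc by simp
qed simp

lemma P_per: "P (s + real k * \<tau>) t = P s t"
  by (simp add: P_def z_per)

lemma P_power: "blinfun_apply (P s (real k * \<tau>)) = blinfun_apply (P s \<tau>) ^^ k"
proof (induction k)
  case 0 then show ?case using P_zero by auto
next
  case (Suc k)
  have "P (s + real k * \<tau>) \<tau> o\<^sub>L P s (real k * \<tau>) = P s (real k * \<tau> + \<tau>)"
    using \<tau> by (intro P_comp) auto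
  then have "P s (real (Suc k) * \<tau>) = P s \<tau> o\<^sub>L P s (real k * \<tau>)"
    by (simp add: P_per distrib_right add.commute)
  then show ?case using Suc by (simp add: blinfun_compose.rep_eq)
qed

text \<open>The matrix equation is solved columnwise: applied to a fixed vector, any of its solutions is a
  variation.\<close>

lemma monodromy_eq: "monodromy X f (z s) \<tau> = P s \<tau>"
proof -
  let ?G = "\<lambda>t Y. Dfield f (flow0 X f t (z s)) o\<^sub>L Y"
  have seg: "closed_segment 0 \<tau> = {0..\<tau>}" using \<tau> by (simp add: closed_segment_eq_real_ivl)
  have G: "?G t Y = blinderiv f (z (s + t)) o\<^sub>L Y" for t and Y :: "'a \<Rightarrow>\<^sub>L 'a"
    by (simp add: Dfield_def blinderiv_def flow_z)
  have uniq: "Y \<tau> = P s \<tau>" if Y: "solves UNIV ?G {0..\<tau>} Y" "Y 0 = id_blinfun" for Y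
  proof (rule blinfun_eqI)
    fix v
    have "variation s \<tau> (\<lambda>r. Y (0 + \<tau> * r) v)" unfolding variation_def
    proof
      fix r :: real assume r: "r \<in> {0..1}"
      then have tr: "0 + \<tau> * r \<in> {0..\<tau>}" if "r \<in> {0..1}" for r
        using \<tau> that mult_left_mono[of r 1 \<tau>] by auto
      have "(Y has_vector_derivative ?G (0 + \<tau> * r) (Y (0 + \<tau> * r))) (at (0 + \<tau> * r) within {0..\<tau>})"
        using Y(1) tr[OF r] by (simp add: solves_def)
      from has_vector_derivative_rescale[OF this tr]
      have "((\<lambda>r. Y (0 + \<tau> * r)) has_vector_derivative \<tau> *\<^sub>R ?G (0 + \<tau> * r) (Y (0 + \<tau> * r))) (at r within {0..1})" .
      from bounded_linear.has_vector_derivative[OF blinfun.bounded_linear_left this, of v]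
      show "((\<lambda>r. Y (0 + \<tau> * r) v) has_vector_derivative \<tau> *\<^sub>R blinderiv f (z (s + \<tau> * r)) (Y (0 + \<tau> * r) v)) (at r within {0..1})"
        unfolding G by (simp add: scaleR_blinfun.rep_eq)
    qed
    from P_variation[OF this] Y(2) show "Y \<tau> v = P s \<tau> v" by simp
  qed
  have "continuous_on {0..1} (\<lambda>r. \<tau> *\<^sub>R blinderiv f (z (s + \<tau> * r)))"
    by (intro continuous_intros continuous_on_compose2[OF Dfz_cont[of UNIV]]) auto
  from fundamental_solution_exists[OF this] obtain Y where Y: "Y 0 = id_blinfun"
    "\<And>r. r \<in> {0..1} \<Longrightarrow> (Y has_vector_derivative (\<tau> *\<^sub>R blinderiv f (z (s + \<tau> * r)) o\<^sub>L Y r)) (at r within {0..1})"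
    by blast
  have ex: "solves UNIV ?G {0..\<tau>} (\<lambda>t. Y (0 + (1/\<tau>) * t))"
    unfolding solves_def G
  proof (intro ballI conjI UNIV_I)
    fix t assume t: "t \<in> {0..\<tau>}"
    have tr: "0 + (1/\<tau>) * t \<in> {0..1}" if "t \<in> {0..\<tau>}" for t using that \<tau> by auto
    from has_vector_derivative_rescale[OF Y(2)[OF tr[OF t]], of "{0..\<tau>}", OF tr]
    show "((\<lambda>t. Y (0 + (1/\<tau>) * t)) has_vector_derivative (blinderiv f (z (s + t)) o\<^sub>L Y (0 + (1/\<tau>) * t))) (at t within {0..\<tau>})"
      using \<tau> by (simp add: bounded_bilinear.scaleR_left[OF bounded_bilinear_blinfun_compose])
  qed
  show ?thesis unfolding monodromy_def traj_def seg
  proof (rule the_equality)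
    show "\<exists>x. solves UNIV ?G {0..\<tau>} x \<and> x 0 = id_blinfun \<and> x \<tau> = P s \<tau>"
      using ex uniq[OF ex] Y(1) by (intro exI[of _ "\<lambda>t. Y (0 + (1/\<tau>) * t)"]) simp
  qed (use uniq in blast)
qed

text \<open>Differentiating \<open>H (\<phi>\<^sub>t(x)) = H x\<close> shows that \<open>grad H\<close> is transported by the adjoint of the linearised
  flow. So along the orbit it solves the adjoint variational equation, and is continuously
  differentiable in the phase although \<open>H\<close> itself is only assumed to be differentiable.\<close>

context
  fixes H :: "'a \<Rightarrow> real"
  assumes H: "\<And>x. x \<in> X \<Longrightarrow> GDERIV H x :> grad H x" and Hf: "\<And>x. x \<in> X \<Longrightarrow> grad H x \<bullet> f x = 0"
begin

lemma H_const:
  assumes x: "solves X (\<lambda>_. f) (closed_segment 0 t) x"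
  shows "H (x t) = H (x 0)"
proof -
  have "((\<lambda>r. H (x r)) has_derivative (\<lambda>h. 0)) (at r within closed_segment 0 t)" if "r \<in> closed_segment 0 t" for r
  proof -
    have "x r \<in> X" and d: "(x has_derivative (\<lambda>h. h *\<^sub>R f (x r))) (at r within closed_segment 0 t)"
      using x that by (auto simp: solves_def has_vector_derivative_def)
    then have "(H has_derivative (\<lambda>h. grad H (x r) \<bullet> h)) (at (x r))"
      using H by (simp add: gderiv_def inner_commute)
    from has_derivative_compose[OF d this] show ?thesis using Hf[OF \<open>x r \<in> X\<close>] by simp
  qed
  then obtain c where "\<And>r. r \<in> closed_segment 0 t \<Longrightarrow> H (x r) = c"
    using has_derivative_zero_constant[of "closed_segment 0 t" "\<lambda>r. H (x r)"] by auto
  then show ?thesis by simp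
qed

lemma gradH_P: "grad H (z (s + t)) \<bullet> P s t v = grad H (z s) \<bullet> v"
proof -
  obtain N where "open N \<and> z s \<in> N \<and> (\<forall>\<xi>\<in>N. \<exists>x. solves X (\<lambda>_. f) (closed_segment 0 t) x \<and> x 0 = \<xi>)"
    using nearby_solution[of s t] ..
  then have N: "open N" "z s \<in> N" 
    "\<And>\<xi>. \<xi> \<in> N \<Longrightarrow> \<exists>x. solves X (\<lambda>_. f) (closed_segment 0 t) x \<and> x 0 = \<xi>" by auto
  have HD: "(H has_derivative (\<lambda>h. grad H x \<bullet> h)) (at x)" if "x \<in> X" for x
    using H[OF that] by (simp add: gderiv_def inner_commute)
  have "((\<lambda>\<xi>. H (flow0 X f t \<xi>)) has_derivative (\<lambda>v. grad H (z (s + t)) \<bullet> P s t v)) (at (z s))"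
    using has_derivative_compose[OF flow_derivative[of t s], of H] HD[OF zX] by (simp add: flow_z)
  then have "(H has_derivative (\<lambda>v. grad H (z (s + t)) \<bullet> P s t v)) (at (z s))"
  proof (rule has_derivative_transform_within_open[OF _ N(1,2)])
    fix \<xi> assume "\<xi> \<in> N"
    then obtain x where x: "solves X (\<lambda>_. f) (closed_segment 0 t) x" "x 0 = \<xi>" using N(3) by blast
    show "H (flow0 X f t \<xi>) = H \<xi>" using flow0_eq[OF X f x(1), of 0 t] H_const[OF x(1)] x(2) by simp
  qed
  from has_derivative_unique[OF this HD[OF zX]] show ?thesis by (rule fun_cong)
qed

lemma gradH_deriv:
  "((\<lambda>s. grad H (z s)) has_vector_derivative - (\<Sum>b\<in>Basis. (grad H (z s) \<bullet> blinderiv f (z s) b) *\<^sub>R b)) (at s)"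
proof -
  \<comment> \<open>solve the adjoint equation on \<open>[s - 1, s + 1]\<close>, rescaled to the unit interval, and identify its
    solution with \<open>grad H\<close> by pairing both with all variations\<close>
  define s0 where "s0 = s - 1"
  define A where "A = (\<lambda>r. blinderiv f (z (s0 + 2 * r)))"
  have cA: "continuous_on {0..1} A" unfolding A_def
    by (intro continuous_on_compose2[OF Dfz_cont[of UNIV]] continuous_intros) auto
  then obtain K where K: "\<And>t. t \<in> {0..1} \<Longrightarrow> norm (A t) \<le> K"
    by (rule bounded_on_compact[OF _ compact_Icc]) (rule that; blast)
  define \<Phi> where "\<Phi> = (\<lambda>r w. (-2) *\<^sub>R (\<Sum>b\<in>Basis. (w \<bullet> A r b) *\<^sub>R b))"
  have "\<exists>\<alpha>. \<alpha> 0 = grad H (z s0) \<and> (\<forall>r\<in>{0..1}. (\<alpha> has_vector_derivative \<Phi> r (\<alpha> r)) (at r within {0..1}))"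
  proof (rule lipschitz_ode_exists)
    show "continuous_on ({0..1} \<times> UNIV) (\<lambda>(t, x). \<Phi> t x)"
      unfolding case_prod_beta \<Phi>_def
      by (intro continuous_intros continuous_on_compose2[OF cA]) auto
    fix t :: real and x y :: 'a assume t: "t \<in> {0..1}"
    have "\<Phi> t x - \<Phi> t y = (-2) *\<^sub>R (\<Sum>b\<in>Basis. ((x - y) \<bullet> A t b) *\<^sub>R b)"
      unfolding \<Phi>_def inner_diff_left scaleR_diff_left sum_subtractf scaleR_diff_right ..
    then have "norm (\<Phi> t x - \<Phi> t y) \<le> 2 * (\<Sum>b\<in>Basis. norm (((x - y) \<bullet> A t b) *\<^sub>R b))"
      using norm_sum[of "\<lambda>b. ((x - y) \<bullet> A t b) *\<^sub>R b" Basis] by simp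
    also have "\<dots> \<le> 2 * (\<Sum>b\<in>(Basis::'a set). norm (x - y) * K)"
    proof (intro mult_left_mono sum_mono)
      fix b :: 'a assume "b \<in> Basis"
      then have "norm (A t b) \<le> K" using norm_blinfun[of "A t" b] K[OF t] by simp
      then show "norm (((x - y) \<bullet> A t b) *\<^sub>R b) \<le> norm (x - y) * K"
        using Cauchy_Schwarz_ineq2[of "x - y" "A t b"] \<open>b \<in> Basis\<close> 
          mult_left_mono[of "norm (A t b)" K "norm (x - y)"] by simp
    qed simp
    also have "\<dots> = (2 * real DIM('a) * K) * norm (x - y)" by simp
    finally show "norm (\<Phi> t x - \<Phi> t y) \<le> (2 * real DIM('a) * K) * norm (x - y)" .
  qed
  then obtain \<alpha> where \<alpha>0: "\<alpha> 0 = grad H (z s0)"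
    and \<alpha>: "\<And>r. r \<in> {0..1} \<Longrightarrow> (\<alpha> has_vector_derivative \<Phi> r (\<alpha> r)) (at r within {0..1})" by blast
  have eq: "\<alpha> r = grad H (z (s0 + 2 * r))" if r: "r \<in> {0..1}" for r
  proof -
    have "\<alpha> r \<bullet> w = grad H (z (s0 + 2 * r)) \<bullet> w" for w
    proof -
      obtain v where v: "P s0 (2 * r) v = w" using P_bij(2)[of "2 * r"] r by auto
      obtain u where u: "u 0 = v" "variation s0 (2 * r) u" using variation_exists by blast
      have ut: "(u has_vector_derivative (2 * r) *\<^sub>R A (r * q) (u q)) (at q within {0..1})" if "q \<in> {0..1}" for q
        using u(2) that by (simp add: variation_def A_def mult.assoc)
      have rq: "0 + r * q \<in> {0..1}" if "q \<in> {0..1}" for q 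
        using r that by (auto intro: mult_nonneg_nonneg mult_le_one)
      have "((\<lambda>q. \<alpha> (0 + r * q) \<bullet> u q) has_derivative (\<lambda>h. 0)) (at q within {0..1})" if q: "q \<in> {0..1}" for q
      proof -
        have "((\<lambda>q. \<alpha> (0 + r * q)) has_vector_derivative r *\<^sub>R \<Phi> (0 + r * q) (\<alpha> (0 + r * q))) (at q within {0..1})"
          by (rule has_vector_derivative_rescale[OF \<alpha>[OF rq[OF q]] rq])
        from has_derivative_inner[OF this[unfolded has_vector_derivative_def] ut[OF q, unfolded has_vector_derivative_def]]
        have "((\<lambda>q. \<alpha> (0 + r * q) \<bullet> u q) has_derivative (\<lambda>h. \<alpha> (0 + r * q) \<bullet> h *\<^sub>R (2 * r) *\<^sub>R A (r * q) (u q)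
           + h *\<^sub>R r *\<^sub>R \<Phi> (0 + r * q) (\<alpha> (0 + r * q)) \<bullet> u q)) (at q within {0..1})" .
        moreover have "\<Phi> (r * q) (\<alpha> (r * q)) \<bullet> u q = - 2 * (\<alpha> (r * q) \<bullet> A (r * q) (u q))"
        proof -
          have "A (r * q) (u q) = A (r * q) (\<Sum>b\<in>Basis. (u q \<bullet> b) *\<^sub>R b)" by (simp add: euclidean_representation)
          also have "\<dots> = (\<Sum>b\<in>Basis. (u q \<bullet> b) *\<^sub>R A (r * q) b)"
            by (simp add: blinfun.sum_right blinfun.scaleR_right)
          finally show ?thesis unfolding \<Phi>_def 
            by (simp add: inner_sum_right inner_sum_left inner_commute mult.commute)
        qed
        ultimately show ?thesis by simp
      qed
      then obtain c where c: "\<And>q. q \<in> {0..1} \<Longrightarrow> \<alpha> (0 + r * q) \<bullet> u q = c"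
        using has_derivative_zero_constant[of "{0..1::real}" "\<lambda>q. \<alpha> (0 + r * q) \<bullet> u q"] by auto
      have "\<alpha> r \<bullet> u 1 = \<alpha> 0 \<bullet> u 0" using c[of 0] c[of 1] by simp
      moreover have "u 1 = w" using P_variation[OF u(2)] u(1) v by simp
      moreover have "grad H (z (s0 + 2 * r)) \<bullet> w = grad H (z s0) \<bullet> v" using gradH_P[of s0 "2 * r" v] v by simp
      ultimately show ?thesis using \<alpha>0 u(1) by simp
    qed
    then show ?thesis by (metis inner_commute vector_eq_rdot)
  qed
  have hs: "(-s0/2) + (1/2) * s' \<in> {0..1}" if "s' \<in> {s0..s0+2}" for s' using that by auto
  have "s \<in> {s0..s0+2}" by (simp add: s0_def)
  from has_vector_derivative_rescale[OF \<alpha>[OF hs[OF this]], of "{s0..s0+2}", OF hs]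
  have "((\<lambda>s'. \<alpha> ((-s0/2) + (1/2) * s')) has_vector_derivative (1/2) *\<^sub>R \<Phi> ((-s0/2) + (1/2) * s) (\<alpha> ((-s0/2) + (1/2) * s))) 
    (at s within {s0..s0+2})" .
  then have "((\<lambda>s'. grad H (z s')) has_vector_derivative (1/2) *\<^sub>R \<Phi> ((-s0/2) + (1/2) * s) (\<alpha> ((-s0/2) + (1/2) * s))) 
    (at s within {s0..s0+2})"
  proof (rule has_vector_derivative_transform[rotated 2])
    fix s' assume "s' \<in> {s0..s0+2}"
    then show "grad H (z s') = \<alpha> (- s0 / 2 + 1 / 2 * s')" using eq[OF hs] by (simp add: field_simps)
  qed (simp add: s0_def)
  moreover have "(1/2) *\<^sub>R \<Phi> ((-s0/2) + (1/2) * s) (\<alpha> ((-s0/2) + (1/2) * s)) = 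
     - (\<Sum>b\<in>Basis. (grad H (z s) \<bullet> blinderiv f (z s) b) *\<^sub>R b)"
    using eq[OF hs, of s] \<open>s \<in> {s0..s0+2}\<close> by (simp add: \<Phi>_def A_def field_simps)
  ultimately have "((\<lambda>s. grad H (z s)) has_vector_derivative - (\<Sum>b\<in>Basis. (grad H (z s) \<bullet> blinderiv f (z s) b) *\<^sub>R b))
     (at s within {s0..s0+2})" by simp
  moreover have "at s within {s0..s0+2} = at s" by (rule at_within_Icc_at) (simp_all add: s0_def)
  ultimately show ?thesis by simp
qed

lemma gradH_C1: "C1 UNIV (\<lambda>s. grad H (z s))"
proof (rule C1_curve(1)[OF gradH_deriv])
  have "continuous_on UNIV (\<lambda>s. grad H (z s))"
    using gradH_deriv by (meson continuous_at_imp_continuous_on has_vector_derivative_continuous)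
  then show "continuous_on UNIV (\<lambda>s. - (\<Sum>b\<in>Basis. (grad H (z s) \<bullet> blinderiv f (z s) b) *\<^sub>R b))"
    by (intro continuous_intros Dfz_cont)
qed

end

end

section \<open>Nondegeneracy and tubular coordinates\<close>

context periodic_orbit
begin

lemma z_per_int: "z (t + of_int k * \<tau>) = z t"
proof (cases "k \<ge> 0")
  case True
  then show ?thesis using z_per[of t "nat k"] by simp
next
  case False
  then show ?thesis using z_per[of "t + of_int k * \<tau>" "nat (- k)"] by simp
qed

text \<open>The space of pairs \<open>(\<delta>, \<sigma>)\<close> with \<open>(\<Pi>\<^sup>m - I) \<delta> + \<sigma> f = 0\<close> has dimension at most two by \<open>m\<close>-normality,
  hence is spanned by \<open>(f, 0)\<close> and the tangent \<open>(\<theta>', m T')\<close> of the family. The derivative of \<open>L\<close> vanishes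
  on the former and is \<open>1\<close> on the latter.\<close>

lemma nondegenerate:
  assumes mn: "m_normal X f m (z s0) \<tau>"
    and d\<theta>: "(\<theta> has_vector_derivative \<theta>') (at c0)" and \<theta>0: "\<theta> c0 = z s0"
    and dT: "(T has_real_derivative T') (at c0)" and T0: "T c0 = \<tau>"
    and closed: "\<forall>\<^sub>F c in nhds c0. flow0 X f (real m * T c) (\<theta> c) = \<theta> c"
    and DL: "\<And>s. (\<Lambda> has_derivative blinfun_apply (DL s)) (at (z s, real m * \<tau>))"
    and LT: "\<And>t. \<forall>\<^sub>F c in nhds c0. \<Lambda> (flow0 X f t (\<theta> c), real m * T c) = c"
    and Lc: "\<And>s. \<Lambda> (z s, real m * \<tau>) = c0"
    and fnz: "\<And>s. f (z s) \<noteq> 0"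
    and K: "P s (real m * \<tau>) \<delta> - \<delta> + \<sigma> *\<^sub>R f (z s) = 0" and L0: "DL s (\<delta>, \<sigma>) = 0" and orth: "\<delta> \<bullet> f (z s) = 0"
  shows "\<delta> = 0 \<and> \<sigma> = 0"
proof -
  define \<omega> where "\<omega> = real m * \<tau>"
  define F where "F = f (z s0)"
  have \<theta>d: "(\<theta> has_derivative (\<lambda>h. h *\<^sub>R \<theta>')) (at c0)" using d\<theta> by (simp add: has_vector_derivative_def)
  have Td: "((\<lambda>c. real m * T c) has_derivative (\<lambda>h. h * (real m * T'))) (at c0)"
    using dT unfolding has_field_derivative_def by (auto intro!: derivative_eq_intros simp: mult_ac)
  have zw: "z (s + \<omega>) = z s" for s by (simp add: \<omega>_def z_per)
  have pair: "((\<lambda>c. (\<theta> c, real m * T c)) has_derivative (\<lambda>h. (h *\<^sub>R \<theta>', h * (real m * T')))) (at c0)"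
    by (intro has_derivative_Pair \<theta>d Td)
  have E1: "P s0 \<omega> \<theta>' + (real m * T') *\<^sub>R F = \<theta>'"
  proof -
    have "((\<lambda>c. flow0 X f (real m * T c) (\<theta> c)) has_derivative 
        (\<lambda>h. P s0 \<omega> (h *\<^sub>R \<theta>') + (h * (real m * T')) *\<^sub>R f (z (s0 + \<omega>)))) (at c0)"
      using has_derivative_compose[OF pair, of "\<lambda>q. flow0 X f (snd q) (fst q)"
          "\<lambda>q. P s0 \<omega> (fst q) + snd q *\<^sub>R f (z (s0 + \<omega>))"] flow_joint_derivative[of s0 \<omega>]
      by (simp add: \<theta>0 T0 \<omega>_def)
    then have "(\<theta> has_derivative (\<lambda>h. P s0 \<omega> (h *\<^sub>R \<theta>') + (h * (real m * T')) *\<^sub>R f (z (s0 + \<omega>)))) (at c0)"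
      by (rule has_derivative_transform_eventually) 
        (use closed eventually_nhds_x_imp_x[OF closed] in \<open>auto simp: eventually_nhds_conv_at\<close>)
    from fun_cong[OF has_derivative_unique[OF this \<theta>d], of 1] show ?thesis by (simp add: zw F_def)
  qed
  \<comment> \<open>transport everything from \<open>z s0\<close>, where the family starts, to \<open>z s\<close> by the linearised flow \<open>J\<close>\<close>
  obtain t where t: "t \<ge> 0" "z (s0 + t) = z s" "P (s0 + t) \<omega> = P s \<omega>"
  proof -
    obtain k :: nat where "real k * \<tau> \<ge> s0 - s" using ex_less_of_nat_mult[OF \<tau>] by (metis less_imp_le)
    moreover have "s0 + (s - s0 + real k * \<tau>) = s + real k * \<tau>" by simp
    ultimately show ?thesis using that[of "s - s0 + real k * \<tau>"] by (simp add: z_per P_per)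
  qed
  define J where "J = blinfun_apply (P s0 t)"
  have J: "linear J" unfolding J_def by (simp add: blinfun.bounded_linear_right bounded_linear.linear)
  have JF: "J F = f (z s)" using P_field[of s0 t] t by (simp add: J_def F_def)
  have JP: "P s \<omega> (J v) = J (P s0 \<omega> v)" for v
  proof -
    have "\<omega> \<ge> 0" using \<tau> by (simp add: \<omega>_def)
    then have "P (s0 + t) \<omega> o\<^sub>L P s0 t = P s0 (t + \<omega>)" "P (s0 + \<omega>) t o\<^sub>L P s0 \<omega> = P s0 (\<omega> + t)"
      using P_comp[of t \<omega> s0] P_comp[of \<omega> t s0] t(1) by simp_all
    moreover have "P (s0 + \<omega>) t = P s0 t" by (simp add: \<omega>_def P_per)
    ultimately show ?thesis using t by (metis J_def add.commute blinfun_apply_blinfun_compose)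
  qed
  have Jinj: "v = 0" if "J v = 0" for v using P_bij(1)[OF t(1), of s0 v] that by (simp add: J_def)
  have E2: "DL s (J \<theta>', real m * T') = 1"
  proof -
    have "((\<lambda>c. flow0 X f t (\<theta> c)) has_derivative (\<lambda>h. P s0 t (h *\<^sub>R \<theta>'))) (at c0)"
      using has_derivative_compose[OF \<theta>d, of "flow0 X f t"] flow_derivative[of t s0] by (simp add: \<theta>0)
    then have "((\<lambda>c. (flow0 X f t (\<theta> c), real m * T c)) has_derivative (\<lambda>h. (P s0 t (h *\<^sub>R \<theta>'), h * (real m * T')))) (at c0)"
      by (intro has_derivative_Pair Td)
    from has_derivative_compose[OF this, of \<Lambda>] DL[of s]
    have "((\<lambda>c. \<Lambda> (flow0 X f t (\<theta> c), real m * T c)) has_derivative 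
        (\<lambda>h. DL s (P s0 t (h *\<^sub>R \<theta>'), h * (real m * T')))) (at c0)"
      by (simp add: \<theta>0 T0 flow_z t)
    then have "((\<lambda>c. c) has_derivative (\<lambda>h. DL s (P s0 t (h *\<^sub>R \<theta>'), h * (real m * T')))) (at c0)"
      by (rule has_derivative_transform_eventually) 
        (use LT[of t] eventually_nhds_x_imp_x[OF LT[of t]] in \<open>auto simp: eventually_nhds_conv_at\<close>)
    from fun_cong[OF has_derivative_unique[OF this has_derivative_ident], of 1] show ?thesis by (simp add: J_def)
  qed
  have E3: "DL s (f (z s), 0) = 0"
  proof -
    have "((\<lambda>t. (z t, \<omega>)) has_derivative (\<lambda>h. (h *\<^sub>R f (z s), 0))) (at s)"
      using z_deriv[of s] unfolding has_vector_derivative_def by (auto intro!: derivative_eq_intros)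
    from has_derivative_compose[OF this, of \<Lambda>] DL[of s]
    have "((\<lambda>t. c0) has_derivative (\<lambda>h. DL s (h *\<^sub>R f (z s), 0))) (at s)" by (simp add: Lc \<omega>_def)
    from fun_cong[OF has_derivative_unique[OF this has_derivative_const], of 1] show ?thesis by simp
  qed
  obtain d where d: "J d = \<delta>" using P_bij(2)[OF t(1), of s0 \<delta>] by (auto simp: J_def)
  have dK: "P s0 \<omega> d - d + \<sigma> *\<^sub>R F = 0"
  proof (rule Jinj)
    show "J (P s0 \<omega> d - d + \<sigma> *\<^sub>R F) = 0"
      using K[folded \<omega>_def] by (simp add: linear_add[OF J] linear_diff[OF J] linear_cmul[OF J] JP[symmetric] d JF)
  qed
  define Ker where "Ker = {v. P s0 \<omega> v = v}"
  have KF: "F \<in> Ker" using P_field[of s0 \<omega>] by (simp add: Ker_def F_def zw)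
  have Fnz: "F \<noteq> 0" by (simp add: F_def fnz)
  have span: "\<exists>a b. d = a *\<^sub>R F + b *\<^sub>R \<theta>' \<and> \<sigma> = b * (real m * T')"
  proof -
    have eq: "blinfun_apply (monodromy X f (z s0) \<tau>) ^^ m = P s0 \<omega>"
      by (simp add: monodromy_eq P_power \<omega>_def)
    \<comment> \<open>\<open>(\<theta>', m T')\<close> is not a multiple of \<open>(F, 0)\<close>, as \<open>DL\<close> separates them\<close>
    have indep: False if "\<theta>' = a *\<^sub>R F" "real m * T' = 0" for a
    proof -
      have "(J \<theta>', real m * T') = a *\<^sub>R (f (z s), 0)" using that by (simp add: linear_cmul[OF J] JF)
      then have "DL s (J \<theta>', real m * T') = a *\<^sub>R DL s (f (z s), 0)" by (metis blinfun.scaleR_right)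
      then show False using E2 E3 by simp
    qed
    consider "dim Ker = 1" | "dim Ker = 2" "F \<notin> range (\<lambda>v. P s0 \<omega> v - v)"
      using mn unfolding m_normal_def eq Let_def geom_mult_def by (auto simp: Ker_def F_def)
    then show ?thesis
    proof cases
      case 1
      have "Ker \<subseteq> span {F}"
        using KF Fnz 1 by (intro card_ge_dim_independent) (auto simp: dependent_single)
      then have Kspan: "\<exists>a. v = a *\<^sub>R F" if "v \<in> Ker" for v using that by (auto simp: span_singleton)
      have "real m * T' \<noteq> 0"
      proof
        assume "real m * T' = 0"
        then have "\<theta>' \<in> Ker" using E1 unfolding \<open>real m * T' = 0\<close> by (simp add: Ker_def)
        then show False using Kspan indep \<open>real m * T' = 0\<close> by blast
      qed
      define b where "b = \<sigma> / (real m * T')"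
      have b: "\<sigma> = b * (real m * T')" using \<open>real m * T' \<noteq> 0\<close> by (simp add: b_def)
      have "P s0 \<omega> (d - b *\<^sub>R \<theta>') = d - b *\<^sub>R \<theta>'"
      proof -
        have "P s0 \<omega> d = d - \<sigma> *\<^sub>R F" using dK by (simp add: algebra_simps)
        moreover have "P s0 \<omega> \<theta>' = \<theta>' - (real m * T') *\<^sub>R F" using E1 by (simp add: algebra_simps)
        ultimately show ?thesis by (simp add: blinfun.diff_right blinfun.scaleR_right b scaleR_diff_right)
      qed
      then obtain a where "d - b *\<^sub>R \<theta>' = a *\<^sub>R F" using Kspan by (auto simp: Ker_def)
      then have "d = a *\<^sub>R F + b *\<^sub>R \<theta>'" by (simp add: algebra_simps)
      then show ?thesis using b by blast
    next
      case 2
      have nr: "c = 0" if "P s0 \<omega> v - v + c *\<^sub>R F = 0" for c v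
      proof (rule ccontr)
        assume "c \<noteq> 0"
        have "c *\<^sub>R F = v - P s0 \<omega> v" using that by (simp add: algebra_simps)
        then have "F = (1/c) *\<^sub>R (v - P s0 \<omega> v)" using \<open>c \<noteq> 0\<close> by (metis divide_self_if inverse_eq_divide left_inverse scaleR_one scaleR_scaleR)
        then have "F = P s0 \<omega> (- (1/c) *\<^sub>R v) - (- (1/c) *\<^sub>R v)"
          by (simp add: blinfun.scaleR_right blinfun.minus_right algebra_simps)
        then show False using 2 by blast
      qed
      have \<sigma>0: "\<sigma> = 0" using nr[OF dK] .
      have m0: "real m * T' = 0" using nr[of \<theta>' "real m * T'"] E1 by (simp add: algebra_simps)
      have in_Ker: "d \<in> Ker" "\<theta>' \<in> Ker" using dK E1 \<sigma>0 m0 by (auto simp: Ker_def)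
      have \<theta>F: "\<theta>' \<notin> span {F}" using indep m0 by (auto simp: span_singleton)
      then have ne: "\<theta>' \<noteq> F" using span_base by blast
      have "independent {\<theta>', F}"
        by (rule independent_insertI[OF \<theta>F]) (simp add: dependent_single Fnz)
      then have "Ker \<subseteq> span {\<theta>', F}"
        using in_Ker KF 2 ne by (intro card_ge_dim_independent) auto
      then have "d \<in> span {\<theta>', F}" using in_Ker by blast
      then obtain b where "d - b *\<^sub>R \<theta>' \<in> span {F}" using span_breakdown_eq by blast
      then obtain a where "d - b *\<^sub>R \<theta>' = a *\<^sub>R F" by (auto simp: span_singleton)
      then have "d = a *\<^sub>R F + b *\<^sub>R \<theta>'" by (simp add: algebra_simps)
      then show ?thesis using \<sigma>0 m0 by auto
    qed
  qed
  then obtain a b where ab: "d = a *\<^sub>R F + b *\<^sub>R \<theta>'" "\<sigma> = b * (real m * T')" by blast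
  have \<delta>: "\<delta> = a *\<^sub>R f (z s) + b *\<^sub>R J \<theta>'" using d ab by (simp add: linear_add[OF J] linear_cmul[OF J] JF)
  then have "(\<delta>, \<sigma>) = a *\<^sub>R (f (z s), 0) + b *\<^sub>R (J \<theta>', real m * T')" using ab by simp
  then have "DL s (\<delta>, \<sigma>) = a *\<^sub>R DL s (f (z s), 0) + b *\<^sub>R DL s (J \<theta>', real m * T')"
    by (metis blinfun.add_right blinfun.scaleR_right)
  then have "b = 0" using E2 E3 L0 by simp
  then have "\<delta> = a *\<^sub>R f (z s)" using \<delta> by simp
  then have "\<delta> = 0" using orth fnz by auto
  then show ?thesis using \<open>b = 0\<close> ab by simp
qed

end

locale minimal_periodic_orbit = periodic_orbit +
  assumes minimal: "\<And>\<sigma>. 0 < \<sigma> \<Longrightarrow> \<sigma> < \<tau> \<Longrightarrow> \<exists>t. z (t + \<sigma>) \<noteq> z t"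
begin

lemma field_nonzero: "f (z s) \<noteq> 0"
proof
  assume "f (z s) = 0"
  then have "solves X (\<lambda>_. f) UNIV (\<lambda>_. z s)" using zX by (simp add: solves_def)
  from flow0_eq[OF X f this, of 0] have "flow0 X f t (z s) = z s" for t by (metis diff_zero top_greatest)
  then have c: "z (s + t) = z s" for t by (simp add: flow_z)
  have e: "z t = z s" for t using c[of "t - s"] by simp
  obtain t where "z (t + \<tau> / 2) \<noteq> z t" using minimal[of "\<tau> / 2"] \<tau> by auto
  then show False using e[of "t + \<tau> / 2"] e[of t] by metis
qed

lemma z_inj: 
  assumes "z s = z s'" "0 \<le> s' - s" "s' - s < \<tau>"
  shows "s = s'"
proof (rule ccontr)
  assume "s \<noteq> s'"
  then obtain t where "z (t + (s' - s)) \<noteq> z t" using minimal[of "s' - s"] assms by auto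
  moreover have "z (t + (s' - s)) = flow0 X f (t - s) (z s')" by (simp add: flow_z algebra_simps)
  moreover have "z t = flow0 X f (t - s) (z s)" by (simp add: flow_z)
  ultimately show False using assms by simp
qed

text \<open>If \<open>z(s) + \<epsilon>\<delta> = z(s') + \<epsilon>\<delta>'\<close>, pairing with \<open>f(z(s))\<close> bounds a multiple of \<open>|s - s'|\<close> by
  \<open>\<epsilon> |\<delta>' \<bullet> (f(z(s)) - f(z(s')))| = O(\<epsilon> |s - s'|)\<close> for close phases, while distant phases are separated on the orbit.\<close>

lemma tubular_injective:
  "\<exists>\<epsilon>0>0. \<forall>\<epsilon> s s' \<delta> \<delta>'. 0 < \<epsilon> \<and> \<epsilon> < \<epsilon>0 \<and> s \<in> {0..<\<tau>} \<and> s' \<in> {0..<\<tau>} \<and> norm \<delta> \<le> R \<and> norm \<delta>' \<le> R \<and>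
     \<delta> \<bullet> f (z s) = 0 \<and> \<delta>' \<bullet> f (z s') = 0 \<and> z s + \<epsilon> *\<^sub>R \<delta> = z s' + \<epsilon> *\<^sub>R \<delta>' \<longrightarrow> s = s'"
proof -
  let ?I = "{-\<tau>..2*\<tau>}"
  obtain M where "M > 0" and M: "\<And>t. t \<in> ?I \<Longrightarrow> norm (f (z t)) \<le> M"
    by (rule bounded_on_compact[OF fz_cont compact_Icc]) (rule that; blast)
  obtain K where K: "\<And>t t'. t \<in> ?I \<Longrightarrow> t' \<in> ?I \<Longrightarrow> norm (f (z t) - f (z t')) \<le> K * \<bar>t - t'\<bar>" and "K > 0"
  proof -
    have "continuous_on ?I (\<lambda>t. blinderiv f (z t) (f (z t)))" by (intro continuous_intros Dfz_cont fz_cont)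
    then obtain K where K: "K > 0" "\<And>t. t \<in> ?I \<Longrightarrow> norm (blinderiv f (z t) (f (z t))) \<le> K"
      by (rule bounded_on_compact[OF _ compact_Icc]) (rule that; blast)
    have "norm (f (z t) - f (z t')) \<le> K * norm (t - t')" if "t \<in> ?I" "t' \<in> ?I" for t t'
    proof (rule differentiable_bound[where S="?I" and f'="\<lambda>t h. h *\<^sub>R blinderiv f (z t) (f (z t))"])
      fix r assume "r \<in> ?I"
      show "((\<lambda>t. f (z t)) has_derivative (\<lambda>h. h *\<^sub>R blinderiv f (z r) (f (z r)))) (at r within ?I)"
        using fz_deriv[of r] has_derivative_at_withinI by (auto simp: has_vector_derivative_def)
      show "onorm (\<lambda>h. h *\<^sub>R blinderiv f (z r) (f (z r))) \<le> K"
        using K(2)[OF \<open>r \<in> ?I\<close>] by (intro onorm_le) (simp add: mult.commute[of K] mult_left_mono)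
    qed (use that in auto)
    then show ?thesis using that[of K] K(1) by simp
  qed
  obtain c where c: "c > 0" "\<And>t. t \<in> {0..\<tau>} \<Longrightarrow> c \<le> f (z t) \<bullet> f (z t)"
  proof -
    have "continuous_on {0..\<tau>} (\<lambda>t. f (z t) \<bullet> f (z t))" by (intro continuous_intros fz_cont)
    then obtain t0 where "\<And>t. t \<in> {0..\<tau>} \<Longrightarrow> f (z t0) \<bullet> f (z t0) \<le> f (z t) \<bullet> f (z t)"
      using continuous_attains_inf[of "{0..\<tau>}" "\<lambda>t. f (z t) \<bullet> f (z t)"] \<tau> by fastforce
    then show ?thesis using that[of "f (z t0) \<bullet> f (z t0)"] field_nonzero by simp
  qed
  define d where "d = min (\<tau> / 2) (c / (2 * K * M))"
  have d: "d > 0" "d \<le> \<tau>" "K * d * M \<le> c / 2"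
  proof -
    show "d > 0" "d \<le> \<tau>" using \<tau> c \<open>K > 0\<close> \<open>M > 0\<close> by (auto simp: d_def)
    have "d \<le> c / (2 * K * M)" by (simp add: d_def)
    then show "K * d * M \<le> c / 2" using \<open>K > 0\<close> \<open>M > 0\<close> by (simp add: field_simps)
  qed
  have near: "s = s'" if "0 < \<epsilon>" "\<epsilon> * (max R 0) * K < c / 2" "s \<in> {0..\<tau>}" "\<bar>s - s'\<bar> \<le> d" "norm \<delta>' \<le> R"
    "\<delta> \<bullet> f (z s) = 0" "\<delta>' \<bullet> f (z s') = 0" "z s + \<epsilon> *\<^sub>R \<delta> = z s' + \<epsilon> *\<^sub>R \<delta>'" for \<epsilon> s s' \<delta> \<delta>'
  proof (rule ccontr)
    assume "s \<noteq> s'"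
    have s': "s' \<in> ?I" and s: "s \<in> ?I" using that d by auto
    define lo where "lo = min s s'"
    define hi where "hi = max s s'"
    have "lo < hi" using \<open>s \<noteq> s'\<close> by (auto simp: lo_def hi_def)
    have "((\<lambda>t. z t \<bullet> f (z s)) has_real_derivative f (z t) \<bullet> f (z s)) (at t)" for t
      using z_deriv[of t] unfolding has_vector_derivative_def has_field_derivative_def
      by (auto intro!: derivative_eq_intros simp: mult.commute)
    then obtain \<xi> where \<xi>: "lo < \<xi>" "\<xi> < hi" "z hi \<bullet> f (z s) - z lo \<bullet> f (z s) = (hi - lo) * (f (z \<xi>) \<bullet> f (z s))"
      using MVT2[OF \<open>lo < hi\<close>, of "\<lambda>t. z t \<bullet> f (z s)" "\<lambda>t. f (z t) \<bullet> f (z s)"] by blast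
    have \<xi>I: "\<xi> \<in> ?I" using \<xi> s s' by (auto simp: lo_def hi_def)
    have "\<bar>(f (z \<xi>) - f (z s)) \<bullet> f (z s)\<bar> \<le> norm (f (z \<xi>) - f (z s)) * norm (f (z s))"
      by (rule Cauchy_Schwarz_ineq2)
    also have "\<dots> \<le> (K * d) * M"
    proof (rule mult_mono)
      have "\<bar>\<xi> - s\<bar> \<le> d" using \<xi> that(4) by (auto simp: lo_def hi_def min_def max_def split: if_splits)
      then have "K * \<bar>\<xi> - s\<bar> \<le> K * d" using \<open>K > 0\<close> by simp
      then show "norm (f (z \<xi>) - f (z s)) \<le> K * d" using K[OF \<xi>I s] by linarith
    qed (use M[OF s] \<open>K > 0\<close> d in auto)
    finally have "f (z \<xi>) \<bullet> f (z s) \<ge> c / 2"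
      using c(2)[OF that(3)] d(3) by (simp add: inner_diff_left abs_le_iff)
    then have "(hi - lo) * (c / 2) \<le> (hi - lo) * (f (z \<xi>) \<bullet> f (z s))" using \<open>lo < hi\<close> by (intro mult_left_mono) auto
    then have "(hi - lo) * (c / 2) \<le> \<bar>z hi \<bullet> f (z s) - z lo \<bullet> f (z s)\<bar>" using \<xi>(3) by linarith
    moreover have "hi - lo = \<bar>s - s'\<bar>" by (simp add: lo_def hi_def)
    moreover have "\<bar>z hi \<bullet> f (z s) - z lo \<bullet> f (z s)\<bar> = \<bar>(z s' - z s) \<bullet> f (z s)\<bar>"
      by (cases "s \<le> s'") (auto simp: lo_def hi_def inner_diff_left abs_minus_commute)
    ultimately have 1: "\<bar>s - s'\<bar> * (c / 2) \<le> \<bar>(z s' - z s) \<bullet> f (z s)\<bar>" by simp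
    have "z s' - z s = \<epsilon> *\<^sub>R (\<delta> - \<delta>')" using that(8) by (simp add: algebra_simps)
    then have "(z s' - z s) \<bullet> f (z s) = - \<epsilon> * (\<delta>' \<bullet> (f (z s) - f (z s')))"
      using that(6,7) by (simp add: inner_diff_left inner_diff_right)
    then have "\<bar>(z s' - z s) \<bullet> f (z s)\<bar> = \<epsilon> * \<bar>\<delta>' \<bullet> (f (z s) - f (z s'))\<bar>" using that(1) by (simp add: abs_mult)
    also have "\<dots> \<le> \<epsilon> * (max R 0 * (K * \<bar>s - s'\<bar>))"
    proof (rule mult_left_mono)
      have "\<bar>\<delta>' \<bullet> (f (z s) - f (z s'))\<bar> \<le> norm \<delta>' * norm (f (z s) - f (z s'))" by (rule Cauchy_Schwarz_ineq2)
      also have "\<dots> \<le> max R 0 * (K * \<bar>s - s'\<bar>)" using that(5) K[OF s s'] by (intro mult_mono) auto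
      finally show "\<bar>\<delta>' \<bullet> (f (z s) - f (z s'))\<bar> \<le> max R 0 * (K * \<bar>s - s'\<bar>)" .
    qed (use that in auto)
    finally have "\<bar>s - s'\<bar> * (c / 2) \<le> \<bar>s - s'\<bar> * (\<epsilon> * max R 0 * K)" using 1 by (simp add: mult_ac)
    moreover have "\<bar>s - s'\<bar> * (\<epsilon> * max R 0 * K) < \<bar>s - s'\<bar> * (c / 2)"
      using that(2) \<open>s \<noteq> s'\<close> by (intro mult_strict_left_mono) auto
    ultimately show False by linarith
  qed
  obtain \<kappa> where \<kappa>: "\<kappa> > 0" 
    "\<And>s s'. s \<in> {0..\<tau>} \<Longrightarrow> s' \<in> {0..\<tau>} \<Longrightarrow> d \<le> \<bar>s - s'\<bar> \<Longrightarrow> \<bar>s - s'\<bar> \<le> \<tau> - d \<Longrightarrow> \<kappa> \<le> norm (z s - z s')"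
  proof -
    define S where "S = ({0..\<tau>} \<times> {0..\<tau>}) \<inter> (\<lambda>p. \<bar>fst p - snd p\<bar>) -` {d..\<tau>-d}"
    have "compact S" unfolding S_def 
      by (intro compact_Int_closed compact_Times closed_vimage continuous_intros) auto
    have mem: "(s, s') \<in> S" if "s \<in> {0..\<tau>}" "s' \<in> {0..\<tau>}" "d \<le> \<bar>s - s'\<bar>" "\<bar>s - s'\<bar> \<le> \<tau> - d" for s s'
      using that by (simp add: S_def)
    have cont: "continuous_on S (\<lambda>p. norm (z (fst p) - z (snd p)))"
      by (intro continuous_intros continuous_on_compose2[OF z_cont[of UNIV]]) auto
    show ?thesis
    proof (cases "S = {}")
      case True
      then show ?thesis using that[of 1] mem by auto
    next
      case False
      obtain p where p: "p \<in> S" "\<And>q. q \<in> S \<Longrightarrow> norm (z (fst p) - z (snd p)) \<le> norm (z (fst q) - z (snd q))"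
        using continuous_attains_inf[OF \<open>compact S\<close> False cont] by blast
      have p': "d \<le> \<bar>fst p - snd p\<bar>" "\<bar>fst p - snd p\<bar> \<le> \<tau> - d" using p(1) by (auto simp: S_def)
      have "z (fst p) \<noteq> z (snd p)"
      proof
        assume "z (fst p) = z (snd p)"
        then have "fst p = snd p" using z_inj[of "fst p" "snd p"] z_inj[of "snd p" "fst p"] p' d(1) by fastforce
        then show False using p' d by simp
      qed
      then show ?thesis using that[of "norm (z (fst p) - z (snd p))"] p(2)[OF mem] by simp
    qed
  qed
  define \<epsilon>0 where "\<epsilon>0 = min (c / (2 * ((max R 0 + 1) * K))) (\<kappa> / (2 * (max R 0 + 1)))"
  have \<epsilon>0: "\<epsilon>0 > 0" using c \<kappa> \<open>K > 0\<close> by (auto simp: \<epsilon>0_def add_nonneg_pos)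
  have R1: "max R 0 + 1 > 0" by linarith
  show ?thesis
  proof (intro exI[of _ \<epsilon>0] conjI \<epsilon>0 allI impI)
    fix \<epsilon> s s' \<delta> \<delta>'
    assume A: "0 < \<epsilon> \<and> \<epsilon> < \<epsilon>0 \<and> s \<in> {0..<\<tau>} \<and> s' \<in> {0..<\<tau>} \<and> norm \<delta> \<le> R \<and> norm \<delta>' \<le> R \<and>
     \<delta> \<bullet> f (z s) = 0 \<and> \<delta>' \<bullet> f (z s') = 0 \<and> z s + \<epsilon> *\<^sub>R \<delta> = z s' + \<epsilon> *\<^sub>R \<delta>'"
    have e1: "\<epsilon> * (max R 0) * K < c / 2"
    proof -
      have "\<epsilon> < c / (2 * ((max R 0 + 1) * K))" using A by (simp add: \<epsilon>0_def)
      then have "\<epsilon> * ((max R 0 + 1) * K) < c / 2" 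
        using R1 \<open>K > 0\<close> pos_less_divide_eq[of "2 * ((max R 0 + 1) * K)" \<epsilon> c] by (simp add: mult_ac)
      moreover have "\<epsilon> * (max R 0) * K \<le> \<epsilon> * ((max R 0 + 1) * K)" 
        using A \<open>K > 0\<close> by (simp add: mult.assoc)
      ultimately show ?thesis by linarith
    qed
    have e2: "norm (z s - z s') < \<kappa>"
    proof -
      have "z s - z s' = \<epsilon> *\<^sub>R (\<delta>' - \<delta>)" using A by (simp add: algebra_simps)
      then have "norm (z s - z s') = \<epsilon> * norm (\<delta>' - \<delta>)" using A by simp
      also have "norm (\<delta>' - \<delta>) \<le> norm \<delta>' + norm \<delta>" by (rule norm_triangle_ineq4)
      also have "norm \<delta>' + norm \<delta> \<le> 2 * (max R 0 + 1)"
      proof -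
        have "norm \<delta> \<le> R" "norm \<delta>' \<le> R" using A by auto
        moreover have "R \<le> max R 0" by simp
        ultimately show ?thesis unfolding distrib_left by linarith
      qed
      finally have "norm (z s - z s') \<le> \<epsilon> * (2 * (max R 0 + 1))" using A by simp
      also have "\<epsilon> < \<kappa> / (2 * (max R 0 + 1))" using A by (simp add: \<epsilon>0_def)
      then have "\<epsilon> * (2 * (max R 0 + 1)) < \<kappa>" using R1 by (simp add: field_simps)
      finally show ?thesis .
    qed
    \<comment> \<open>phases near opposite ends of \<open>[0, \<tau>)\<close> are close on the circle\<close>
    consider "\<bar>s - s'\<bar> \<le> d" | "s - s' > \<tau> - d" | "s' - s > \<tau> - d"
      using \<kappa>(2)[of s s'] e2 A by fastforce
    then show "s = s'"
    proof cases
      case 1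
      then show ?thesis using near[of \<epsilon> s s' \<delta>' \<delta>] A e1 by auto
    next
      case 2
      have "z (s' + \<tau>) = z s'" by (rule zper)
      then have "s = s' + \<tau>" using near[of \<epsilon> s "s' + \<tau>" \<delta>' \<delta>] A e1 2 by auto
      then show ?thesis using A by auto
    next
      case 3
      have "z (s + \<tau>) = z s" by (rule zper)
      then have "s' = s + \<tau>" using near[of \<epsilon> s' "s + \<tau>" \<delta> \<delta>'] A e1 3 by auto
      then show ?thesis using A by auto
    qed
  qed
qed

end

section \<open>The scaled deviation from the periodic orbit\<close>

lemma C1_inverse:
  fixes h :: "'a::real_normed_vector \<Rightarrow> real"
  assumes "C1 S h" "\<And>x. x \<in> S \<Longrightarrow> h x \<noteq> 0"
  shows "C1 S (\<lambda>x. inverse (h x))"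
proof -
  have "C1 (- {0::real}) inverse"
  proof (rule C1_I)
    show "(inverse has_derivative blinfun_apply (blinfun_scaleR_left (- (inverse x * inverse x)))) (at x)"
      if "x \<in> - {0}" for x :: real
      using that by (auto intro!: derivative_eq_intros)
    show "continuous_on (- {0}) (\<lambda>x::real. blinfun_scaleR_left (- (inverse x * inverse x)))"
      by (intro bounded_linear.continuous_on[OF bounded_linear_blinfun_scaleR_left] continuous_intros) auto
  qed
  moreover have "h ` S \<subseteq> - {0}" by (force dest: assms(2))
  ultimately show ?thesis by (rule C1_compose[OF _ assms(1)])
qed

text \<open>\<open>G\<close> is a continuation of the forcing to an open set, so in particular to some \<open>\<epsilon> < 0\<close>; this allows
  two-sided derivatives at \<open>\<epsilon> = 0\<close>. \<open>\<Lambda>\<close> is the mapping \<open>L\<close> on pairs, with value \<open>c0\<close> on the orbit.\<close>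

locale perturbed_orbit = minimal_periodic_orbit X f z \<tau>
  for X :: "'a::euclidean_space set" and f z \<tau> +
  fixes g :: "'a \<Rightarrow> real \<Rightarrow> real \<Rightarrow> real \<Rightarrow> 'a" and H :: "'a \<Rightarrow> real" and m l :: nat
    and G :: "('a \<times> real \<times> real) \<times> real \<Rightarrow> 'a" and SG :: "(('a \<times> real \<times> real) \<times> real) set"
    and \<Lambda> :: "'a \<times> real \<Rightarrow> real" and W :: "('a \<times> real) set" and c0 :: real
  assumes f2: "C1 X (blinderiv f)"
    and H: "\<And>x. x \<in> X \<Longrightarrow> GDERIV H x :> grad H x" and Hf: "\<And>x. x \<in> X \<Longrightarrow> grad H x \<bullet> f x = 0"
    and Hnz: "\<And>x. x \<in> X \<Longrightarrow> f x \<noteq> 0 \<Longrightarrow> grad H x \<noteq> 0"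
    and m: "m > 0" and l: "l > 0"
    and SG: "open SG" and G: "C1 SG G"
    and SGX: "\<And>x T \<epsilon> t. x \<in> X \<Longrightarrow> T > 0 \<Longrightarrow> \<epsilon> \<ge> 0 \<Longrightarrow> ((x, T, \<epsilon>), t) \<in> SG"
    and Gg: "\<And>x T \<epsilon> t. x \<in> X \<Longrightarrow> T > 0 \<Longrightarrow> \<epsilon> \<ge> 0 \<Longrightarrow> G ((x, T, \<epsilon>), t) = g x t T \<epsilon>"
    and W: "open W" and \<Lambda>: "C1 W \<Lambda>" and \<Lambda>2: "C1 W (blinderiv \<Lambda>)"
    and zW: "\<And>s. (z s, real m * \<tau>) \<in> W" and \<Lambda>z: "\<And>s. \<Lambda> (z s, real m * \<tau>) = c0"
    and nondeg: "\<And>s \<delta> \<sigma>. P s (real m * \<tau>) \<delta> - \<delta> + \<sigma> *\<^sub>R f (z s) = 0 \<Longrightarrow>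
      blinderiv \<Lambda> (z s, real m * \<tau>) (\<delta>, \<sigma>) = 0 \<Longrightarrow> \<delta> \<bullet> f (z s) = 0 \<Longrightarrow> \<delta> = 0 \<and> \<sigma> = 0"
begin

definition a :: "real \<Rightarrow> 'a" where "a s = grad H (z s)"

lemma a_C1: "C1 S a"
  using C1_subset[OF gradH_C1[OF H Hf]] unfolding a_def[abs_def] by blast

lemma a_nz: "a s \<noteq> 0"
  using Hnz[OF zX field_nonzero] by (simp add: a_def)

lemma a_field: "a s \<bullet> f (z s) = 0"
  using Hf[OF zX] by (simp add: a_def)

lemma a_per: "a (s + \<tau>) = a s"
  by (simp add: a_def zper)

lemma a_deriv: "(a has_vector_derivative - (\<Sum>b\<in>Basis. (a s \<bullet> blinderiv f (z s) b) *\<^sub>R b)) (at s)"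
  using gradH_deriv[OF H Hf] unfolding a_def[abs_def] by blast

abbreviation "\<omega> \<equiv> real m * \<tau>"

lemma \<omega>_pos: "\<omega> > 0"
  using m \<tau> by simp

lemma z_\<omega>: "z (s + \<omega>) = z s"
  by (rule z_per)

lemma a_P: "a s \<bullet> P s \<omega> v = a s \<bullet> v"
  using gradH_P[OF H Hf, where s=s and t=\<omega> and v=v] by (simp add: a_def z_\<omega>)

text \<open>With \<open>x(t) = z(t + s) + \<epsilon> y(t)\<close> the equation \<open>x' = f(x) + \<epsilon> g\<close> becomes \<open>y' = Q(t, \<epsilon> y) y + g\<close>, where
  \<open>Q\<close> is an averaged derivative of \<open>f\<close>; this is regular at \<open>\<epsilon> = 0\<close>. The state collects
  \<open>(y, t, s, \<sigma>, \<epsilon>)\<close>, with the parameters as constants, and time is rescaled by \<open>m\<tau> + \<epsilon>\<sigma> = l T\<close>, so that the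
  whole period becomes the unit interval.\<close>

definition base :: "'a \<times> real \<times> real \<times> real \<times> real \<Rightarrow> 'a" where
  "base q = z (fst (snd q) + fst (snd (snd q)))"

definition dev :: "'a \<times> real \<times> real \<times> real \<times> real \<Rightarrow> 'a" where
  "dev q = snd (snd (snd (snd q))) *\<^sub>R fst q"

definition dur :: "'a \<times> real \<times> real \<times> real \<times> real \<Rightarrow> real" where
  "dur q = \<omega> + snd (snd (snd (snd q))) * fst (snd (snd (snd q)))"

definition garg :: "'a \<times> real \<times> real \<times> real \<times> real \<Rightarrow> ('a \<times> real \<times> real) \<times> real" where
  "garg q = ((base q + dev q, dur q * inverse (real l), snd (snd (snd (snd q)))), fst (snd q))"

definition dev_domain :: "('a \<times> real \<times> real \<times> real \<times> real) set" where
  "dev_domain = {q. (base q, dev q) \<in> seg_domain X \<and> dur q > 0 \<and> garg q \<in> SG}"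

definition dev_field :: "'a \<times> real \<times> real \<times> real \<times> real \<Rightarrow> 'a \<times> real \<times> real \<times> real \<times> real" where
  "dev_field q = (dur q *\<^sub>R (mean_deriv f (base q, dev q) (fst q) + G (garg q)), dur q, 0, 0, 0)"

lemma base_C1: "C1 S base" unfolding base_def[abs_def]
  by (rule C1_compose[OF z_C1[of UNIV]]) (intro C1_intros, auto)

lemma dev_C1: "C1 S dev" unfolding dev_def[abs_def] by (intro C1_intros)

lemma dur_C1: "C1 S dur" unfolding dur_def[abs_def] by (intro C1_intros)

lemma garg_C1: "C1 S garg" unfolding garg_def[abs_def] by (intro C1_intros base_C1 dev_C1 dur_C1)

lemma open_dev_domain: "open dev_domain"
proof -
  have "open ((\<lambda>q. (base q, dev q)) -` seg_domain X)"
    by (intro open_vimage open_seg_domain X C1_continuous_on C1_Pair base_C1 dev_C1)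
  moreover have "open (dur -` {0<..})" by (intro open_vimage C1_continuous_on dur_C1) auto
  moreover have "open (garg -` SG)" by (intro open_vimage C1_continuous_on garg_C1 SG)
  ultimately have "open ((\<lambda>q. (base q, dev q)) -` seg_domain X \<inter> (dur -` {0<..} \<inter> garg -` SG))"
    by (intro open_Int)
  moreover have "dev_domain = (\<lambda>q. (base q, dev q)) -` seg_domain X \<inter> (dur -` {0<..} \<inter> garg -` SG)"
    by (auto simp: dev_domain_def)
  ultimately show ?thesis by simp
qed

lemma dev_field_C1: "C1 dev_domain dev_field"
proof -
  have "C1 dev_domain (\<lambda>q. mean_deriv f (base q, dev q))"
    by (rule C1_compose[OF mean_deriv_C1[OF X f2] C1_Pair[OF base_C1 dev_C1]]) (auto simp: dev_domain_def)
  moreover have "C1 dev_domain (\<lambda>q. G (garg q))"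
    by (rule C1_compose[OF G garg_C1]) (auto simp: dev_domain_def)
  ultimately show ?thesis unfolding dev_field_def[abs_def] by (intro C1_intros dur_C1)
qed

definition dev_end :: "'a \<times> real \<times> real \<times> real \<times> real \<Rightarrow> 'a" where
  "dev_end q = fst (traj dev_domain (\<lambda>_. dev_field) q 1)"

abbreviation "dev_ok \<equiv> unit_domain dev_domain dev_field"

lemma open_dev_ok: "open dev_ok" and dev_end_C1: "C1 dev_ok dev_end"
proof -
  show "open dev_ok" by (rule unit_map_C1(1)[OF open_dev_domain dev_field_C1])
  show "C1 dev_ok dev_end" unfolding dev_end_def[abs_def]
    by (rule C1_fst[OF unit_map_C1(2)[OF open_dev_domain dev_field_C1]])
qed

lemma dev_end_eq: "solves dev_domain (\<lambda>_. dev_field) {0..1} q \<Longrightarrow> dev_end (q 0) = fst (q 1)"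
  unfolding dev_end_def using traj_unit[OF open_dev_domain dev_field_C1] by simp

lemma constant_on_unit_interval:
  fixes c :: "real \<Rightarrow> 'b::real_normed_vector"
  assumes "\<And>r. r \<in> {0..1} \<Longrightarrow> (c has_vector_derivative 0) (at r within {0..1})" "r \<in> {0..1}"
  shows "c r = c 0"
proof -
  have "(c has_derivative (\<lambda>h. 0)) (at r within {0..1})" if "r \<in> {0..1}" for r
    using assms(1)[OF that] by (simp add: has_vector_derivative_def)
  then obtain k where k: "\<And>r. r \<in> {0..1} \<Longrightarrow> c r = k"
    using has_derivative_zero_constant[of "{0..1::real}" c] by auto
  show ?thesis using k[OF assms(2)] k[of 0] by simp
qed

lemma dev_structure:
  assumes q: "solves dev_domain (\<lambda>_. dev_field) {0..1} q" and q0: "q 0 = (\<delta>, 0, s, \<sigma>, \<epsilon>)" and r: "r \<in> {0..1}"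
  shows "q r = (fst (q r), (\<omega> + \<epsilon> * \<sigma>) * r, s, \<sigma>, \<epsilon>)"
proof -
  have d: "(q has_vector_derivative dev_field (q r)) (at r within {0..1})" if "r \<in> {0..1}" for r
    using q that by (simp add: solves_def)
  have sn: "((\<lambda>r. snd (q r)) has_vector_derivative (dur (q r), 0, 0, 0)) (at r within {0..1})" if "r \<in> {0..1}" for r
    using bounded_linear.has_vector_derivative[OF bounded_linear_snd d[OF that]] by (simp add: dev_field_def)
  have "((\<lambda>r. snd (snd (q r))) has_vector_derivative 0) (at r within {0..1})" if "r \<in> {0..1}" for r
    using bounded_linear.has_vector_derivative[OF bounded_linear_snd sn[OF that]] by (simp add: zero_prod_def)
  then have c: "snd (snd (q r)) = (s, \<sigma>, \<epsilon>)" if "r \<in> {0..1}" for r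
    using constant_on_unit_interval[of "\<lambda>r. snd (snd (q r))" r] that q0 by simp
  have "((\<lambda>r. fst (snd (q r)) - (\<omega> + \<epsilon> * \<sigma>) * r) has_vector_derivative 0) (at r within {0..1})" if "r \<in> {0..1}" for r
  proof -
    have "((\<lambda>r. fst (snd (q r))) has_vector_derivative (\<omega> + \<epsilon> * \<sigma>)) (at r within {0..1})"
      using bounded_linear.has_vector_derivative[OF bounded_linear_fst sn[OF that]] c[OF that] by (simp add: dur_def)
    moreover have "((\<lambda>r. (\<omega> + \<epsilon> * \<sigma>) * r) has_vector_derivative (\<omega> + \<epsilon> * \<sigma>)) (at r within {0..1})"
      by (auto intro!: derivative_eq_intros simp: has_real_derivative_iff_has_vector_derivative[symmetric])
    ultimately show ?thesis using has_vector_derivative_diff by fastforce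
  qed
  from constant_on_unit_interval[OF this r] have "fst (snd (q r)) = (\<omega> + \<epsilon> * \<sigma>) * r" using q0 by simp
  then show ?thesis using c[OF r] by (metis prod.collapse)
qed

text \<open>The substitution \<open>x(t) = z(s + t) + \<epsilon> y(t)\<close>, undone for \<open>\<epsilon> \<ge> 0\<close>, where \<open>G\<close> agrees with \<open>g\<close>.\<close>

lemma pert_traj_dev:
  assumes q: "(\<delta>, 0, s, \<sigma>, \<epsilon>) \<in> dev_ok" and \<epsilon>: "\<epsilon> \<ge> 0"
  defines "d \<equiv> \<omega> + \<epsilon> * \<sigma>"
  shows "d > 0" and "pert_traj X f g d (z s + \<epsilon> *\<^sub>R \<delta>) (d / real l) \<epsilon> = z (s + d) + \<epsilon> *\<^sub>R dev_end (\<delta>, 0, s, \<sigma>, \<epsilon>)"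
proof -
  obtain q where q: "solves dev_domain (\<lambda>_. dev_field) {0..1} q" "q 0 = (\<delta>, 0, s, \<sigma>, \<epsilon>)"
    using q by (auto simp: unit_domain_def)
  note st = dev_structure[OF q, folded d_def]
  have qD: "q r \<in> dev_domain" if "r \<in> {0..1}" for r using q(1) that by (simp add: solves_def)
  have dur: "dur (q r) = d" if "r \<in> {0..1}" for r using st[OF that] by (metis dur_def d_def fst_conv snd_conv)
  show d: "d > 0" using qD[of 0] dur[of 0] by (simp add: dev_domain_def)
  define T where "T = d / real l"
  have T: "T > 0" using d l by (simp add: T_def)
  let ?G = "\<lambda>u x. f x + \<epsilon> *\<^sub>R g x u T \<epsilon>"
  define x where "x = (\<lambda>t. z (s + t) + \<epsilon> *\<^sub>R fst (q (0 + inverse d * t)))"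
  have seg: "closed_segment 0 d = {0..d}" using d by (simp add: closed_segment_eq_real_ivl)
  have "solves X ?G {0..d} x" unfolding solves_def
  proof
    fix t assume t: "t \<in> {0..d}"
    have unit: "0 + inverse d * t \<in> {0..1}" if "t \<in> {0..d}" for t
      using that d by (auto simp: field_simps)
    define r where "r = 0 + inverse d * t"
    have r: "r \<in> {0..1}" using unit[OF t] by (simp add: r_def)
    have dr: "d * r = t" using d by (simp add: r_def)
    obtain y where qr: "q r = (y, t, s, \<sigma>, \<epsilon>)" using st[OF r] dr by metis
    have bd: "base (q r) = z (s + t)" "dev (q r) = \<epsilon> *\<^sub>R y" by (simp_all add: base_def dev_def qr add.commute)
    have inseg: "(z (s + t), \<epsilon> *\<^sub>R y) \<in> seg_domain X" using qD[OF r] bd by (simp add: dev_domain_def)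
    have xt: "x t = z (s + t) + \<epsilon> *\<^sub>R y" using qr by (simp add: x_def r_def)
    have "\<forall>\<theta>\<in>{0..1}. z (s + t) + \<theta> *\<^sub>R (\<epsilon> *\<^sub>R y) \<in> X" using inseg by (simp add: seg_domain_def)
    then have "z (s + t) + 1 *\<^sub>R (\<epsilon> *\<^sub>R y) \<in> X" by (rule bspec) simp
    then have xX: "x t \<in> X" using xt by simp
    have ga: "garg (q r) = ((x t, T, \<epsilon>), t)" using bd dur[OF r] xt by (simp add: garg_def qr T_def divide_inverse)
    have "((\<lambda>r. fst (q r)) has_vector_derivative fst (dev_field (q r))) (at r within {0..1})"
      using q(1) r by (auto simp: solves_def intro: bounded_linear.has_vector_derivative[OF bounded_linear_fst])
    then have "((\<lambda>t. fst (q (0 + inverse d * t))) has_vector_derivative inverse d *\<^sub>R fst (dev_field (q r))) (at t within {0..d})"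
      unfolding r_def by (rule has_vector_derivative_rescale) (rule unit)
    moreover have "inverse d *\<^sub>R fst (dev_field (q r)) = mean_deriv f (z (s + t), \<epsilon> *\<^sub>R y) y + g (x t) t T \<epsilon>"
      using d dur[OF r] Gg[OF xX T \<epsilon>] by (simp add: dev_field_def bd[unfolded qr] ga[unfolded qr] qr)
    ultimately have "((\<lambda>t. fst (q (0 + inverse d * t))) has_vector_derivative 
        mean_deriv f (z (s + t), \<epsilon> *\<^sub>R y) y + g (x t) t T \<epsilon>) (at t within {0..d})" by simp
    then have "((\<lambda>t. \<epsilon> *\<^sub>R fst (q (0 + inverse d * t))) has_vector_derivative
        \<epsilon> *\<^sub>R (mean_deriv f (z (s + t), \<epsilon> *\<^sub>R y) y + g (x t) t T \<epsilon>)) (at t within {0..d})"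
      by (rule bounded_linear.has_vector_derivative[OF bounded_linear_scaleR_right])
    moreover have "((\<lambda>t. z (s + t)) has_vector_derivative f (z (s + t))) (at t within {0..d})"
      using z_solves_shift[of "{0..d}" s] t by (simp add: solves_def)
    ultimately have "(x has_vector_derivative f (z (s + t)) + \<epsilon> *\<^sub>R (mean_deriv f (z (s + t), \<epsilon> *\<^sub>R y) y + g (x t) t T \<epsilon>)) (at t within {0..d})"
      unfolding x_def by (intro has_vector_derivative_add)
    moreover have "f (z (s + t)) + \<epsilon> *\<^sub>R (mean_deriv f (z (s + t), \<epsilon> *\<^sub>R y) y) = f (x t)"
      using mean_deriv_works[OF f inseg] unfolding xt by (simp add: blinfun.scaleR_right algebra_simps)
    ultimately show "x t \<in> X \<and> (x has_vector_derivative ?G t (x t)) (at t within {0..d})"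
      using xX by (simp add: scaleR_add_right add.assoc[symmetric])
  qed
  then have sol: "solves X ?G (closed_segment 0 d) x" by (simp add: seg)
  have XU: "open (X \<times> (UNIV::real set))" using X by (intro open_Times) auto
  have "C1 (X \<times> UNIV) (\<lambda>q. f (fst q) + \<epsilon> *\<^sub>R G ((fst q, T, \<epsilon>), snd q))"
    using SGX T \<epsilon> by (intro C1_intros C1_compose[OF f] C1_compose[OF G]) auto
  then have "C1 (X \<times> UNIV) (\<lambda>q. ?G (snd q) (fst q))"
    by (rule C1_cong[OF XU, rotated]) (use Gg T \<epsilon> in auto)
  from traj_eq[OF X this sol] have "traj X ?G (x 0) d = x d" .
  moreover have "x 0 = z s + \<epsilon> *\<^sub>R \<delta>" using q(2) by (simp add: x_def)
  moreover have "x d = z (s + d) + \<epsilon> *\<^sub>R dev_end (\<delta>, 0, s, \<sigma>, \<epsilon>)"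
    using d dev_end_eq[OF q(1)] q(2) by (simp add: x_def)
  ultimately show "pert_traj X f g d (z s + \<epsilon> *\<^sub>R \<delta>) (d / real l) \<epsilon> = z (s + d) + \<epsilon> *\<^sub>R dev_end (\<delta>, 0, s, \<sigma>, \<epsilon>)"
    by (simp add: pert_traj_def T_def)
qed

definition forcing0 :: "real \<Rightarrow> real \<Rightarrow> 'a" where
  "forcing0 s t = g (z (s + t)) t (\<omega> / real l) 0"

lemma forcing0_cont: "continuous_on S (forcing0 s)"
proof -
  have T: "\<omega> / real l > 0" using \<omega>_pos l by simp
  have "continuous_on S (\<lambda>t. G ((z (s + t), \<omega> / real l, 0), t))"
    using SGX[OF zX T] by (intro continuous_on_compose2[OF C1_continuous_on[OF G]] continuous_intros 
        continuous_on_compose2[OF z_cont[of UNIV]]) auto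
  then show ?thesis unfolding forcing0_def[abs_def] using Gg[OF zX T] by simp
qed

definition linear_dev :: "real \<Rightarrow> (real \<Rightarrow> 'a) \<Rightarrow> bool" where
  "linear_dev s y \<longleftrightarrow> (\<forall>r\<in>{0..1}. (y has_vector_derivative 
     \<omega> *\<^sub>R (blinderiv f (z (s + \<omega> * r)) (y r) + forcing0 s (\<omega> * r))) (at r within {0..1}))"

lemma linear_dev_exists: "\<exists>y. y 0 = \<delta> \<and> linear_dev s y"
proof -
  have cD: "continuous_on {0..1} (\<lambda>r. blinderiv f (z (s + \<omega> * r)))"
    by (intro continuous_on_compose2[OF Dfz_cont[of UNIV]] continuous_intros) auto
  then obtain K where K: "\<And>r. r \<in> {0..1} \<Longrightarrow> norm (blinderiv f (z (s + \<omega> * r))) \<le> K"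
    by (rule bounded_on_compact[OF _ compact_Icc]) (rule that; blast)
  show ?thesis unfolding linear_dev_def
  proof (rule lipschitz_ode_exists)
    show "continuous_on ({0..1} \<times> UNIV) (\<lambda>(r, y). \<omega> *\<^sub>R (blinderiv f (z (s + \<omega> * r)) y + forcing0 s (\<omega> * r)))"
      unfolding case_prod_beta
      by (intro continuous_intros continuous_on_compose2[OF cD] continuous_on_compose2[OF forcing0_cont[of UNIV]]) auto
    fix r x y assume r: "r \<in> {0..1::real}"
    have "norm (blinderiv f (z (s + \<omega> * r)) (x - y)) \<le> K * norm (x - y)"
      using K[OF r] by (meson mult_right_mono norm_blinfun norm_ge_zero order_trans)
    then have "\<omega> * norm (blinderiv f (z (s + \<omega> * r)) (x - y)) \<le> \<omega> * (K * norm (x - y))"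
      using \<omega>_pos by (intro mult_left_mono) auto
    moreover have "\<omega> *\<^sub>R (blinderiv f (z (s + \<omega> * r)) x + forcing0 s (\<omega> * r)) -
        \<omega> *\<^sub>R (blinderiv f (z (s + \<omega> * r)) y + forcing0 s (\<omega> * r)) = \<omega> *\<^sub>R blinderiv f (z (s + \<omega> * r)) (x - y)"
      by (simp add: blinfun.diff_right algebra_simps)
    ultimately show "norm (\<omega> *\<^sub>R (blinderiv f (z (s + \<omega> * r)) x + forcing0 s (\<omega> * r)) -
        \<omega> *\<^sub>R (blinderiv f (z (s + \<omega> * r)) y + forcing0 s (\<omega> * r))) \<le> (\<omega> * K) * norm (x - y)"
      using \<omega>_pos by simp
  qed
qed

lemma linear_dev_solves:
  assumes "linear_dev s y"
  shows "solves dev_domain (\<lambda>_. dev_field) {0..1} (\<lambda>r. (y r, \<omega> * r, s, \<sigma>, 0))"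
  unfolding solves_def
proof (intro ballI conjI)
  fix r :: real assume r: "r \<in> {0..1}"
  let ?q = "(y r, \<omega> * r, s, \<sigma>, 0::real)"
  have T: "\<omega> * inverse (real l) > 0" using \<omega>_pos l by simp
  have *: "base ?q = z (s + \<omega> * r)" "dev ?q = 0" "dur ?q = \<omega>" 
    by (simp_all add: base_def dev_def dur_def add.commute)
  then have ga: "garg ?q = ((z (s + \<omega> * r), \<omega> * inverse (real l), 0), \<omega> * r)" by (simp add: garg_def)
  show "?q \<in> dev_domain"
    using SGX[OF zX T, of 0] \<omega>_pos zX by (simp add: dev_domain_def * ga seg_domain_def)
  have "dev_field ?q = (\<omega> *\<^sub>R (blinderiv f (z (s + \<omega> * r)) (y r) + forcing0 s (\<omega> * r)), \<omega>, 0, 0, 0)"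
    using Gg[OF zX T, of 0] by (simp add: dev_field_def * ga mean_deriv_zero forcing0_def divide_inverse)
  moreover have "((\<lambda>r. \<omega> * r) has_vector_derivative \<omega>) (at r within {0..1})"
    by (auto intro!: derivative_eq_intros simp: has_real_derivative_iff_has_vector_derivative[symmetric])
  ultimately show "((\<lambda>r. (y r, \<omega> * r, s, \<sigma>, 0)) has_vector_derivative dev_field ?q) (at r within {0..1})"
    using assms r unfolding linear_dev_def by (auto intro!: has_vector_derivative_Pair)
qed

lemma dev_ok_zero: "(\<delta>, 0, s, \<sigma>, 0) \<in> dev_ok"
  and dev_end_zero: "linear_dev s y \<Longrightarrow> dev_end (y 0, 0, s, \<sigma>, 0) = y 1"
proof -
  obtain y where "y 0 = \<delta>" "linear_dev s y" using linear_dev_exists by blast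
  then show "(\<delta>, 0, s, \<sigma>, 0) \<in> dev_ok" 
    using linear_dev_solves[of s y \<sigma>] unfolding unit_domain_def by force
  show "dev_end (y 0, 0, s, \<sigma>, 0) = y 1" if "linear_dev s y" for y
    using dev_end_eq[OF linear_dev_solves[OF that, of \<sigma>]] by simp
qed

text \<open>The difference of two solutions of the inhomogeneous linear equation is a variation. At \<open>\<epsilon> = 0\<close>
  the duration is \<open>\<omega>\<close> whatever \<open>\<sigma>\<close> is.\<close>

lemma dev_end_affine: "dev_end (\<delta>, 0, s, \<sigma>, 0) = P s \<omega> \<delta> + dev_end (0, 0, s, 0, 0)"
proof -
  obtain y where y: "y 0 = \<delta>" "linear_dev s y" using linear_dev_exists by blast
  obtain w where w: "w 0 = 0" "linear_dev s w" using linear_dev_exists by blast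
  have "variation s \<omega> (\<lambda>r. y r - w r)" unfolding variation_def
  proof
    fix r :: real assume r: "r \<in> {0..1}"
    have "((\<lambda>r. y r - w r) has_vector_derivative 
        \<omega> *\<^sub>R (blinderiv f (z (s + \<omega> * r)) (y r) + forcing0 s (\<omega> * r)) -
        \<omega> *\<^sub>R (blinderiv f (z (s + \<omega> * r)) (w r) + forcing0 s (\<omega> * r))) (at r within {0..1})"
      using y w r by (intro has_vector_derivative_diff) (auto simp: linear_dev_def)
    then show "((\<lambda>r. y r - w r) has_vector_derivative \<omega> *\<^sub>R blinderiv f (z (s + \<omega> * r)) (y r - w r)) (at r within {0..1})"
      by (simp add: blinfun.diff_right algebra_simps)
  qed
  from P_variation[OF this] show ?thesis 
    using dev_end_zero[OF y(2), of \<sigma>] dev_end_zero[OF w(2), of 0] y w by simp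
qed

text \<open>Pairing the linear equation with \<open>grad H\<close>, which solves the adjoint equation, leaves only the
  forcing: this is the Melnikov integral.\<close>

lemma dev_end_melnikov:
  "a s \<bullet> (dev_end (\<delta>, 0, s, \<sigma>, 0) - \<delta>) = melnikov X f g H m l (z 0) \<tau> s"
proof -
  obtain y where y: "y 0 = \<delta>" "linear_dev s y" using linear_dev_exists by blast
  define i where "i = inverse \<omega>"
  have "\<omega> \<noteq> 0" using \<omega>_pos by linarith
  then have i: "\<omega> * i = 1" "i * \<omega> = 1" "i > 0" 
    unfolding i_def by (rule right_inverse, rule left_inverse, intro positive_imp_inverse_positive \<omega>_pos)
  define k where "k = (\<lambda>t. a (s + t) \<bullet> y (0 + i * t))"
  have "((\<lambda>t. a (s + t) \<bullet> forcing0 s t) has_integral k \<omega> - k 0) {0..\<omega>}"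
  proof (rule fundamental_theorem_of_calculus)
    fix t assume t: "t \<in> {0..\<omega>}"
    have unit: "0 + i * t \<in> {0..1}" if "t \<in> {0..\<omega>}" for t
      using that mult_left_mono[of t \<omega> i] i by auto
    define r where "r = 0 + i * t"
    have r: "r \<in> {0..1}" "\<omega> * r = t" using unit[OF t] i(1) by (auto simp: r_def mult.assoc[symmetric])
    have "(y has_vector_derivative \<omega> *\<^sub>R (blinderiv f (z (s + t)) (y r) + forcing0 s t)) (at r within {0..1})"
      using y(2) r unfolding linear_dev_def by fastforce
    from has_vector_derivative_rescale[OF this[unfolded r_def], of "{0..\<omega>}", OF unit]
    have dy: "((\<lambda>t. y (0 + i * t)) has_derivative (\<lambda>h. h *\<^sub>R (blinderiv f (z (s + t)) (y r) + forcing0 s t))) (at t within {0..\<omega>})"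
      using i by (simp add: r_def has_vector_derivative_def)
    define a' where "a' = - (\<Sum>b\<in>Basis. (a (s + t) \<bullet> blinderiv f (z (s + t)) b) *\<^sub>R b)"
    have "((\<lambda>t. a (s + 1 * t)) has_vector_derivative 1 *\<^sub>R a') (at t within {0..\<omega>})"
      by (rule has_vector_derivative_rescale[where S=UNIV]) (use a_deriv[of "s + t"] in \<open>auto simp: a'_def\<close>)
    then have da: "((\<lambda>t. a (s + t)) has_derivative (\<lambda>h. h *\<^sub>R a')) (at t within {0..\<omega>})"
      by (simp add: has_vector_derivative_def)
    have "a' \<bullet> y r = - (a (s + t) \<bullet> blinderiv f (z (s + t)) (y r))"
    proof -
      have "blinderiv f (z (s + t)) (y r) = blinderiv f (z (s + t)) (\<Sum>b\<in>Basis. (y r \<bullet> b) *\<^sub>R b)"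
        by (simp add: euclidean_representation)
      also have "\<dots> = (\<Sum>b\<in>Basis. (y r \<bullet> b) *\<^sub>R blinderiv f (z (s + t)) b)"
        by (simp add: blinfun.sum_right blinfun.scaleR_right)
      finally show ?thesis unfolding a'_def
        by (simp add: inner_sum_right inner_sum_left inner_commute mult.commute)
    qed
    then have "a (s + t) \<bullet> (h *\<^sub>R (blinderiv f (z (s + t)) (y r) + forcing0 s t)) + (h *\<^sub>R a') \<bullet> y r
        = h *\<^sub>R (a (s + t) \<bullet> forcing0 s t)" for h
      by (simp add: inner_add_right algebra_simps)
    then show "(k has_vector_derivative a (s + t) \<bullet> forcing0 s t) (at t within {0..\<omega>})"
      using has_derivative_inner[OF da dy] unfolding k_def has_vector_derivative_def by (simp add: r_def)
  qed (use \<omega>_pos in simp)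
  moreover have "k \<omega> - k 0 = a s \<bullet> (dev_end (\<delta>, 0, s, \<sigma>, 0) - \<delta>)"
    using i dev_end_zero[OF y(2), of \<sigma>] y(1) unfolding k_def
    by (simp add: a_def z_\<omega> inner_diff_right)
  moreover have "melnikov X f g H m l (z 0) \<tau> s = integral {0..\<omega>} (\<lambda>t. a (s + t) \<bullet> forcing0 s t)"
    unfolding melnikov_def forcing0_def a_def using flow_z[of _ 0] by (simp add: add.commute mult.commute)
  ultimately show ?thesis by (simp add: integral_unique)
qed

lemma dev_shift:
  assumes c: "\<And>t. z (t + c) = z t" and q: "solves dev_domain (\<lambda>_. dev_field) {0..1} q"
  shows "solves dev_domain (\<lambda>_. dev_field) {0..1} (\<lambda>r. q r + (0, 0, c, 0, 0))"
proof -
  let ?q = "\<lambda>q. q + (0, 0, c, 0, 0)"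
  have b: "base (?q q) = base q" for q
    using c[of "fst (snd q) + fst (snd (snd q))"] by (simp add: base_def add.assoc)
  have e: "dev (?q q) = dev q" "dur (?q q) = dur q" for q by (simp_all add: dev_def dur_def)
  have ga: "garg (?q q) = garg q" for q by (simp add: garg_def b e)
  have "?q q \<in> dev_domain \<longleftrightarrow> q \<in> dev_domain" "dev_field (?q q) = dev_field q" for q
    by (simp_all add: dev_domain_def dev_field_def b e ga)
  then show ?thesis using q unfolding solves_def by (auto intro!: derivative_eq_intros)
qed

lemma dev_period:
  "(\<delta>, 0, s + \<tau>, \<sigma>, \<epsilon>) \<in> dev_ok \<longleftrightarrow> (\<delta>, 0, s, \<sigma>, \<epsilon>) \<in> dev_ok"
  "(\<delta>, 0, s, \<sigma>, \<epsilon>) \<in> dev_ok \<Longrightarrow> dev_end (\<delta>, 0, s + \<tau>, \<sigma>, \<epsilon>) = dev_end (\<delta>, 0, s, \<sigma>, \<epsilon>)"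
proof -
  have *: "(\<delta>, 0, s + c, \<sigma>, \<epsilon>) \<in> dev_ok \<and> dev_end (\<delta>, 0, s + c, \<sigma>, \<epsilon>) = dev_end (\<delta>, 0, s, \<sigma>, \<epsilon>)"
    if q: "(\<delta>, 0, s, \<sigma>, \<epsilon>) \<in> dev_ok" and c: "\<And>t. z (t + c) = z t" for s c
  proof -
    obtain q where q: "solves dev_domain (\<lambda>_. dev_field) {0..1} q" "q 0 = (\<delta>, 0, s, \<sigma>, \<epsilon>)"
      using q by (auto simp: unit_domain_def)
    note q' = dev_shift[OF c q(1)]
    have "(\<delta>, 0, s + c, \<sigma>, \<epsilon>) \<in> dev_ok" unfolding unit_domain_def using q' q(2) by force
    moreover have "dev_end (q 0 + (0, 0, c, 0, 0)) = fst (q 1 + (0, 0, c, 0, 0))" by (rule dev_end_eq[OF q'])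
    ultimately show ?thesis using dev_end_eq[OF q(1)] q(2) by simp
  qed
  have "z (t + - \<tau>) = z t" for t using zper[of "t - \<tau>"] by simp
  then show "(\<delta>, 0, s + \<tau>, \<sigma>, \<epsilon>) \<in> dev_ok \<longleftrightarrow> (\<delta>, 0, s, \<sigma>, \<epsilon>) \<in> dev_ok"
    using *[of s \<tau>] *[of "s + \<tau>" "- \<tau>"] zper by auto
  show "(\<delta>, 0, s, \<sigma>, \<epsilon>) \<in> dev_ok \<Longrightarrow> dev_end (\<delta>, 0, s + \<tau>, \<sigma>, \<epsilon>) = dev_end (\<delta>, 0, s, \<sigma>, \<epsilon>)"
    using *[of s \<tau>] zper by blast
qed

end

section \<open>The bifurcation function\<close>

context perturbed_orbit
begin

definition e :: "real \<Rightarrow> 'a" where "e s = inverse (a s \<bullet> a s) *\<^sub>R a s"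

lemma e_C1: "C1 S e"
  unfolding e_def[abs_def] by (intro C1_scaleR C1_inverse C1_inner a_C1) (simp add: a_nz)

lemma a_e: "a s \<bullet> e s = 1"
  by (simp add: e_def a_nz)

lemma mean_deriv_z_C1: "C1 UNIV (mean_deriv z)"
proof -
  have "C1 UNIV (\<lambda>t. blinfun_scaleR_left (f (z t)))"
    by (rule C1_compose_linear[OF bounded_linear_blinfun_scaleR_left fz_C1])
  then have "C1 UNIV (blinderiv z)" by (simp add: blinderiv_z[abs_def])
  from mean_deriv_C1[OF open_UNIV this] show ?thesis by (simp add: seg_domain_def)
qed

text \<open>The defining equations divided by \<open>\<epsilon>\<close>, in the unknowns \<open>(\<delta>, \<sigma>, b)\<close>. The direction \<open>e(s)\<close>, multiplied by
  the new unknown \<open>b\<close>, fills the one-dimensional cokernel of the linearisation; a solution is genuine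
  exactly if \<open>b = 0\<close>.\<close>

definition state :: "real \<times> real \<times> 'a \<times> real \<times> real \<Rightarrow> 'a \<times> real \<times> real \<times> real \<times> real" where
  "state p = (fst (snd (snd p)), 0, fst p, fst (snd (snd (snd p))), fst (snd p))"

definition level_seg :: "real \<times> real \<times> 'a \<times> real \<times> real \<Rightarrow> ('a \<times> real) \<times> ('a \<times> real)" where
  "level_seg p = ((z (fst p), \<omega>), fst (snd p) *\<^sub>R (fst (snd (snd p)), fst (snd (snd (snd p)))))"

definition red_domain :: "(real \<times> real \<times> 'a \<times> real \<times> real) set" where
  "red_domain = {p. state p \<in> dev_ok \<and> level_seg p \<in> seg_domain W}"

definition red_eq :: "real \<times> real \<times> 'a \<times> real \<times> real \<Rightarrow> 'a \<times> real \<times> real" where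
  "red_eq p =
    (dev_end (state p) + fst (snd (snd (snd p))) *\<^sub>R mean_deriv z (fst p + \<omega>, fst (snd p) * fst (snd (snd (snd p)))) 1
        - fst (snd (snd p)) - snd (snd (snd (snd p))) *\<^sub>R e (fst p),
     mean_deriv \<Lambda> (level_seg p) (fst (snd (snd p)), fst (snd (snd (snd p)))),
     fst (snd (snd p)) \<bullet> f (z (fst p)))"

lemma state_C1: "C1 S state" unfolding state_def[abs_def] by (intro C1_intros)

lemma level_seg_C1: "C1 S level_seg" unfolding level_seg_def[abs_def]
  by (intro C1_Pair C1_scaleR C1_const C1_fst C1_snd C1_ident C1_compose[OF z_C1[of UNIV]]) auto

lemma open_red_domain: "open red_domain"
proof -
  have "open (state -` dev_ok)" by (intro open_vimage open_dev_ok C1_continuous_on state_C1)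
  moreover have "open (level_seg -` seg_domain W)"
    by (intro open_vimage open_seg_domain W C1_continuous_on level_seg_C1)
  ultimately have "open (state -` dev_ok \<inter> level_seg -` seg_domain W)" by (rule open_Int)
  moreover have "red_domain = state -` dev_ok \<inter> level_seg -` seg_domain W" by (auto simp: red_domain_def)
  ultimately show ?thesis by simp
qed

lemma red_eq_C1: "C1 red_domain red_eq"
proof -
  have "C1 red_domain (\<lambda>p. dev_end (state p))"
    by (rule C1_compose[OF dev_end_C1 state_C1]) (auto simp: red_domain_def)
  moreover have "C1 red_domain (\<lambda>p. mean_deriv \<Lambda> (level_seg p))"
    by (rule C1_compose[OF mean_deriv_C1[OF W \<Lambda>2] level_seg_C1]) (auto simp: red_domain_def)
  moreover have "C1 red_domain (\<lambda>p. mean_deriv z (fst p + \<omega>, fst (snd p) * fst (snd (snd (snd p)))))"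
    by (rule C1_compose[OF mean_deriv_z_C1]) (intro C1_intros, simp)
  moreover have "C1 red_domain (\<lambda>p. e (fst p))"
    by (rule C1_compose[OF e_C1[of UNIV]]) (intro C1_intros, simp)
  moreover have "C1 red_domain (\<lambda>p. f (z (fst p)))"
    by (rule C1_compose[OF fz_C1[of UNIV]]) (intro C1_intros, simp)
  ultimately show ?thesis unfolding red_eq_def[abs_def]
    by (intro C1_Pair C1_add C1_diff C1_scaleR C1_blinfun_apply C1_inner C1_fst C1_snd C1_ident C1_const)
qed

lemma red_zero: "(s, 0, v) \<in> red_domain"
proof -
  obtain \<delta> \<sigma> b where v: "v = (\<delta>, \<sigma>, b)" by (cases v)
  show ?thesis using dev_ok_zero zW 
    by (simp add: red_domain_def state_def level_seg_def v seg_domain_def zero_prod_def[symmetric])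
qed

lemma red_period:
  "(s + \<tau>, \<epsilon>, v) \<in> red_domain \<longleftrightarrow> (s, \<epsilon>, v) \<in> red_domain"
  "(s, \<epsilon>, v) \<in> red_domain \<Longrightarrow> red_eq (s + \<tau>, \<epsilon>, v) = red_eq (s, \<epsilon>, v)"
proof -
  obtain \<delta> \<sigma> b where v: "v = (\<delta>, \<sigma>, b)" by (cases v)
  show "(s + \<tau>, \<epsilon>, v) \<in> red_domain \<longleftrightarrow> (s, \<epsilon>, v) \<in> red_domain"
    by (simp add: red_domain_def state_def level_seg_def v dev_period(1) zper)
  have "mean_deriv z (s + \<tau> + \<omega>, c) = mean_deriv z (s + \<omega>, c)" for c
  proof -
    have "z (s + \<tau> + \<omega> + r) = z (s + \<omega> + r)" for r using zper[of "s + \<omega> + r"] by (simp add: algebra_simps)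
    then show ?thesis by (simp add: mean_deriv_def blinderiv_z)
  qed
  then show "(s, \<epsilon>, v) \<in> red_domain \<Longrightarrow> red_eq (s + \<tau>, \<epsilon>, v) = red_eq (s, \<epsilon>, v)"
    by (simp add: red_eq_def red_domain_def state_def level_seg_def v dev_period(2) zper a_per e_def)
qed

lemma red_eq_zero:
  "red_eq (s, 0, \<delta>, \<sigma>, b) = (dev_end (\<delta>, 0, s, \<sigma>, 0) + \<sigma> *\<^sub>R f (z s) - \<delta> - b *\<^sub>R e s,
     blinderiv \<Lambda> (z s, \<omega>) (\<delta>, \<sigma>), \<delta> \<bullet> f (z s))"
  by (simp add: red_eq_def state_def level_seg_def mean_deriv_zero zero_prod_def[symmetric] blinderiv_z z_\<omega>)

text \<open>Injectivity: pairing the first component with \<open>grad H\<close> annihilates all terms but \<open>b\<close>, and for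
  \<open>b = 0\<close> the claim is the nondegeneracy of the orbit.\<close>

lemma red_affine: "\<exists>A. linear A \<and> inj A \<and> (\<forall>v. red_eq (s, 0, v) = A v + red_eq (s, 0, 0))"
proof -
  define A where "A = (\<lambda>v. (P s \<omega> (fst v) + fst (snd v) *\<^sub>R f (z s) - fst v - snd (snd v) *\<^sub>R e s,
     blinderiv \<Lambda> (z s, \<omega>) (fst v, fst (snd v)), fst v \<bullet> f (z s)))"
  have "bounded_linear A" unfolding A_def
    by (intro bounded_linear_Pair bounded_linear_add bounded_linear_sub bounded_linear_compose[OF blinfun.bounded_linear_right]
        bounded_linear_fst bounded_linear_snd bounded_linear_compose[OF bounded_linear_fst bounded_linear_snd]
        bounded_linear_compose[OF bounded_linear_snd bounded_linear_snd]
        bounded_linear_compose[OF bounded_linear_scaleR_left] bounded_linear_compose[OF bounded_linear_inner_left])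
  then have lin: "linear A" by (rule bounded_linear.linear)
  have "v = 0" if "A v = 0" for v
  proof -
    obtain \<delta> \<sigma> b where v: "v = (\<delta>, \<sigma>, b)" by (cases v)
    have eq: "P s \<omega> \<delta> + \<sigma> *\<^sub>R f (z s) - \<delta> - b *\<^sub>R e s = 0" "blinderiv \<Lambda> (z s, \<omega>) (\<delta>, \<sigma>) = 0" "\<delta> \<bullet> f (z s) = 0"
      using that by (simp_all add: A_def v zero_prod_def)
    have "a s \<bullet> (P s \<omega> \<delta> + \<sigma> *\<^sub>R f (z s) - \<delta> - b *\<^sub>R e s) = - b"
      by (simp add: inner_add_right inner_diff_right a_P a_field a_e)
    then have b: "b = 0" using eq(1) by simp
    then have "\<delta> = 0 \<and> \<sigma> = 0" using nondeg[of s \<delta> \<sigma>] eq by (simp add: algebra_simps)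
    then show "v = 0" using b by (simp add: v zero_prod_def)
  qed
  then have "inj A" using linear_injective_0[OF lin] by blast
  moreover have "red_eq (s, 0, v) = A v + red_eq (s, 0, 0)" for v
  proof -
    obtain \<delta> \<sigma> b where v: "v = (\<delta>, \<sigma>, b)" by (cases v)
    have 0: "(0::'a \<times> real \<times> real) = (0, 0, 0)" by (simp add: zero_prod_def)
    have 1: "blinderiv \<Lambda> (z s, T) (0, 0) = 0" for T by (metis blinfun.zero_right zero_prod_def)
    show ?thesis unfolding v 0 red_eq_zero A_def 
      by (simp add: dev_end_affine[of \<delta> s \<sigma>] 1 algebra_simps)
  qed
  ultimately show ?thesis using lin by blast
qed

lemma red_melnikov:
  assumes "red_eq (s, 0, \<delta>, \<sigma>, b) = 0"
  shows "b = melnikov X f g H m l (z 0) \<tau> s"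
proof -
  have "dev_end (\<delta>, 0, s, \<sigma>, 0) + \<sigma> *\<^sub>R f (z s) - \<delta> - b *\<^sub>R e s = 0"
    using assms unfolding red_eq_zero by (simp add: zero_prod_def)
  then have "a s \<bullet> ((dev_end (\<delta>, 0, s, \<sigma>, 0) - \<delta>) + \<sigma> *\<^sub>R f (z s) - b *\<^sub>R e s) = 0"
    by (simp add: algebra_simps)
  then show ?thesis
    by (simp only: inner_add_right inner_diff_right[of "a s" _ "b *\<^sub>R e s"] dev_end_melnikov) 
      (simp add: a_field a_e)
qed

lemma red_displacement:
  assumes p: "(s, \<epsilon>, \<delta>, \<sigma>, 0) \<in> red_domain" and \<epsilon>: "\<epsilon> > 0" and \<Lambda>L: "\<And>\<xi> T. \<Lambda> (\<xi>, T) = L \<xi> T"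
    and orth: "\<delta> \<bullet> f (z s) = 0"
  shows "displacement X f g l L c0 (z s + \<epsilon> *\<^sub>R \<delta>) ((\<omega> + \<epsilon> * \<sigma>) / real l) \<epsilon> = 0 \<longleftrightarrow> red_eq (s, \<epsilon>, \<delta>, \<sigma>, 0) = 0"
proof -
  let ?d = "\<omega> + \<epsilon> * \<sigma>"
  have ok: "(\<delta>, 0, s, \<sigma>, \<epsilon>) \<in> dev_ok" and seg: "((z s, \<omega>), \<epsilon> *\<^sub>R (\<delta>, \<sigma>)) \<in> seg_domain W"
    using p by (simp_all add: red_domain_def state_def level_seg_def)
  have tr: "pert_traj X f g ?d (z s + \<epsilon> *\<^sub>R \<delta>) (?d / real l) \<epsilon> = z (s + ?d) + \<epsilon> *\<^sub>R dev_end (\<delta>, 0, s, \<sigma>, \<epsilon>)"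
    using pert_traj_dev[OF ok] \<epsilon> by simp
  have zd: "z (s + ?d) - z s = \<epsilon> *\<^sub>R \<sigma> *\<^sub>R mean_deriv z (s + \<omega>, \<epsilon> * \<sigma>) 1"
  proof -
    have "(s + \<omega>, \<epsilon> * \<sigma>) \<in> seg_domain UNIV" by (simp add: seg_domain_def)
    from mean_deriv_works[OF z_C1 this] have "z (s + \<omega> + \<epsilon> * \<sigma>) - z (s + \<omega>) = mean_deriv z (s + \<omega>, \<epsilon> * \<sigma>) (\<epsilon> * \<sigma>)" .
    moreover have "mean_deriv z (s + \<omega>, \<epsilon> * \<sigma>) ((\<epsilon> * \<sigma>) *\<^sub>R 1) = (\<epsilon> * \<sigma>) *\<^sub>R mean_deriv z (s + \<omega>, \<epsilon> * \<sigma>) 1"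
      by (rule blinfun.scaleR_right)
    ultimately show ?thesis by (simp add: z_\<omega> add.assoc)
  qed
  have Ld: "\<Lambda> (z s + \<epsilon> *\<^sub>R \<delta>, ?d) - c0 = \<epsilon> *\<^sub>R mean_deriv \<Lambda> ((z s, \<omega>), \<epsilon> *\<^sub>R (\<delta>, \<sigma>)) (\<delta>, \<sigma>)"
  proof -
    have "mean_deriv \<Lambda> ((z s, \<omega>), \<epsilon> *\<^sub>R (\<delta>, \<sigma>)) (\<epsilon> *\<^sub>R (\<delta>, \<sigma>)) =
        \<epsilon> *\<^sub>R mean_deriv \<Lambda> ((z s, \<omega>), \<epsilon> *\<^sub>R (\<delta>, \<sigma>)) (\<delta>, \<sigma>)" by (rule blinfun.scaleR_right)
    then show ?thesis using mean_deriv_works[OF \<Lambda> seg] by (simp add: \<Lambda>z)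
  qed
  have "pert_traj X f g ?d (z s + \<epsilon> *\<^sub>R \<delta>) (?d / real l) \<epsilon> - (z s + \<epsilon> *\<^sub>R \<delta>) = \<epsilon> *\<^sub>R 
     (dev_end (\<delta>, 0, s, \<sigma>, \<epsilon>) + \<sigma> *\<^sub>R mean_deriv z (s + \<omega>, \<epsilon> * \<sigma>) 1 - \<delta>)"
    using zd unfolding tr by (simp add: algebra_simps)
  then show ?thesis
    using \<epsilon> l Ld orth by (simp add: displacement_def red_eq_def state_def level_seg_def zero_prod_def \<Lambda>L)
qed

theorem bifurcation:
  assumes \<Lambda>L: "\<And>\<xi> T. \<Lambda> (\<xi>, T) = L \<xi> T" and c0: "c0 = L (z 0) \<omega>"
  shows "\<exists>B. bifurcation_function X f g m l (z 0) \<tau> L (melnikov X f g H m l (z 0) \<tau>) B"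
proof -
  let ?M = "melnikov X f g H m l (z 0) \<tau>"
  obtain \<epsilon>1 R0 C w where \<epsilon>1: "\<epsilon>1 > 0" and wC1: "C1 (UNIV \<times> {-\<epsilon>1<..<\<epsilon>1}) (\<lambda>(s, \<epsilon>). w s \<epsilon>)"
    and w: "\<And>s \<epsilon>. \<bar>\<epsilon>\<bar> < \<epsilon>1 \<Longrightarrow> (s, \<epsilon>, w s \<epsilon>) \<in> red_domain \<and> red_eq (s, \<epsilon>, w s \<epsilon>) = 0 \<and> norm (w s \<epsilon>) \<le> R0 \<and>
        w (s + \<tau>) \<epsilon> = w s \<epsilon> \<and> norm (w s \<epsilon> - w s 0) \<le> C * \<bar>\<epsilon>\<bar>"
    and wR: "\<And>R. \<exists>\<epsilon>0>0. \<epsilon>0 \<le> \<epsilon>1 \<and> (\<forall>s \<epsilon> v. \<bar>\<epsilon>\<bar> < \<epsilon>0 \<longrightarrow> norm v \<le> R \<longrightarrow>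
        (s, \<epsilon>, v) \<in> red_domain \<and> (red_eq (s, \<epsilon>, v) = 0 \<longrightarrow> v = w s \<epsilon>))"
    by (rule affine_perturbation_zeros[OF open_red_domain red_eq_C1 red_zero \<tau> red_period red_affine],
      assumption, rule that)
  define B where "B = (\<lambda>s \<epsilon>. snd (snd (w s \<epsilon>)))"
  have BM: "B s 0 = ?M s" for s
  proof -
    obtain \<delta> \<sigma> b where v: "w s 0 = (\<delta>, \<sigma>, b)" by (cases "w s 0")
    show ?thesis using red_melnikov[of s \<delta> \<sigma> b] w[of 0 s] \<epsilon>1 by (simp add: B_def v)
  qed
  have cond1: "Ck_on 1 (UNIV \<times> {0..<\<epsilon>1}) (\<lambda>(s, \<epsilon>). B s \<epsilon>)"
    unfolding Ck_on_def
  proof (intro exI conjI)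
    show "open (UNIV \<times> {-\<epsilon>1<..<\<epsilon>1} :: (real \<times> real) set)" by (intro open_Times) auto
    have "C1 (UNIV \<times> {-\<epsilon>1<..<\<epsilon>1}) (\<lambda>q. snd (snd ((\<lambda>(s, \<epsilon>). w s \<epsilon>) q)))"
      by (intro C1_snd wC1)
    then have "C1 (UNIV \<times> {-\<epsilon>1<..<\<epsilon>1}) (\<lambda>(s, \<epsilon>). B s \<epsilon>)"
      by (simp add: B_def case_prod_unfold)
    then show "Ck_open 1 (UNIV \<times> {-\<epsilon>1<..<\<epsilon>1}) (\<lambda>(s, \<epsilon>). B s \<epsilon>)" by (rule C1_Ck_open)
  qed (use \<epsilon>1 in auto)
  have cond2: "B (s + \<tau>) \<epsilon> = B s \<epsilon>" if "\<epsilon> \<in> {0..<\<epsilon>1}" for s \<epsilon>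
    using w[of \<epsilon> s] that by (simp add: B_def)
  have cond3: "\<bar>B s \<epsilon> - ?M s\<bar> \<le> C * \<epsilon>" if "\<epsilon> \<in> {0..<\<epsilon>1}" for s \<epsilon>
  proof -
    have "\<bar>B s \<epsilon> - ?M s\<bar> = norm (snd (snd (w s \<epsilon> - w s 0)))" by (simp add: B_def BM[symmetric])
    also have "\<dots> \<le> norm (w s \<epsilon> - w s 0)" by (meson norm_fst_snd_le order_trans)
    also have "\<dots> \<le> C * \<epsilon>" using w[of \<epsilon> s] that by simp
    finally show ?thesis .
  qed
  have pf: "pert_form X f m l (z 0) \<tau> R \<epsilon> s \<xi> T \<longleftrightarrow> (\<exists>\<delta> \<sigma>. norm \<delta> \<le> R \<and> \<bar>\<sigma>\<bar> \<le> R \<and> \<delta> \<bullet> f (z s) = 0 \<and>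
       \<xi> = z s + \<epsilon> *\<^sub>R \<delta> \<and> T = (\<omega> + \<epsilon> * \<sigma>) / real l)" for R \<epsilon> s \<xi> T
    by (simp add: pert_form_def flow_z)
  have cond4: "\<exists>\<epsilon>0>0. \<epsilon>0 \<le> \<epsilon>1 \<and> (\<forall>\<epsilon>. 0 < \<epsilon> \<and> \<epsilon> < \<epsilon>0 \<longrightarrow>
           (\<exists>h. bij_betw h (pert_solutions X f g m l (z 0) \<tau> L R \<epsilon>) {s\<in>{0..<\<tau>}. B s \<epsilon> = 0} \<and>
              (\<forall>(\<xi>, T)\<in>pert_solutions X f g m l (z 0) \<tau> L R \<epsilon>. \<forall>s\<in>{0..<\<tau>}.
                 pert_form X f m l (z 0) \<tau> R \<epsilon> s \<xi> T \<longleftrightarrow> s = h (\<xi>, T))))" if R: "R \<ge> R0" for R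
  proof -
    \<comment> \<open>\<open>|\<delta>| \<le> R\<close> and \<open>|\<sigma>| \<le> R\<close> give \<open>|(\<delta>, \<sigma>, 0)| \<le> 2 R\<close>\<close>
    obtain d1 where d1: "d1 > 0" "d1 \<le> \<epsilon>1" and d1D: "\<And>s \<epsilon> v. \<bar>\<epsilon>\<bar> < d1 \<Longrightarrow> norm v \<le> 2 * R \<Longrightarrow>
        (s, \<epsilon>, v) \<in> red_domain \<and> (red_eq (s, \<epsilon>, v) = 0 \<longrightarrow> v = w s \<epsilon>)"
      using wR[of "2 * R"] by blast
    obtain d2 where d2: "d2 > 0" and tub: "\<And>\<epsilon> s s' \<delta> \<delta>'. 0 < \<epsilon> \<Longrightarrow> \<epsilon> < d2 \<Longrightarrow> s \<in> {0..<\<tau>} \<Longrightarrow> s' \<in> {0..<\<tau>} \<Longrightarrow> 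
        norm \<delta> \<le> R \<Longrightarrow> norm \<delta>' \<le> R \<Longrightarrow> \<delta> \<bullet> f (z s) = 0 \<Longrightarrow> \<delta>' \<bullet> f (z s') = 0 \<Longrightarrow> 
        z s + \<epsilon> *\<^sub>R \<delta> = z s' + \<epsilon> *\<^sub>R \<delta>' \<Longrightarrow> s = s'"
      using tubular_injective[of R] by blast
    show ?thesis
    proof (intro exI[of _ "min d1 d2"] conjI allI impI)
      fix \<epsilon> assume \<epsilon>: "0 < \<epsilon> \<and> \<epsilon> < min d1 d2"
      then have e1: "\<bar>\<epsilon>\<bar> < d1" "\<bar>\<epsilon>\<bar> < \<epsilon>1" "\<epsilon> > 0" "\<epsilon> < d2" using d1 by auto
      let ?S = "pert_solutions X f g m l (z 0) \<tau> L R \<epsilon>"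
      let ?Z = "{s\<in>{0..<\<tau>}. B s \<epsilon> = 0}"
      let ?pf = "\<lambda>s q. pert_form X f m l (z 0) \<tau> R \<epsilon> s (fst q) (snd q)"
      have S: "q \<in> ?S \<longleftrightarrow> displacement X f g l L c0 (fst q) (snd q) \<epsilon> = 0 \<and> (\<exists>s. ?pf s q)" for q
        by (cases q) (simp add: pert_solutions_def c0)
      have f1: "\<exists>\<delta> \<sigma>. w s \<epsilon> = (\<delta>, \<sigma>, 0) \<and> q = (z s + \<epsilon> *\<^sub>R \<delta>, (\<omega> + \<epsilon> * \<sigma>) / real l)"
        if q: "q \<in> ?S" and s: "?pf s q" for q s
      proof -
        obtain \<delta> \<sigma> where n: "norm \<delta> \<le> R" "\<bar>\<sigma>\<bar> \<le> R" and o: "\<delta> \<bullet> f (z s) = 0"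
          and qe: "fst q = z s + \<epsilon> *\<^sub>R \<delta>" "snd q = (\<omega> + \<epsilon> * \<sigma>) / real l"
          using s unfolding pf by blast
        have "norm (\<delta>, \<sigma>, 0::real) \<le> norm \<delta> + norm (\<sigma>, 0::real)" by (rule norm_Pair_le)
        then have "norm (\<delta>, \<sigma>, 0::real) \<le> 2 * R" using n by (simp add: norm_Pair)
        note v = d1D[OF e1(1) this, of s]
        have "displacement X f g l L c0 (z s + \<epsilon> *\<^sub>R \<delta>) ((\<omega> + \<epsilon> * \<sigma>) / real l) \<epsilon> = 0"
          using q qe unfolding S by simp
        then have "red_eq (s, \<epsilon>, \<delta>, \<sigma>, 0) = 0"
          using red_displacement[OF conjunct1[OF v] e1(3) \<Lambda>L o] by simp
        then have "w s \<epsilon> = (\<delta>, \<sigma>, 0)" using v by simp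
        then show ?thesis using qe by (metis prod.collapse)
      qed
      have f2: "\<exists>q\<in>?S. ?pf s q" if s: "B s \<epsilon> = 0" for s
      proof -
        obtain \<delta> \<sigma> where v: "w s \<epsilon> = (\<delta>, \<sigma>, 0)" using s unfolding B_def by (metis prod.collapse)
        define q where "q = (z s + \<epsilon> *\<^sub>R \<delta>, (\<omega> + \<epsilon> * \<sigma>) / real l)"
        have "norm (\<delta>, \<sigma>, 0::real) \<le> R" using w[OF e1(2), of s] R v by simp
        moreover have "norm \<delta> \<le> norm (\<delta>, \<sigma>, 0::real)" using norm_fst_snd_le(1)[of "(\<delta>, \<sigma>, 0::real)"] by simp
        moreover have "\<bar>\<sigma>\<bar> \<le> norm (\<delta>, \<sigma>, 0::real)" 
          using norm_fst_snd_le(2)[of "(\<delta>, \<sigma>, 0::real)"] norm_fst_snd_le(1)[of "(\<sigma>, 0::real)"] by simp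
        moreover have red: "(s, \<epsilon>, \<delta>, \<sigma>, 0) \<in> red_domain" "red_eq (s, \<epsilon>, \<delta>, \<sigma>, 0) = 0"
          using w[OF e1(2), of s] v by simp_all
        moreover have o: "\<delta> \<bullet> f (z s) = 0" using red(2) by (simp add: red_eq_def zero_prod_def)
        ultimately have "?pf s q" unfolding pf q_def by force
        moreover have "q \<in> ?S" unfolding S 
          using red_displacement[OF red(1) e1(3) \<Lambda>L o] red(2) calculation by (auto simp: q_def)
        ultimately show ?thesis by blast
      qed
      have f3: "\<exists>s\<in>{0..<\<tau>}. ?pf s q" if q: "q \<in> ?S" for q
      proof -
        obtain s where s: "?pf s q" using q unfolding S by blast
        obtain s' k where "s' \<in> {0..<\<tau>}" "s = s' + of_int k * \<tau>" using reduce_period[OF \<tau>] by blast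
        then have "z s = z s'" by (simp add: z_per_int)
        then have "?pf s' q" using s unfolding pf by simp
        then show ?thesis using \<open>s' \<in> {0..<\<tau>}\<close> by blast
      qed
      have f4: "s = s'" if "s \<in> {0..<\<tau>}" "s' \<in> {0..<\<tau>}" "?pf s q" "?pf s' q" for s s' q
        using that(3,4) unfolding pf using tub[OF e1(3,4) that(1,2)] by force
      define h where "h = (\<lambda>q. THE s. s \<in> {0..<\<tau>} \<and> ?pf s q)"
      have h: "h q \<in> {0..<\<tau>}" "?pf (h q) q" if q: "q \<in> ?S" for q
      proof -
        have "\<exists>!s. s \<in> {0..<\<tau>} \<and> ?pf s q" using f3[OF q] f4 by blast
        from theI'[OF this] show "h q \<in> {0..<\<tau>}" "?pf (h q) q" by (auto simp: h_def)
      qed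
      have h_eq: "?pf s q \<longleftrightarrow> s = h q" if "q \<in> ?S" "s \<in> {0..<\<tau>}" for s q
        using f4[OF that(2) h(1)[OF that(1)], of q] h[OF that(1)] by blast
      have "bij_betw h ?S ?Z" unfolding bij_betw_def
      proof
        show "inj_on h ?S"
        proof (rule inj_onI)
          fix q q' assume q: "q \<in> ?S" "q' \<in> ?S" "h q = h q'"
          show "q = q'" using f1[OF q(1) h(2)[OF q(1)]] f1[OF q(2) h(2)[OF q(2)]] q(3) by auto
        qed
        show "h ` ?S = ?Z"
        proof (intro subset_antisym subsetI)
          fix s assume "s \<in> h ` ?S"
          then obtain q where q: "q \<in> ?S" "s = h q" by blast
          then have "B s \<epsilon> = 0" using f1[OF q(1) h(2)[OF q(1)]] by (auto simp: B_def)
          then show "s \<in> ?Z" using h(1)[OF q(1)] q(2) by simp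
        next
          fix s assume s: "s \<in> ?Z"
          then obtain q where "q \<in> ?S" "?pf s q" using f2 by blast
          then show "s \<in> h ` ?S" using h_eq[of q s] s by blast
        qed
      qed
      moreover have "\<forall>(\<xi>, T)\<in>?S. \<forall>s\<in>{0..<\<tau>}. pert_form X f m l (z 0) \<tau> R \<epsilon> s \<xi> T \<longleftrightarrow> s = h (\<xi>, T)"
        using h_eq by fastforce
      ultimately show "\<exists>h. bij_betw h ?S ?Z \<and> (\<forall>(\<xi>, T)\<in>?S. \<forall>s\<in>{0..<\<tau>}. 
          pert_form X f m l (z 0) \<tau> R \<epsilon> s \<xi> T \<longleftrightarrow> s = h (\<xi>, T))" by blast
    qed (use d1 d2 in auto)
  qed
  have "bifurcation_function X f g m l (z 0) \<tau> L ?M B"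
    unfolding bifurcation_function_def
  proof (rule exI[of _ \<epsilon>1], intro conjI \<epsilon>1 cond1)
    show "\<forall>s. \<forall>\<epsilon>\<in>{0..<\<epsilon>1}. B (s + \<tau>) \<epsilon> = B s \<epsilon>" using cond2 by blast
    show "\<exists>C. \<forall>s. \<forall>\<epsilon>\<in>{0..<\<epsilon>1}. \<bar>B s \<epsilon> - ?M s\<bar> \<le> C * \<epsilon>" using cond3 by blast
  qed (use cond4 in blast)
  then show ?thesis by blast
qed

end

section \<open>From the hypotheses on \<open>f\<close>, \<open>g\<close> and \<open>L\<close> to the reduction\<close>

lemma Ck_on_C2_extension:
  assumes "Ck_on r S h" "2 \<le> r"
  obtains S' h' where "open S'" "S \<subseteq> S'" "\<And>x. x \<in> S \<Longrightarrow> h' x = h x" "C1 S' h'" "C1 S' (blinderiv h')"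
proof -
  obtain S' h' where S': "open S'" "S \<subseteq> S'" "\<And>x. x \<in> S \<Longrightarrow> h' x = h x" "Ck_open r S' h'"
    using assms unfolding Ck_on_def by blast
  obtain k where "r = Suc (Suc k)" using le_Suc_ex[OF assms(2)] by auto
  then have k: "Ck_open (Suc (Suc k)) S' h'" using S'(4) by simp
  show ?thesis by (rule that[OF S'(1-3) Ck_open_C1[OF k] Ck_open_C2[OF S'(1) k]])
qed

lemma Ck_on_C2:
  assumes "Ck_on r S h" "2 \<le> r" "open S"
  shows "C1 S h" and "C1 S (blinderiv h)"
proof -
  obtain S' h' where S': "open S'" "S \<subseteq> S'" "\<And>x. x \<in> S \<Longrightarrow> h' x = h x" "C1 S' h'" "C1 S' (blinderiv h')"
    using Ck_on_C2_extension[OF assms(1,2)] by blast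
  have 1: "C1 S h'" "C1 S (blinderiv h')" using S' C1_subset by blast+
  show "C1 S h" by (rule C1_cong[OF assms(3) S'(3) 1(1)])
  have "blinderiv h' x = blinderiv h x" if "x \<in> S" for x
    using blinderiv_cong[OF assms(3) that S'(3)] 1(1) that by (auto simp: C1_def)
  then show "C1 S (blinderiv h)" by (rule C1_cong[OF assms(3) _ 1(2)])
qed

lemma Ck_on_differentiable:
  assumes "Ck_on r S h" "0 < r" "open S" "x \<in> S"
  shows "h differentiable (at x)"
proof -
  obtain S' h' where S': "open S'" "S \<subseteq> S'" "\<And>x. x \<in> S \<Longrightarrow> h' x = h x" "Ck_open r S' h'"
    using assms unfolding Ck_on_def by blast
  obtain k where "r = Suc k" using assms(2) gr0_conv_Suc by blast
  then have "h' differentiable (at x)" using S'(2,4) assms(4) by auto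
  then have "(h' has_derivative frechet_derivative h' (at x)) (at x)" by (rule frechet_derivative_works[THEN iffD1])
  then have "(h has_derivative frechet_derivative h' (at x)) (at x)"
    by (rule has_derivative_transform_within_open[OF _ assms(3,4)]) (rule S'(3))
  then show ?thesis by (auto simp: differentiable_def)
qed

lemma periodic_min_solution:
  fixes f :: "'a::euclidean_space \<Rightarrow> 'a"
  assumes "periodic_min X f p \<tau>" "open X" "C1 X f"
  obtains z where "minimal_periodic_orbit X f z \<tau>" "z 0 = p" "\<And>t. flow0 X f t p = z t"
proof -
  obtain z where z: "solves X (\<lambda>_. f) UNIV z" "z 0 = p" "\<forall>t. z (t + \<tau>) = z t" "0 < \<tau>"
    "\<forall>\<sigma>. 0 < \<sigma> \<and> \<sigma> < \<tau> \<longrightarrow> \<not> (\<forall>t. z (t + \<sigma>) = z t)"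
    using assms(1) unfolding periodic_min_def by blast
  have "minimal_periodic_orbit X f z \<tau>" using z assms by unfold_locales auto
  moreover have "flow0 X f t p = z t" for t using flow0_eq[OF assms(2,3) z(1), of 0 t] z(2) by simp
  ultimately show ?thesis using that z(2) by blast
qed

text \<open>Of the mechanical structure only a first integral enters whose gradient does not vanish off the
  equilibria.\<close>

theorem bifurcation_function_exists:
  fixes X :: "'a::euclidean_space set"
  assumes X: "open X" and f: "Ck_on r X f" and r: "2 \<le> r"
    and g: "Ck_fst_on r ((X \<times> {0<..} \<times> {0..}) \<times> UNIV) (\<lambda>((x, T, \<epsilon>), t). g x t T \<epsilon>)"
    and H: "\<And>x. x \<in> X \<Longrightarrow> GDERIV H x :> grad H x" and Hf: "\<And>x. x \<in> X \<Longrightarrow> grad H x \<bullet> f x = 0"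
    and Hnz: "\<And>x. x \<in> X \<Longrightarrow> f x \<noteq> 0 \<Longrightarrow> grad H x \<noteq> 0"
    and m: "0 < m" and l: "0 < l" and p: "periodic_min X f p \<tau>" and L: "parametrises X f r m p \<tau> L"
  shows "\<exists>B. bifurcation_function X f g m l p \<tau> L (melnikov X f g H m l p \<tau>) B"
proof -
  note fC = Ck_on_C2[OF f r X]
  obtain z where z: "minimal_periodic_orbit X f z \<tau>" "z 0 = p" and fl: "\<And>t. flow0 X f t p = z t"
    using periodic_min_solution[OF p X fC(1)] by blast
  interpret minimal_periodic_orbit X f z \<tau> by (rule z(1))
  have orb: "orbit X f p = range z" unfolding orbit_def fl ..
  obtain SG G where SG: "open SG" "(X \<times> {0<..} \<times> {0..}) \<times> UNIV \<subseteq> SG"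
    and Gg: "\<And>q. q \<in> (X \<times> {0<..} \<times> {0..}) \<times> UNIV \<Longrightarrow> G q = (\<lambda>((x, T, \<epsilon>), t). g x t T \<epsilon>) q"
    and G: "Ck_open (r - 1) SG G"
    using g unfolding Ck_fst_on_def by blast
  obtain k where "r - 1 = Suc k" using r by (metis Suc_1 Suc_diff_le Suc_le_D Suc_le_mono diff_Suc_1 le_add_diff_inverse plus_1_eq_Suc)
  then have GC1: "C1 SG G" using G Ck_open_C1 by metis
  define \<Lambda> where "\<Lambda> = (\<lambda>(\<xi>, T). L \<xi> T)"
  define c0 where "c0 = L p (real m * \<tau>)"
  obtain W where W: "open W" "orbit X f p \<times> {real m * \<tau>} \<subseteq> W" "Ck_on r W \<Lambda>"
    using L unfolding parametrises_def \<Lambda>_def by blast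
  note LC = Ck_on_C2[OF W(3) r W(1)]
  have zW: "(z s, real m * \<tau>) \<in> W" for s using W(2) orb by auto
  obtain \<C> \<theta> T where \<C>: "open \<C>" "c0 \<in> \<C>" and \<theta>C: "Ck_on r \<C> \<theta>" and TC: "Ck_on r \<C> T"
    and \<theta>0: "\<theta> c0 \<in> orbit X f p" and T0: "T c0 = \<tau>"
    and fam: "\<And>c. c \<in> \<C> \<Longrightarrow> periodic_min X f (\<theta> c) (T c) \<and> m_normal X f m (\<theta> c) (T c) \<and>
           (\<forall>t. L (flow0 X f t (\<theta> c)) (real m * T c) = c)"
    using L unfolding parametrises_def c0_def by blast
  have r0: "0 < r" using r by simp
  have evC: "\<forall>\<^sub>F c in nhds c0. c \<in> \<C>" using \<C> by (rule eventually_nhds_in_open)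
  obtain s0 where s0: "\<theta> c0 = z s0" using \<theta>0 orb by auto
  obtain \<theta>' where d\<theta>: "(\<theta> has_vector_derivative \<theta>') (at c0)"
    using Ck_on_differentiable[OF \<theta>C r0 \<C>] vector_derivative_works by blast
  obtain T' where dT: "(T has_real_derivative T') (at c0)"
    using Ck_on_differentiable[OF TC r0 \<C>] real_differentiable_def by blast
  have \<Lambda>z: "\<Lambda> (z s, real m * \<tau>) = c0" for s
    using fam[OF \<C>(2), THEN conjunct2, THEN conjunct2, rule_format, of "s - s0"] flow_z[of "s - s0" s0]
    by (simp add: s0 T0 \<Lambda>_def)
  have closed: "\<forall>\<^sub>F c in nhds c0. flow0 X f (real m * T c) (\<theta> c) = \<theta> c"
  proof (rule eventually_mono[OF evC])
    fix c assume "c \<in> \<C>"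
    then obtain x where x: "minimal_periodic_orbit X f x (T c)" "x 0 = \<theta> c" "\<And>t. flow0 X f t (\<theta> c) = x t"
      using periodic_min_solution[OF _ X fC(1)] fam by blast
    interpret c: minimal_periodic_orbit X f x "T c" by (rule x(1))
    show "flow0 X f (real m * T c) (\<theta> c) = \<theta> c" using c.z_per[of 0 m] x by simp
  qed
  have LT: "\<forall>\<^sub>F c in nhds c0. \<Lambda> (flow0 X f t (\<theta> c), real m * T c) = c" for t
    by (rule eventually_mono[OF evC]) (use fam in \<open>simp add: \<Lambda>_def\<close>)
  have mn: "m_normal X f m (z s0) \<tau>" using fam[OF \<C>(2)] by (simp add: s0 T0)
  interpret perturbed_orbit X f z \<tau> g H m l G SG \<Lambda> W c0
  proof unfold_locales
    show "((x, T, \<epsilon>), t) \<in> SG" "G ((x, T, \<epsilon>), t) = g x t T \<epsilon>" if "x \<in> X" "T > 0" "\<epsilon> \<ge> 0" for x T \<epsilon> t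
      using that SG(2) Gg[of "((x, T, \<epsilon>), t)"] by auto
    show "\<delta> = 0 \<and> \<sigma> = 0" if "P s (real m * \<tau>) \<delta> - \<delta> + \<sigma> *\<^sub>R f (z s) = 0"
      "blinderiv \<Lambda> (z s, real m * \<tau>) (\<delta>, \<sigma>) = 0" "\<delta> \<bullet> f (z s) = 0" for s \<delta> \<sigma>
      by (rule nondegenerate[OF mn d\<theta> s0 dT T0 closed C1_has_derivative[OF LC(1) zW] LT \<Lambda>z field_nonzero that])
  qed (fact fC SG GC1 H Hf Hnz m l W LC zW \<Lambda>z)+
  show ?thesis
    using bifurcation[of L] z(2) by (simp add: \<Lambda>_def c0_def)
qed

section \<open>The energy of the mechanical system\<close>

lemma GDERIV_unique:
  assumes "GDERIV \<phi> x :> d" "GDERIV \<phi> x :> d'"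
  shows "d = d'"
proof -
  have "(\<lambda>h. h \<bullet> d) = (\<lambda>h. h \<bullet> d')" using assms has_derivative_unique unfolding gderiv_def by blast
  then have "\<forall>h. h \<bullet> d = h \<bullet> d'" by meson
  then show ?thesis using vector_eq_ldot by blast
qed

lemma GDERIV_grad:
  fixes \<phi> :: "'a::euclidean_space \<Rightarrow> real"
  assumes d: "(\<phi> has_derivative D) (at x)"
  shows "GDERIV \<phi> x :> grad \<phi> x" and "grad \<phi> x \<bullet> v = D v"
proof -
  have lin: "linear D" using d has_derivative_linear by blast
  define S where "S = (\<Sum>b\<in>Basis. D b *\<^sub>R b)"
  have D: "D v = v \<bullet> S" for v
  proof -
    have "D v = D (\<Sum>b\<in>Basis. (v \<bullet> b) *\<^sub>R b)" by (simp add: euclidean_representation)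
    also have "\<dots> = (\<Sum>b\<in>Basis. (v \<bullet> b) * D b)" by (simp add: linear_sum[OF lin] linear_cmul[OF lin])
    finally show ?thesis by (simp add: S_def inner_sum_right mult.commute)
  qed
  then have "D = (\<lambda>v. v \<bullet> S)" by blast
  then have g: "GDERIV \<phi> x :> S" using d unfolding gderiv_def by simp
  then have e: "grad \<phi> x = S" unfolding grad_def by (rule the_equality) (rule GDERIV_unique[OF _ g])
  show "GDERIV \<phi> x :> grad \<phi> x" using g e by simp
  show "grad \<phi> x \<bullet> v = D v" using D e by (simp add: inner_commute)
qed

lemma bounded_bilinear_matrix_vector:
  "bounded_bilinear (\<lambda>(A::real^'n^'m) (x::real^'n). A *v x)"
  unfolding bilinear_conv_bounded_bilinear[symmetric] bilinear_def
  by (auto intro!: linearI simp: matrix_vector_right_distrib matrix_vector_mult_add_rdistrib 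
      scaleR_matrix_vector_assoc matrix_vector_mult_scaleR)

lemma matrix_inv_right:
  fixes A :: "real^'n^'n"
  assumes "\<And>v. v \<noteq> 0 \<Longrightarrow> 0 < v \<bullet> (A *v v)"
  shows "A *v (matrix_inv A *v w) = w"
proof -
  have "inj ((*v) A)"
  proof (rule injI)
    fix x y assume "A *v x = A *v y"
    then have "A *v (x - y) = 0" by (simp add: matrix_vector_mult_diff_distrib)
    then show "x = y" using assms[of "x - y"] by force
  qed
  then have "invertible A" unfolding invertible_left_inverse matrix_left_invertible_injective .
  then have "A ** matrix_inv A = mat 1" unfolding invertible_def matrix_inv_def by (rule someI2_ex) simp
  then show ?thesis by (simp add: matrix_vector_mul_assoc)
qed

lemma inner_symmetric_matrix:
  fixes A :: "real^'n^'n"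
  assumes "transpose A = A"
  shows "x \<bullet> (A *v y) = y \<bullet> (A *v x)"
  using dot_lmul_matrix[of x A y] transpose_matrix_vector[of A x] assms by (simp add: inner_commute)

text \<open>The third identity says that the gyroscopic force has the power \<open>v \<bullet> DM(v) v / 2\<close>, which compensates
  the change of the kinetic energy due to \<open>M\<close>. This is what makes \<open>f\<close> preserve the energy.\<close>

lemma energy_derivative:
  assumes M: "Ms differentiable (at q)" and V: "V differentiable (at q)" and sym: "transpose (Ms q) = Ms q"
  defines "DM \<equiv> frechet_derivative Ms (at q)"
  shows "GDERIV (energy Ms V) (q, v) :> grad (energy Ms V) (q, v)"
    and "grad (energy Ms V) (q, v) \<bullet> (q', v') = v' \<bullet> (Ms q *v v) + v \<bullet> (DM q' *v v) / 2 + grad V q \<bullet> q'"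
    and "v \<bullet> gyro Ms q v = v \<bullet> (DM v *v v) / 2"
    and "gyro Ms q 0 = 0"
proof -
  interpret mv: bounded_bilinear "\<lambda>(A::real^'a^'a) (x::real^'a). A *v x" by (rule bounded_bilinear_matrix_vector)
  have dM: "(Ms has_derivative DM) (at q)" using M unfolding DM_def frechet_derivative_works .
  have dV: "(V has_derivative (\<lambda>h. grad V q \<bullet> h)) (at q)"
    using V GDERIV_grad(1) unfolding differentiable_def by (auto simp: gderiv_def inner_commute)
  note sy = inner_symmetric_matrix[OF sym]
  have f: "(fst has_derivative fst) (at (q, v))" by (auto intro!: derivative_eq_intros)
  have "((\<lambda>x. Ms (fst x)) has_derivative (\<lambda>h. DM (fst h))) (at (q, v))"
    using has_derivative_compose[OF f, of Ms DM] dM by simp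
  from mv.FDERIV[OF this has_derivative_snd[OF has_derivative_ident]]
  have d1: "((\<lambda>x. Ms (fst x) *v snd x) has_derivative (\<lambda>h. Ms q *v snd h + DM (fst h) *v v)) (at (q, v))" by simp
  have "((\<lambda>x. V (fst x)) has_derivative (\<lambda>h. grad V q \<bullet> fst h)) (at (q, v))"
    using has_derivative_compose[OF f, of V "\<lambda>h. grad V q \<bullet> h"] dV by simp
  then have "((\<lambda>x. (snd x \<bullet> (Ms (fst x) *v snd x)) / 2 + V (fst x)) has_derivative 
      (\<lambda>h. (v \<bullet> (Ms q *v snd h + DM (fst h) *v v) + snd h \<bullet> (Ms q *v v)) / 2 + grad V q \<bullet> fst h)) (at (q, v))"
    by (auto intro!: derivative_eq_intros d1)
  then have d: "(energy Ms V has_derivative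
      (\<lambda>h. (v \<bullet> (Ms q *v snd h + DM (fst h) *v v) + snd h \<bullet> (Ms q *v v)) / 2 + grad V q \<bullet> fst h)) (at (q, v))"
    by (simp add: energy_def kinetic_def case_prod_unfold)
  show "GDERIV (energy Ms V) (q, v) :> grad (energy Ms V) (q, v)" by (rule GDERIV_grad(1)[OF d])
  show "grad (energy Ms V) (q, v) \<bullet> (q', v') = v' \<bullet> (Ms q *v v) + v \<bullet> (DM q' *v v) / 2 + grad V q \<bullet> q'"
    unfolding GDERIV_grad(2)[OF d] by (simp add: inner_add_right sy[of v v'] add_divide_distrib)
  have dk: "((\<lambda>q'. kinetic Ms q' v) has_derivative (\<lambda>h. v \<bullet> (DM h *v v) / 2)) (at q)" for v
    unfolding kinetic_def using mv.FDERIV[OF dM has_derivative_const[of v]] by (auto intro!: derivative_eq_intros)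
  show "v \<bullet> gyro Ms q v = v \<bullet> (DM v *v v) / 2"
    using GDERIV_grad(2)[OF dk[of v], of v] by (simp add: gyro_def DM_def inner_diff_right inner_commute)
  have "grad (\<lambda>q'. kinetic Ms q' 0) q \<bullet> w = 0" for w using GDERIV_grad(2)[OF dk[of 0], of w] by simp
  then have "grad (\<lambda>q'. kinetic Ms q' 0) q = 0" by (metis inner_eq_zero_iff)
  then show "gyro Ms q 0 = 0" by (simp add: gyro_def)
qed

theorem theoremA2:
  fixes U :: "(real ^ 'n) set"
    and Ms :: "real ^ 'n \<Rightarrow> real ^ 'n ^ 'n"
    and V :: "real ^ 'n \<Rightarrow> real"
    and Q :: "'n forcing"
    and r m l :: nat
    and p :: "'n state"
    and \<tau> :: real
  defines "X \<equiv> U \<times> (UNIV :: (real ^ 'n) set)"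
    and "f \<equiv> cons_field Ms V"
    and "g \<equiv> pert_field Ms Q"
    and "H \<equiv> energy Ms V"
  assumes "mech_system U Ms V Q r"
    and "0 < m" "0 < l" "coprime l m"
    and "periodic_min X f p \<tau>"
    and "m_normal X f m p \<tau>"
  shows "\<forall>L. parametrises X f r m p \<tau> L \<longrightarrow>
           (\<exists>B. bifurcation_function X f g m l p \<tau> L (melnikov X f g H m l p \<tau>) B)"
proof (intro allI impI)
  fix L assume L: "parametrises X f r m p \<tau> L"
  note mech = assms(5)[unfolded mech_system_def]
  have U: "open U" and r: "2 \<le> r" and fC: "Ck_on r X f"
    and gC: "Ck_fst_on r ((X \<times> {0<..} \<times> {0..}) \<times> UNIV) (\<lambda>((x, T, \<epsilon>), t). g x t T \<epsilon>)"
    using mech by (auto simp: X_def f_def g_def)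
  have X: "open X" unfolding X_def using U by (intro open_Times) auto
  have q: "transpose (Ms q) = Ms q" "\<And>v. v \<noteq> 0 \<Longrightarrow> 0 < v \<bullet> (Ms q *v v)"
    "Ms differentiable (at q)" "V differentiable (at q)" if "q \<in> U" for q
    using mech that by auto
  show "\<exists>B. bifurcation_function X f g m l p \<tau> L (melnikov X f g H m l p \<tau>) B"
  proof (rule bifurcation_function_exists[OF X fC r gC _ _ _ assms(6,7,9) L])
    fix x assume "x \<in> X"
    then obtain y v where x: "x = (y, v)" and y: "y \<in> U" by (auto simp: X_def)
    note E = energy_derivative[OF q(3,4,1)[OF y]]
    show "GDERIV H x :> grad H x" unfolding H_def x by (rule E(1))
    show "grad H x \<bullet> f x = 0"
    proof -
      let ?w = "grad V y + gyro Ms y v"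
      have "Ms y *v (matrix_inv (Ms y) *v ?w) = ?w" by (rule matrix_inv_right[OF q(2)[OF y]])
      moreover have "(matrix_inv (Ms y) *v ?w) \<bullet> (Ms y *v v) = v \<bullet> (Ms y *v (matrix_inv (Ms y) *v ?w))"
        by (rule inner_symmetric_matrix[OF q(1)[OF y]])
      ultimately show ?thesis
        unfolding H_def f_def x cons_field_def prod.case E(2)
        using E(3) by (simp add: inner_add_right inner_commute)
    qed
    show "grad H x \<noteq> 0" if "f x \<noteq> 0"
    proof
      assume "grad H x = 0"
      then have z: "v' \<bullet> (Ms y *v v) + v \<bullet> (frechet_derivative Ms (at y) q' *v v) / 2 + grad V y \<bullet> q' = 0" for q' v'
        using E(2)[of v q' v'] by (simp add: H_def x)
      have "frechet_derivative Ms (at y) 0 = 0" 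
        using linear_frechet_derivative[OF q(3)[OF y]] linear_0 by blast
      then have "v \<bullet> (Ms y *v v) = 0" using z[of v 0] by simp
      then have v: "v = 0" using q(2)[OF y, of v] by force
      then have "grad V y \<bullet> grad V y = 0" using z[of 0 "grad V y"] by simp
      then have "f x = 0" unfolding f_def x cons_field_def using v E(4) by (simp add: zero_prod_def)
      then show False using that by simp
    qed
  qed
qed

end
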